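(* Let $\Omega\subset\mathbb{X}$ be a nonempty closed set, let $f:\mathbb{X}\to(-\infty,+\infty]$ be bounded from below, coercive on $\Omega$ and locally Lipschitz continuous on $\Omega$, let $\nu>0$, let $\phi\in\mathscr{L}$, and let $\psi$ be the function equal to $\phi$ on $[0,1]$ and $+\infty$ elsewhere, with conjugate $\psi^*$. If for each $r\in\{1,2,\ldots,n\}$ the mapping $\mathcal{S}_r$ is calm at $0$ for all $X\in\mathcal{S}_r(0)$, then there exists a threshold $\overline{\rho}>0$ such that for every $\rho\ge\overline{\rho}$ the problem $$\min_{X\in\Omega}\Big\{f(X)+\nu\rho\Big[\|X\|_*-\rho^{-1}\sum_{i=1}^n\psi^*(\rho\sigma_i(X))\Big]\Big\}$$ has the same global optimal solution set as the problem $$\min_{X\in\Omega}\big\{f(X)+\nu\,\mathrm{rank}(X)\big\}.$$ Moreover, the assumption that for each $r\in\{1,\ldots,n\}$ the mapping $\mathcal{S}_r$ is calm at $0$ for all $X\in\mathcal{S}_r(0)$ automatically holds when $\Omega$ is any of the following sets: (1) $\Omega=\{Z\in\mathbb{X}\,|\,|||Z|||\le\varrho\}$ with $\varrho>0$ and $|||\cdot|||$ an arbitrary matrix norm; or $\Omega=\{Z\in\mathbb{X}\,|\,\|Z\|_F=\varrho\}$ with $\varrho>0$; or ($\mathbb{X}=\mathbb{S}^n$) $\Omega=\mathbb{S}_+^n\cap\{Z\in\mathbb{S}^n\,|\,|||Z|||\le\varrho\}$; (2) ($\mathbb{X}=\mathbb{S}^n$) $\Omega=\mathbb{S}_+^n\cap\{X\in\mathbb{S}^n\,|\,\mathrm{diag}(X)=e\}$;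 (3) ($\mathbb{X}=\mathbb{S}^n$) $\Omega=\mathbb{S}_+^n\cap\{X\in\mathbb{S}^n\,|\,\langle B,X\rangle=b_1,\ \langle C,X\rangle=b_2\}$ with $b_1\in\mathbb{R}$, $b_2\in\mathbb{R}\setminus\{0\}$ and $B,C\in\mathbb{S}^n$ such that $B-(b_1/b_2)C$ is nonsingular; or $\Omega=\mathbb{S}_+^n\cap\{X\in\mathbb{S}^n\,|\,\langle C,X\rangle=b_2\}$ with $b_2\in\mathbb{R}\setminus\{0\}$ and $C\in\mathbb{S}^n$ nonsingular; (4) ($\mathbb{X}=\mathbb{S}^n$) $\Omega=\mathbb{S}_+^n\cap\{X\in\mathbb{S}^n\,|\,X_{11}=1,\ X_{ii}-\tfrac12(X_{1i}+X_{i1})=0\ \text{for}\ i=2,\ldots,n\}$; (5) ($\mathbb{X}=\mathbb{S}^n$, $n=kp$) $\Omega=\mathbb{S}_+^n\cap\{X\in\mathbb{S}^n\,|\,\langle I,X_{ii}\rangle=1,\ \langle I,X_{ij}\rangle=0\ \text{for}\ i\ne j\in\{1,\ldots,k\}\}$, where $X_{ij}$ is the $(i,j)$-th $p\times p$ block of $X$ and $\langle I,X_{ii}\rangle=1$ is required for all $i\in\{1,\ldots,k\}$; (6) ($\mathbb{X}=\mathbb{R}^{n\times n}$) $\Omega=\{X\in\mathbb{R}_+^{n\times n}\,|\,Xe=e\}$; (7) ($\mathbb{X}=\mathbb{R}^{n\times n}$) $\Omega=\{X\in\mathbb{R}_+^{n\times n}\,|\,Xe=e,\ X^{\mathbb{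T}}e=e\}$.
   Context: $\mathbb{X}$ denotes either $\mathbb{R}^{n\times m}$ (with $n\le m$) or the space $\mathbb{S}^n$ of $n\times n$ real symmetric matrices, equipped with the trace inner product and the Frobenius norm $\|\cdot\|_F$; $\mathbb{S}_+^n$ is the cone of positive semidefinite matrices, $\mathbb{R}_+^{n\times n}$ the set of entrywise nonnegative matrices, $e$ the all-ones vector, $I$ the identity matrix. $\sigma_1(X)\ge\cdots\ge\sigma_n(X)$ are the singular values of $X$; $\|X\|_*=\sum_{i=1}^n\sigma_i(X)$ is the nuclear norm and $\|X\|_{(r)}=\sum_{i=1}^r\sigma_i(X)$ is the Ky-Fan $r$-norm. The multifunction $\mathcal{S}_r:\mathbb{R}\rightrightarrows\mathbb{X}$ is $\mathcal{S}_r(\tau):=\{X\in\Omega\,|\,\|X\|_*-\|X\|_{(r)}=\tau\}$, so $\mathcal{S}_r(0)=\{X\in\Omega\,|\,\mathrm{rank}(X)\le r\}$. $\mathscr{L}$ is the family of proper lower semicontinuous convex functions $\phi$ on $\mathbb{R}$ such that $\mathrm{int}(\mathrm{dom}\,\phi)\supseteq[0,1]$, $\phi(t^* )=0$ where $t^*:=\arg\min_{0\le t\le1}\phi(t)$, and $\phi(1)=1$. The conjugate is $\psi^*(s)=\sup_{t\in\mathbb{R}}\{st-\psi(t)\}=\sup_{t\in[0,1]}\{st-\phi(t)\}$. $f$ coercive on $\Omega$ means $f(X)\to+\infty$ as $\|X\|_F\to\infty$ with $X\in\Omega$. $f$ locally Lipschitz continuous on $\Omega$ means $f$ is finite on $\Omega$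 and each point of $\Omega$ has a neighborhood $N$ such that $f$ is Lipschitz on $N\cap\Omega$. Calmness: a multifunction $\mathcal{M}:\mathbb{Y}\rightrightarrows\mathbb{Z}$ between finite-dimensional Euclidean spaces is calm at $\overline{y}$ for $\overline{z}\in\mathcal{M}(\overline{y})$ if there exist $\gamma\ge0$, $\varepsilon>0$, $\delta>0$ such that for all $y$ with $\|y-\overline{y}\|\le\varepsilon$, $\mathcal{M}(y)\cap\mathbb{B}(\overline{z},\delta)\subseteq\mathcal{M}(\overline{y})+\gamma\|y-\overline{y}\|\mathbb{B}_{\mathbb{Z}}$, where $\mathbb{B}(\overline z,\delta)$ is the closed ball and $\mathbb{B}_{\mathbb{Z}}$ the closed unit ball. *)

theory Defs
  imports "HOL-Analysis.Analysis" "HOL-Computational_Algebra.Polynomial"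
begin

text \<open>
  An \<open>n \<times> m\<close> real matrix is an element of \<open>real^'m^'n\<close> with \<open>n = CARD('n)\<close> and
  \<open>m = CARD('m)\<close>. On this type the library's \<open>norm\<close> is the Frobenius norm and its inner
  product is the trace inner product.
\<close>

definition sym_mats :: "(real^'n^'n) set" where
  "sym_mats = {X. transpose X = X}"

definition psd_mats :: "(real^'n^'n) set" where
  "psd_mats = {X \<in> sym_mats. \<forall>v. 0 \<le> v \<bullet> (X *v v)}"

definition block :: "real^('k::finite \<times> 'p::finite)^('k \<times> 'p) \<Rightarrow> 'k \<Rightarrow> 'k \<Rightarrow> real^'p^'p" where
  "block X i j = (\<chi> a b. X $ (i, a) $ (j, b))"

text \<open>A norm on a linear subspace \<open>V\<close>; nothing is required of \<open>N\<close> outside \<open>V\<close>.\<close>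

definition norm_on :: "'a::real_vector set \<Rightarrow> ('a \<Rightarrow> real) \<Rightarrow> bool" where
  "norm_on V N \<longleftrightarrow>
     (\<forall>X\<in>V. 0 \<le> N X \<and> (N X = 0 \<longleftrightarrow> X = 0)) \<and>
     (\<forall>a. \<forall>X\<in>V. N (a *\<^sub>R X) = \<bar>a\<bar> * N X) \<and>
     (\<forall>X\<in>V. \<forall>Y\<in>V. N (X + Y) \<le> N X + N Y)"


definition charpoly :: "real^'n^'n \<Rightarrow> real poly" where
  "charpoly A = det (\<chi> i j. (if i = j then [:0, 1:] else 0) - [:A $ i $ j:])"

text \<open>
  The singular values are the square roots of the eigenvalues of \<open>X X\<^sup>T\<close>, listed in
  nonincreasing order and repeated according to multiplicity. As \<open>X X\<^sup>T\<close> is a symmetric positive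
  semidefinite \<open>n \<times> n\<close> matrix, there are exactly \<open>n\<close> of them. The index \<open>i\<close> of
  \<open>sing_val i X\<close> runs through \<open>1, \<dots>, n\<close>.
\<close>

definition sing_vals :: "real^'m^'n \<Rightarrow> real list" where
  "sing_vals X =
     rev (sorted_list_of_multiset (image_mset sqrt (proots (charpoly (X ** transpose X)))))"

definition sing_val :: "nat \<Rightarrow> real^'m^'n \<Rightarrow> real" where
  "sing_val i X = sing_vals X ! (i - 1)"

definition nuclear_norm :: "real^'m^'n \<Rightarrow> real" where
  "nuclear_norm X = (\<Sum>i = 1..CARD('n). sing_val i X)"

definition ky_fan_norm :: "nat \<Rightarrow> real^'m^'n \<Rightarrow> real" where
  "ky_fan_norm r X = (\<Sum>i = 1..r. sing_val i X)"

definition S_map :: "(real^'m^'n) set \<Rightarrow> nat \<Rightarrow> real \<Rightarrow> (real^'m^'n) set" where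
  "S_map \<Omega> r \<tau> = {X \<in> \<Omega>. nuclear_norm X - ky_fan_norm r X = \<tau>}"


text \<open>
  If \<open>M\<close> takes its values in a linear subspace (such as the symmetric matrices), the unit
  ball of the ambient space may be used in place of that of the subspace: a difference of two
  elements of the subspace lies in the subspace.
\<close>

definition calm_at ::
  "('a::euclidean_space \<Rightarrow> 'b::euclidean_space set) \<Rightarrow> 'a \<Rightarrow> 'b \<Rightarrow> bool" where
  "calm_at M y0 z0 \<longleftrightarrow> z0 \<in> M y0 \<and>
     (\<exists>\<gamma>\<ge>0. \<exists>\<epsilon>>0. \<exists>\<delta>>0. \<forall>y. norm (y - y0) \<le> \<epsilon> \<longrightarrow>
        M y \<inter> cball z0 \<delta> \<subseteq> {z + (\<gamma> * norm (y - y0)) *\<^sub>R u |z u. z \<in> M y0 \<and> u \<in> cball 0 1})"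

definition all_calm :: "(real^'m^'n) set \<Rightarrow> bool" where
  "all_calm \<Omega> \<longleftrightarrow>
     (\<forall>r\<in>{1..CARD('n)}. \<forall>X \<in> S_map \<Omega> r 0. calm_at (S_map \<Omega> r) 0 X)"


definition bounded_below_on :: "'a set \<Rightarrow> ('a \<Rightarrow> ereal) \<Rightarrow> bool" where
  "bounded_below_on V f \<longleftrightarrow> (\<exists>c::real. \<forall>X\<in>V. ereal c \<le> f X)"

definition coercive_on :: "'a::real_normed_vector set \<Rightarrow> ('a \<Rightarrow> ereal) \<Rightarrow> bool" where
  "coercive_on \<Omega> f \<longleftrightarrow> (f \<longlongrightarrow> \<infinity>) (inf at_infinity (principal \<Omega>))"

definition locally_lipschitz_on :: "'a::real_normed_vector set \<Rightarrow> ('a \<Rightarrow> ereal) \<Rightarrow> bool" where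
  "locally_lipschitz_on \<Omega> f \<longleftrightarrow>
     (\<forall>X\<in>\<Omega>. \<bar>f X\<bar> \<noteq> \<infinity>) \<and>
     (\<forall>X\<in>\<Omega>. \<exists>U L. open U \<and> X \<in> U \<and> lipschitz_on L (U \<inter> \<Omega>) (\<lambda>Y. real_of_ereal (f Y)))"


text \<open>
  The class \<open>\<L>\<close>: proper, lower semicontinuous, convex (convex epigraph), and the
  conditions relating \<open>\<phi>\<close> to \<open>[0,1]\<close>. The minimiser over \<open>[0,1]\<close> need not be unique; the
  condition says that the minimum value is \<open>0\<close>.
\<close>

definition phi_class :: "(real \<Rightarrow> ereal) set" where
  "phi_class = {\<phi>.
     (\<forall>t. \<phi> t \<noteq> -\<infinity>) \<and> (\<exists>t. \<phi> t < \<infinity>) \<and>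
     (\<forall>t. \<phi> t \<le> Liminf (at t) \<phi>) \<and>
     convex {(t, a :: real). \<phi> t \<le> ereal a} \<and>
     {0..1} \<subseteq> interior {t. \<phi> t < \<infinity>} \<and>
     (\<exists>t. is_arg_min \<phi> (\<lambda>s. s \<in> {0..1}) t \<and> \<phi> t = 0) \<and>
     \<phi> 1 = 1}"

definition psi_of :: "(real \<Rightarrow> ereal) \<Rightarrow> real \<Rightarrow> ereal" where
  "psi_of \<phi> t = (if t \<in> {0..1} then \<phi> t else \<infinity>)"

definition conjugate :: "(real \<Rightarrow> ereal) \<Rightarrow> real \<Rightarrow> ereal" where
  "conjugate h s = (SUP t. ereal (s * t) - h t)"

definition rank_objective ::
  "(real^'m^'n \<Rightarrow> ereal) \<Rightarrow> real \<Rightarrow> real^'m^'n \<Rightarrow> ereal" where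
  "rank_objective f \<nu> X = f X + ereal (\<nu> * real (rank X))"

definition surrogate_objective ::
  "(real^'m^'n \<Rightarrow> ereal) \<Rightarrow> real \<Rightarrow> (real \<Rightarrow> ereal) \<Rightarrow> real \<Rightarrow> real^'m^'n \<Rightarrow> ereal" where
  "surrogate_objective f \<nu> \<phi> \<rho> X =
     f X + ereal (\<nu> * \<rho>) *
       (ereal (nuclear_norm X) -
        ereal (inverse \<rho>) * (\<Sum>i = 1..CARD('n). conjugate (psi_of \<phi>) (\<rho> * sing_val i X)))"

definition solution_set :: "'a set \<Rightarrow> ('a \<Rightarrow> ereal) \<Rightarrow> 'a set" where
  "solution_set \<Omega> F = {X. is_arg_min F (\<lambda>Y. Y \<in> \<Omega>) X}"

end

theory Submission
  imports Defs "HOL-Combinatorics.List_Permutation"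
begin

text \<open>Write \<open>T\<^sub>r X\<close> for the sum of the singular values of \<open>X\<close> after the first \<open>r\<close>, that is, the nuclear norm
minus the Ky-Fan \<open>r\<close>-norm. Up to the factor \<open>n\<close> this is the distance from \<open>X\<close> to the matrices of
rank at most \<open>r\<close>: truncating a singular value decomposition gives a matrix of rank at most \<open>r\<close> within
\<open>T\<^sub>r X\<close> of \<open>X\<close> (\<open>low_rank_approx\<close>, and \<open>low_rank_approx_sym\<close>, which keeps symmetry and positive
semidefiniteness), and every matrix of rank at most \<open>r\<close> has distance at least the
\<open>(r + 1)\<close>-st singular value from \<open>X\<close> (\<open>tail_sum_le_dist\<close>). These two estimates are all that is
used of the perturbation theory of singular values.

Exactness of the penalty. Set \<open>G s = s - \<psi>\<^sup>* s\<close>. Convexity of \<open>\<phi>\<close> and \<open>1\<close> being interior to its domain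
give a constant \<open>K\<close> with \<open>min 1 (s / K) \<le> G s \<le> 1\<close> for \<open>s \<ge> 0\<close>, and \<open>G 0 = 0\<close>
(\<open>conjugate_bounds\<close>); the surrogate replaces the rank by the sum of the \<open>G (\<rho> \<sigma>\<^sub>k)\<close>, so it never
exceeds the rank objective. It remains to show that wherever it is strictly smaller, some feasible
point has a still smaller rank objective. Near a feasible point of rank \<open>r\<close> the first \<open>r\<close> singular
values stay away from zero and contribute exactly \<open>r\<close> once \<open>\<rho>\<close> is large. Calmness yields a feasible
\<open>Y\<close> of rank at most \<open>r\<close> with distance \<open>O(T\<^sub>r X)\<close> from \<open>X\<close>; moving to \<open>Y\<close> raises \<open>f\<close> by \<open>O(T\<^sub>r X)\<close>
only, while the remaining penalty is at least \<open>min 1 (\<rho> T\<^sub>r X / K)\<close>, which wins for large \<open>\<rho>\<close>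
(\<open>local_exactness\<close>). Coercivity leaves a compact region to cover by finitely many such
neighbourhoods (\<open>exact_penalty\<close>).

Calmness of the constraint sets. By \<open>all_calmI\<close> one has to move a feasible \<open>X\<close> with small \<open>T\<^sub>r X\<close> to a
feasible point of rank at most \<open>r\<close> at distance \<open>O(T\<^sub>r X)\<close>. For balls and spheres the truncation is
rescaled. In the positive semidefinite families the truncation \<open>P\<close> is repaired by a congruence
\<open>P \<mapsto> L P L\<^sup>T\<close> with \<open>L\<close> close to the identity, which does not raise the rank and keeps semidefiniteness:
for the correlation, binary and block constraints \<open>L\<close> normalises a Gram factorisation of \<open>P\<close>, for the
linear slices it combines a scaling with the solution of a quadratic equation. For the two polytopes of stochastic matrices truncation
destroys nonnegativity, so one descends instead: if \<open>P\<close> is a nearest matrix of rank at most \<open>r\<close> to a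
feasible \<open>Z\<close>, then \<open>E = Z - P\<close> is normal to the low-rank matrices at \<open>P\<close>, and together with the row
sums of \<open>Z\<close> this forces the column sums (in the doubly stochastic case also the row sums) of \<open>E\<close> to
be of second order in \<open>E\<close>. Hence some feasible direction decreases the distance to the low-rank
matrices at a uniform rate, and minimising that distance plus a small multiple of the distance to
\<open>X\<close> reaches rank at most \<open>r\<close> (\<open>descent_error_bound\<close>).\<close>

section \<open>Spectral theorem and singular values\<close>

text \<open>Along \<open>v + t w\<close>, where \<open>w = f v - (v \<bullet> f v) v\<close> is orthogonal to \<open>v\<close>, the quadratic form would increase at
first order in \<open>t\<close> unless \<open>w = 0\<close>.\<close>

lemma self_adjoint_max_eigen:
  fixes f :: "'a::euclidean_space \<Rightarrow> 'a"
  assumes lin: "linear f" and sa: "\<And>x y. f x \<bullet> y = x \<bullet> f y"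
    and S: "subspace S" and inv: "f ` S \<subseteq> S" and v: "v \<in> S" "norm v = 1"
    and mx: "\<And>x. x \<in> S \<Longrightarrow> norm x = 1 \<Longrightarrow> x \<bullet> f x \<le> v \<bullet> f v"
  shows "f v = (v \<bullet> f v) *\<^sub>R v"
proof -
  define l where "l = v \<bullet> f v"
  define w where "w = f v - l *\<^sub>R v"
  have wS: "w \<in> S" unfolding w_def using inv v S by (auto intro!: subspace_diff subspace_scale)
  have vv: "v \<bullet> v = 1" using v by (simp add: dot_square_norm)
  have wv: "w \<bullet> v = 0" unfolding w_def by (simp add: inner_diff_left vv) (simp add: l_def inner_commute)
  have q: "x \<bullet> f x \<le> l * (x \<bullet> x)" if x: "x \<in> S" for x
  proof (cases "x = 0")
    case False
    define y where "y = (1 / norm x) *\<^sub>R x"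
    have "y \<in> S" "norm y = 1" using False x S by (auto simp: y_def subspace_scale)
    then have "y \<bullet> f y \<le> l" using mx l_def by auto
    moreover have "y \<bullet> f y = (x \<bullet> f x) / (norm x)^2"
      by (simp add: y_def linear_scale[OF lin] power2_eq_square)
    ultimately show ?thesis using False by (simp add: field_simps dot_square_norm)
  qed (simp add: linear_0[OF lin])
  have wfv: "w \<bullet> f v = w \<bullet> w" by (simp add: w_def inner_diff_right) (simp add: w_def[symmetric] wv)
  have main: "2 * t * (w \<bullet> w) \<le> t^2 * (l * (w \<bullet> w) - w \<bullet> f w)" for t
  proof -
    have "v + t *\<^sub>R w \<in> S" using v wS S by (simp add: subspace_add subspace_scale)
    from q[OF this] have "l + 2 * t * (w \<bullet> f v) + t^2 * (w \<bullet> f w) \<le> l * (1 + t^2 * (w \<bullet> w))"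
      using sa[of v w] wv
      by (simp add: linear_add[OF lin] linear_scale[OF lin] inner_add_left inner_add_right vv
          inner_commute[of v w] inner_commute[of "f v" w] power2_eq_square l_def[symmetric] algebra_simps)
    then show ?thesis unfolding wfv by (simp add: algebra_simps)
  qed
  have "w \<bullet> w = 0"
  proof (rule ccontr)
    assume "w \<bullet> w \<noteq> 0"
    then have p: "w \<bullet> w > 0" using inner_ge_zero[of w] by linarith
    define c where "c = \<bar>l * (w \<bullet> w) - w \<bullet> f w\<bar> + 1"
    have c: "c > 0" by (simp add: c_def)
    define t where "t = (w \<bullet> w) / c"
    have t: "t > 0" using p c by (simp add: t_def)
    have "2 * t * (w \<bullet> w) \<le> t^2 * c"
      using main[of t] by (smt (verit) c_def mult_left_mono zero_le_power2)
    then have "2 * (w \<bullet> w) \<le> t * c" using t by (simp add: power2_eq_square)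
    then show False using p c by (simp add: t_def)
  qed
  then show ?thesis by (simp add: w_def l_def)
qed

text \<open>Split off a maximiser of the quadratic form on the unit sphere and continue on its orthogonal
complement, which is again invariant.\<close>

lemma self_adjoint_eigenbasis_subspace:
  fixes f :: "'a::euclidean_space \<Rightarrow> 'a"
  assumes lin: "linear f" and sa: "\<And>x y. f x \<bullet> y = x \<bullet> f y"
    and S: "subspace S" and inv: "f ` S \<subseteq> S"
  shows "\<exists>B. B \<subseteq> S \<and> pairwise orthogonal B \<and> (\<forall>x\<in>B. norm x = 1 \<and> f x = (x \<bullet> f x) *\<^sub>R x) \<and> span B = S"
  using S inv
proof (induction "dim S" arbitrary: S rule: less_induct)
  case less
  show ?case
  proof (cases "S \<subseteq> {0}")
    case True
    then have "S = {0}" using less.prems subspace_0 by blast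
    then show ?thesis by (intro exI[of _ "{}"]) auto
  next
    case False
    then obtain x0 where x0: "x0 \<in> S" "x0 \<noteq> 0" by auto
    let ?K = "S \<inter> sphere 0 1"
    have "compact ?K" using closed_subspace[OF less.prems(1)] by (simp add: closed_Int_compact)
    moreover have "(1 / norm x0) *\<^sub>R x0 \<in> ?K" using x0 less.prems by (simp add: subspace_scale)
    then have "?K \<noteq> {}" by blast
    moreover have "continuous_on ?K (\<lambda>x. x \<bullet> f x)"
      using lin by (intro continuous_intros linear_continuous_on) (simp add: linear_conv_bounded_linear)
    ultimately obtain v where v: "v \<in> ?K" and mx: "\<And>x. x \<in> ?K \<Longrightarrow> x \<bullet> f x \<le> v \<bullet> f v"
      using continuous_attains_sup[of ?K "\<lambda>x. x \<bullet> f x"] by blast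
    have ev: "f v = (v \<bullet> f v) *\<^sub>R v"
      using self_adjoint_max_eigen[OF lin sa less.prems, of v] v mx by auto
    have vv: "v \<bullet> v = 1" using v by (simp add: dot_square_norm)
    define S' where "S' = {x \<in> S. v \<bullet> x = 0}"
    have sub': "subspace S'" using less.prems(1)
      unfolding S'_def subspace_def by (auto simp: inner_add_right)
    have inv': "f ` S' \<subseteq> S'"
    proof
      fix y assume "y \<in> f ` S'"
      then obtain x where x: "x \<in> S" "v \<bullet> x = 0" "y = f x" by (auto simp: S'_def)
      have "v \<bullet> f x = f v \<bullet> x" by (simp add: sa)
      also have "\<dots> = 0" by (subst ev) (simp add: x)
      finally show "y \<in> S'" using x less.prems by (auto simp: S'_def)
    qed
    have "v \<notin> S'" "S' \<subseteq> S" using vv by (auto simp: S'_def)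
    then have "S' \<subset> S" using v by auto
    then have "dim S' < dim S"
      using sub' less.prems(1) by (metis dim_psubset span_eq_iff)
    from less.hyps[OF this sub' inv'] obtain B where
      B: "B \<subseteq> S'" "pairwise orthogonal B" "\<forall>x\<in>B. norm x = 1 \<and> f x = (x \<bullet> f x) *\<^sub>R x" "span B = S'"
      by blast
    have "span (insert v B) = S"
    proof
      show "span (insert v B) \<subseteq> S" using B v less.prems(1) by (intro span_minimal) (auto simp: S'_def)
      show "S \<subseteq> span (insert v B)"
      proof
        fix x assume x: "x \<in> S"
        have "x - (v \<bullet> x) *\<^sub>R v \<in> S'"
          using x v vv less.prems(1) by (auto simp: S'_def subspace_diff subspace_scale inner_diff_right)
        then show "x \<in> span (insert v B)" using B(4) by (auto simp: span_insert)
      qed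
    qed
    moreover have "pairwise orthogonal (insert v B)"
      using B(1,2) by (auto simp: pairwise_insert S'_def orthogonal_def inner_commute)
    ultimately show ?thesis using B v ev
      by (intro exI[of _ "insert v B"]) (auto simp: S'_def)
  qed
qed

definition orthonormal :: "('i \<Rightarrow> 'a::real_inner) \<Rightarrow> bool" where
  "orthonormal u \<longleftrightarrow> (\<forall>i j. u i \<bullet> u j = (if i = j then 1 else 0))"

lemma spectral_theorem:
  fixes A :: "real^'n^'n"
  assumes "transpose A = A"
  obtains u :: "'n \<Rightarrow> real^'n" and \<mu> where "orthonormal u" "\<And>i. A *v u i = \<mu> i *\<^sub>R u i"
proof -
  have sa: "(A *v x) \<bullet> y = x \<bullet> (A *v y)" for x y
    using assms by (metis dot_lmul_matrix transpose_matrix_vector)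
  obtain B where B: "pairwise orthogonal B" "\<forall>x\<in>B. norm x = 1 \<and> A *v x = (x \<bullet> (A *v x)) *\<^sub>R x"
      "span B = (UNIV :: (real^'n) set)"
    using self_adjoint_eigenbasis_subspace[of "(*v) A" UNIV] sa by auto
  have ind: "independent B" using B by (intro pairwise_orthogonal_independent) auto
  have fin: "finite B" using ind independent_imp_finite by blast
  have "card B = CARD('n)"
    using dim_eq_card[of B UNIV] B(3) ind by simp
  then obtain u where u: "bij_betw u (UNIV :: 'n set) B"
    using fin by (metis finite_class.finite_UNIV finite_same_card_bij)
  show thesis
  proof (rule that[of u "\<lambda>i. u i \<bullet> (A *v u i)"])
    have "u i \<in> B" for i using u by (auto simp: bij_betw_def)
    then show "A *v u i = (u i \<bullet> (A *v u i)) *\<^sub>R u i" for i using B by auto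
    have "u i \<bullet> u j = (if i = j then 1 else 0)" for i j
    proof (cases "i = j")
      case True then show ?thesis using \<open>\<And>i. u i \<in> B\<close>[of i] B(2) by (auto simp: dot_square_norm)
    next
      case False
      then have "u i \<noteq> u j" using u by (metis UNIV_I bij_betw_def inj_on_eq_iff)
      then show ?thesis using B(1) \<open>\<And>i. u i \<in> B\<close> False by (auto simp: pairwise_def orthogonal_def)
    qed
    then show "orthonormal u" by (simp add: orthonormal_def)
  qed
qed

lemma orthonormal_expansion:
  fixes u :: "'n \<Rightarrow> real^'n"
  assumes "orthonormal u"
  shows "(\<Sum>i\<in>UNIV. (u i \<bullet> x) *\<^sub>R u i) = x"
proof -
  define U where "U = (\<chi> i. u i)"
  have "U ** transpose U = mat 1"
    using assms by (simp add: U_def matrix_mult_transpose_dot_row row_def orthonormal_def mat_def vec_eq_iff)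
  then have "transpose U ** U = mat 1" by (simp add: matrix_left_right_inverse)
  then have "transpose U *v (U *v x) = x" by (simp add: matrix_vector_mul_assoc)
  moreover have "transpose U *v y = (\<Sum>i\<in>UNIV. y $ i *\<^sub>R u i)" for y
    by (simp add: matrix_mult_sum column_def transpose_def U_def scalar_mult_eq_scaleR)
  ultimately show ?thesis by (simp add: matrix_vector_mul_component U_def)
qed

text \<open>With the eigenvectors as the rows of \<open>U\<close>, the characteristic matrix satisfies \<open>U (x I - A) = (x I - D) U\<close> over
the polynomial ring, and \<open>det U\<close> is a nonzero constant, so it cancels.\<close>

lemma charpoly_eigenbasis:
  fixes A :: "real^'n^'n" and u :: "'n \<Rightarrow> real^'n"
  assumes "orthonormal u" "\<And>i. A *v u i = \<mu> i *\<^sub>R u i"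
  shows "charpoly A = (\<Prod>i\<in>UNIV. [:- \<mu> i, 1:])"
proof -
  let ?C = "\<lambda>M :: real^'n^'n. (\<chi> i j. [:M $ i $ j:]) :: real poly^'n^'n"
  let ?D = "(\<chi> i j. if i = j then [:- \<mu> i, 1:] else 0) :: real poly^'n^'n"
  let ?X = "(\<chi> i j. (if i = j then [:0, 1:] else 0) - [:A $ i $ j:]) :: real poly^'n^'n"
  define U where "U = (\<chi> i. u i)"
  have UU: "U ** transpose U = mat 1"
    using assms by (simp add: U_def matrix_mult_transpose_dot_row row_def orthonormal_def mat_def vec_eq_iff)
  have sumC: "(\<Sum>k\<in>K. [:g k:]) = [:\<Sum>k\<in>K. g k:]" for g :: "'n \<Rightarrow> real" and K
    by (induction K rule: infinite_finite_induct) auto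
  have Cmul: "?C M ** ?C M' = ?C (M ** M')" for M M'
    by (simp add: matrix_matrix_mult_def vec_eq_iff sumC)
      (intro allI sum.cong refl mult.commute)
  have "?C U ** ?X = ?D ** ?C U"
  proof -
    have "u i v* A = \<mu> i *\<^sub>R u i" for i
    proof -
      have "(\<Sum>j\<in>UNIV. (u j \<bullet> (u i v* A)) *\<^sub>R u j) = u i v* A"
        by (rule orthonormal_expansion[OF assms(1)])
      moreover have "u j \<bullet> (u i v* A) = (if j = i then \<mu> i else 0)" for j
        using assms by (simp add: inner_commute[of "u j"] dot_lmul_matrix orthonormal_def)
      ultimately show ?thesis by (simp add: if_distrib[of "\<lambda>x. x *\<^sub>R _"] cong: if_cong)
    qed
    then have "(u i v* A) $ j = (\<mu> i *\<^sub>R u i) $ j" for i j by simp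
    then have e: "(\<Sum>k\<in>UNIV. u i $ k * A $ k $ j) = \<mu> i * u i $ j" for i j
      by (simp add: vector_matrix_mult_def mult.commute)
    have "(\<Sum>k\<in>UNIV. [:u i $ k:] * ((if k = j then [:0, 1:] else 0) - [:A $ k $ j:]))
       = (\<Sum>k\<in>UNIV. (if i = k then [:- \<mu> i, 1:] else 0) * [:u k $ j:])" for i j
    proof -
      have "(\<Sum>k\<in>UNIV. [:u i $ k:] * ((if k = j then [:0, 1:] else 0) - [:A $ k $ j:]))
        = (\<Sum>k\<in>UNIV. (if k = j then [:u i $ k:] * [:0, 1:] else 0)) - (\<Sum>k\<in>UNIV. [:u i $ k * A $ k $ j:])"
        unfolding sum_subtractf[symmetric] by (intro sum.cong refl) (auto simp: right_diff_distrib)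
      also have "\<dots> = [:u i $ j:] * [:0,1:] - [:\<mu> i * u i $ j:]" by (simp add: sumC e)
      also have "\<dots> = [:- \<mu> i, 1:] * [:u i $ j:]" by simp
      also have "\<dots> = (\<Sum>k\<in>UNIV. (if i = k then [:- \<mu> i, 1:] * [:u k $ j:] else 0))"
        by simp
      also have "\<dots> = (\<Sum>k\<in>UNIV. (if i = k then [:- \<mu> i, 1:] else 0) * [:u k $ j:])"
        by (intro sum.cong) auto
      finally show ?thesis .
    qed
    then show ?thesis by (simp add: matrix_matrix_mult_def vec_eq_iff U_def)
  qed
  moreover have "det (?C U) * det (?C (transpose U)) = 1"
    by (simp only: det_mul[symmetric] Cmul UU) (simp add: mat_def if_distrib det_diagonal one_pCons[symmetric] cong: if_cong)
  ultimately have "det ?X = det ?D"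
  proof -
    assume h: "?C U ** ?X = ?D ** ?C U" and 1: "det (?C U) * det (?C (transpose U)) = 1"
    have "det (?C U) * det ?X = det ?D * det (?C U)"
      using arg_cong[OF h, of det] by (simp only: det_mul)
    then have "det (?C U) * (det ?X - det ?D) = 0" by (simp add: algebra_simps)
    moreover have "det (?C U) \<noteq> 0" using 1 by auto
    ultimately show ?thesis by simp
  qed
  also have "det ?D = (\<Prod>i\<in>UNIV. [:- \<mu> i, 1:])" by (subst det_diagonal) auto
  finally show ?thesis by (simp add: charpoly_def)
qed

text \<open>Any orthonormal eigenbasis of \<open>X X\<^sup>T\<close> lists the singular values in some order. The freedom in the choice of
the basis matters: for symmetric \<open>X\<close> an eigenbasis of \<open>X\<close> itself can be taken, whereas an arbitrary
eigenbasis of \<open>X\<^sup>2\<close> would yield truncations that are not symmetric.\<close>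

lemma sing_vals_eigenbasis:
  fixes X :: "real^'m^'n" and u :: "'n \<Rightarrow> real^'n"
  assumes "orthonormal u" "\<And>i. (X ** transpose X) *v u i = \<mu> i *\<^sub>R u i"
  obtains b where "bij_betw b {1..CARD('n)} UNIV" "\<And>k. k \<in> {1..CARD('n)} \<Longrightarrow> sing_val k X = sqrt (\<mu> (b k))"
    "sorted_wrt (\<ge>) (sing_vals X)" "length (sing_vals X) = CARD('n)"
proof -
  have sum_single: "(\<Sum>i\<in>A. {#\<mu> i#}) = image_mset \<mu> (mset_set A)" if "finite A" for A :: "'n set"
    using that by (induction A rule: finite_induct) auto
  have "proots (charpoly (X ** transpose X)) = (\<Sum>i\<in>UNIV. {#\<mu> i#})"
    unfolding charpoly_eigenbasis[OF assms] by (subst proots_prod) auto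
  then have *: "proots (charpoly (X ** transpose X)) = image_mset \<mu> (mset_set UNIV)"
    by (simp only: sum_single[OF finite])
  obtain ys where ys: "set ys = (UNIV :: 'n set)" "distinct ys" using finite_distinct_list by (metis finite_class.finite_UNIV)
  have ms: "mset (sing_vals X) = mset (map (\<lambda>i. sqrt (\<mu> i)) ys)"
    unfolding sing_vals_def mset_rev mset_sorted_list_of_multiset * mset_map mset_set_set[OF ys(2), symmetric] ys(1)
    by (simp only: multiset.map_comp o_def)
  have ly: "length ys = CARD('n)" using ys distinct_card by metis
  have l: "length (sing_vals X) = CARD('n)" using mset_eq_length[OF ms] ly by simp
  obtain p where p: "bij_betw p {..<CARD('n)} {..<CARD('n)}"
     "\<And>i. i < CARD('n) \<Longrightarrow> sing_vals X ! i = map (\<lambda>i. sqrt (\<mu> i)) ys ! p i"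
    using permutation_Ex_bij[OF ms] unfolding l length_map ly by blast
  have s: "sorted_wrt (\<ge>) (sing_vals X)"
    by (simp add: sing_vals_def sorted_wrt_rev)
  have "bij_betw (\<lambda>k. k - 1) {1..CARD('n)} {..<CARD('n)}"
    by (rule bij_betw_byWitness[where f' = Suc]) auto
  moreover have "bij_betw ((!) ys) {..<CARD('n)} UNIV" using bij_betw_nth[OF ys(2)] ly ys by auto
  ultimately have bb: "bij_betw ((!) ys \<circ> (p \<circ> (\<lambda>k. k - 1))) {1..CARD('n)} UNIV"
    by (intro bij_betw_trans[OF bij_betw_trans[OF _ p(1)]])
  show thesis
  proof (rule that[OF bb _ s l])
    fix k assume "k \<in> {1..CARD('n)}"
    then have k: "k - 1 < CARD('n)" by auto
    then have "p (k - 1) < CARD('n)" using p(1) by (auto simp: bij_betw_def)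
    then show "sing_val k X = sqrt (\<mu> (((!) ys \<circ> (p \<circ> (\<lambda>k. k - 1))) k))"
      using p(2)[OF k] ly by (simp add: sing_val_def)
  qed
qed

section \<open>Truncation to low rank\<close>

lemma norm_matrix_vector_mult_le:
  fixes A :: "real^'m^'n"
  shows "norm (A *v x) \<le> norm A * norm x"
proof -
  have "norm (A *v x) = L2_set (\<lambda>i. norm ((A *v x) $ i)) UNIV" by (simp add: norm_vec_def)
  also have "\<dots> \<le> L2_set (\<lambda>i. norm (A $ i) * norm x) UNIV"
    by (intro L2_set_mono) (auto simp: matrix_vector_mul_component Cauchy_Schwarz_ineq2)
  also have "\<dots> = norm A * norm x"
    by (simp add: norm_vec_def[of A] L2_set_left_distrib)
  finally show ?thesis .
qed

lemma norm_transpose [simp]: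
  fixes A :: "real^'m^'n"
  shows "norm (transpose A) = norm A"
proof -
  have "transpose A \<bullet> transpose A = A \<bullet> A"
    unfolding inner_vec_def transpose_def by (simp, rule sum.swap)
  then show ?thesis by (simp add: norm_eq_sqrt_inner)
qed

lemma norm_vector_matrix_mult_le:
  fixes A :: "real^'m^'n"
  shows "norm (x v* A) \<le> norm x * norm A"
  using norm_matrix_vector_mult_le[of "transpose A" x] by (simp add: mult.commute)

lemma norm_matrix_matrix_mult_le:
  fixes A :: "real^'m^'n" and B :: "real^'k^'m"
  shows "norm (A ** B) \<le> norm A * norm B"
proof -
  have row: "(A ** B) $ i = A $ i v* B" for i
    by (simp add: matrix_matrix_mult_def vector_matrix_mult_def vec_eq_iff mult.commute)
  have "norm (A ** B) = L2_set (\<lambda>i. norm ((A ** B) $ i)) UNIV" by (simp add: norm_vec_def)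
  also have "\<dots> \<le> L2_set (\<lambda>i. norm (A $ i) * norm B) UNIV"
    by (intro L2_set_mono) (auto simp: row norm_vector_matrix_mult_le)
  also have "\<dots> = norm A * norm B"
    by (simp add: norm_vec_def[of A] L2_set_left_distrib)
  finally show ?thesis .
qed

definition outer :: "real^'n \<Rightarrow> real^'m \<Rightarrow> real^'m^'n" where
  "outer x y = (\<chi> i j. x $ i * y $ j)"

lemma outer_mult_vec: "outer x y *v z = (y \<bullet> z) *\<^sub>R x"
  by (simp add: outer_def matrix_vector_mult_def inner_vec_def vec_eq_iff sum_distrib_left ac_simps)

lemma norm_outer: "norm (outer x y) = norm x * norm y"
proof -
  have "outer x y \<bullet> outer x y = (x \<bullet> x) * (y \<bullet> y)"
    by (simp add: outer_def inner_vec_def sum_product mult.assoc mult.left_commute)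
  then show ?thesis by (simp add: norm_eq_sqrt_inner real_sqrt_mult)
qed

lemma sum_outer_mult_vec:
  "(\<Sum>k\<in>K. outer (x k) (y k)) *v z = (\<Sum>k\<in>K. (y k \<bullet> z) *\<^sub>R x k)"
  by (induction K rule: infinite_finite_induct) (auto simp: matrix_vector_mult_add_rdistrib outer_mult_vec)

lemma rank_sum_outer_le:
  assumes "finite K"
  shows "rank (\<Sum>k\<in>K. outer (x k) (y k)) \<le> card K"
proof -
  have "range ((*v) (\<Sum>k\<in>K. outer (x k) (y k))) \<subseteq> span (x ` K)"
    unfolding sum_outer_mult_vec by (clarify, intro span_sum span_scale span_base imageI)
  then have "rank (\<Sum>k\<in>K. outer (x k) (y k)) \<le> card (x ` K)"
    unfolding rank_dim_range using assms by (intro dim_le_card) auto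
  then show ?thesis using card_image_le[OF assms, of x] by linarith
qed

lemma inner_sum_orthogonal:
  assumes "finite K" "\<And>j k. j \<in> K \<Longrightarrow> k \<in> K \<Longrightarrow> j \<noteq> k \<Longrightarrow> a j \<bullet> a k = 0"
  shows "(\<Sum>k\<in>K. c k *\<^sub>R a k) \<bullet> (\<Sum>k\<in>K. c k *\<^sub>R a k) = (\<Sum>k\<in>K. (c k)\<^sup>2 * (a k \<bullet> a k))"
proof -
  have "(\<Sum>k\<in>K. c k *\<^sub>R a k) \<bullet> (\<Sum>k\<in>K. c k *\<^sub>R a k) = (\<Sum>j\<in>K. \<Sum>k\<in>K. c j * (c k * (a j \<bullet> a k)))"
    unfolding inner_sum_left unfolding inner_sum_right by (simp add: ac_simps)
  also have "\<dots> = (\<Sum>j\<in>K. \<Sum>k\<in>K. if k = j then (c k)\<^sup>2 * (a k \<bullet> a k) else 0)"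
    using assms(2) by (intro sum.cong refl) (auto simp: power2_eq_square)
  also have "\<dots> = (\<Sum>k\<in>K. (c k)\<^sup>2 * (a k \<bullet> a k))" using assms(1) by simp
  finally show ?thesis .
qed

text \<open>An orthonormal system of left singular vectors of \<open>X\<close>, indexed so that \<open>w k\<close> belongs to the \<open>k\<close>-th
singular value. The row vectors \<open>w k v* X\<close> are the right singular vectors scaled by the singular
values, so no choice is needed for vanishing singular values.\<close>

definition sing_basis :: "(nat \<Rightarrow> real^'n) \<Rightarrow> real^'m^'n \<Rightarrow> bool" where
  "sing_basis w X \<longleftrightarrow>
     (\<forall>j\<in>{1..CARD('n)}. \<forall>k\<in>{1..CARD('n)}. w j \<bullet> w k = (if j = k then 1 else 0) \<and>
        (w j v* X) \<bullet> (w k v* X) = (if j = k then (sing_val k X)\<^sup>2 else 0)) \<and>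
     (\<Sum>k = 1..CARD('n). outer (w k) (w k v* X)) = X"

lemma inner_vector_matrix_mult:
  "((x :: real^'n) v* X) \<bullet> (y v* X) = x \<bullet> ((X ** transpose X) *v y)"
  by (simp add: dot_lmul_matrix matrix_vector_mul_assoc[symmetric])

lemma sing_basis_of_eigenbasis:
  fixes X :: "real^'m^'n" and u :: "'n \<Rightarrow> real^'n"
  assumes u: "orthonormal u" "\<And>i. (X ** transpose X) *v u i = \<mu> i *\<^sub>R u i"
  obtains b where "sing_basis (u \<circ> b) X"
    "\<And>k. k \<in> {1..CARD('n)} \<Longrightarrow> 0 \<le> sing_val k X"
    "\<And>j k. 1 \<le> j \<Longrightarrow> j \<le> k \<Longrightarrow> k \<le> CARD('n) \<Longrightarrow> sing_val k X \<le> sing_val j X"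
proof -
  obtain b where b: "bij_betw b {1..CARD('n)} UNIV"
    and sv: "\<And>k. k \<in> {1..CARD('n)} \<Longrightarrow> sing_val k X = sqrt (\<mu> (b k))"
    and so: "sorted_wrt (\<ge>) (sing_vals X)" and le: "length (sing_vals X) = CARD('n)"
    using sing_vals_eigenbasis[OF u] by metis
  have in_v: "(u i v* X) \<bullet> (u j v* X) = (if i = j then \<mu> j else 0)" for i j
    using u by (simp add: inner_vector_matrix_mult orthonormal_def)
  have \<mu>0: "\<mu> i \<ge> 0" for i using in_v[of i i] by (metis inner_ge_zero)
  have eq: "b j = b k \<longleftrightarrow> j = k" if "j \<in> {1..CARD('n)}" "k \<in> {1..CARD('n)}" for j k
    using b that by (auto simp: bij_betw_def inj_on_eq_iff)
  have "(\<Sum>k = 1..CARD('n). outer (u (b k)) (u (b k) v* X)) = (\<Sum>i\<in>UNIV. outer (u i) (u i v* X))"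
    by (rule sum.reindex_bij_betw[OF b])
  also have "\<dots> = X"
    unfolding matrix_eq sum_outer_mult_vec dot_lmul_matrix orthonormal_expansion[OF u(1)] by simp
  finally have 1: "sing_basis (u \<circ> b) X"
    using u(1) in_v sv \<mu>0 eq by (simp add: sing_basis_def orthonormal_def)
  show thesis
  proof (rule that[OF 1])
    show "0 \<le> sing_val k X" if "k \<in> {1..CARD('n)}" for k using sv[OF that] \<mu>0 by simp
    show "sing_val k X \<le> sing_val j X" if "1 \<le> j" "j \<le> k" "k \<le> CARD('n)" for j k
    proof (cases "j = k")
      case False
      then have "j - 1 < k - 1" "k - 1 < length (sing_vals X)" using that le by auto
      then show ?thesis using so by (simp add: sing_val_def sorted_wrt_iff_nth_less)
    qed simp
  qed
qed

lemma sing_basis_exists: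
  fixes X :: "real^'m^'n"
  obtains w where "sing_basis w X"
    "\<And>k. k \<in> {1..CARD('n)} \<Longrightarrow> 0 \<le> sing_val k X"
    "\<And>j k. 1 \<le> j \<Longrightarrow> j \<le> k \<Longrightarrow> k \<le> CARD('n) \<Longrightarrow> sing_val k X \<le> sing_val j X"
proof -
  have "transpose (X ** transpose X) = X ** transpose X" by (simp add: matrix_transpose_mul)
  then obtain u :: "'n \<Rightarrow> real^'n" and \<mu> where
    "orthonormal u" "\<And>i. (X ** transpose X) *v u i = \<mu> i *\<^sub>R u i"
    using spectral_theorem by blast
  then show thesis using sing_basis_of_eigenbasis that by metis
qed

lemma sing_val_nonneg:
  fixes X :: "real^'m^'n"
  shows "k \<in> {1..CARD('n)} \<Longrightarrow> 0 \<le> sing_val k X"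
  using sing_basis_exists by metis

lemma sing_val_antimono:
  fixes X :: "real^'m^'n"
  shows "1 \<le> j \<Longrightarrow> j \<le> k \<Longrightarrow> k \<le> CARD('n) \<Longrightarrow> sing_val k X \<le> sing_val j X"
  using sing_basis_exists by metis

text \<open>The function whose level sets inside \<open>\<Omega>\<close> are the values of \<open>S_map \<Omega> r\<close>.\<close>

definition tail_sum :: "nat \<Rightarrow> real^'m^'n \<Rightarrow> real" where
  "tail_sum r X = nuclear_norm X - ky_fan_norm r X"

lemma tail_sum_eq:
  fixes X :: "real^'m^'n"
  assumes "r \<le> CARD('n)"
  shows "tail_sum r X = (\<Sum>k\<in>{r<..CARD('n)}. sing_val k X)"
proof -
  have "{1..CARD('n)} = {1..r} \<union> {r<..CARD('n)}" using assms by auto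
  then have "nuclear_norm X = ky_fan_norm r X + (\<Sum>k\<in>{r<..CARD('n)}. sing_val k X)"
    unfolding nuclear_norm_def ky_fan_norm_def by (simp add: sum.union_disjoint disjoint_iff)
  then show ?thesis by (simp add: tail_sum_def)
qed

lemma tail_sum_nonneg:
  fixes X :: "real^'m^'n"
  assumes "r \<le> CARD('n)"
  shows "0 \<le> tail_sum r X"
  unfolding tail_sum_eq[OF assms] by (intro sum_nonneg sing_val_nonneg) auto

lemma norm_sing_basis:
  fixes X :: "real^'m^'n"
  assumes "sing_basis w X" "k \<in> {1..CARD('n)}"
  shows "norm (w k) = 1" "norm (w k v* X) = sing_val k X"
  using assms sing_val_nonneg[of k X] by (auto simp: sing_basis_def norm_eq_sqrt_inner)

lemma norm_diff_truncation_le: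
  fixes X :: "real^'m^'n"
  assumes w: "sing_basis w X" and r: "r \<le> CARD('n)"
  shows "norm (X - (\<Sum>k = 1..r. outer (w k) (w k v* X))) \<le> tail_sum r X"
proof -
  have "{1..CARD('n)} = {1..r} \<union> {r<..CARD('n)}" using r by auto
  then have split: "(\<Sum>k = 1..CARD('n). outer (w k) (w k v* X)) =
     (\<Sum>k = 1..r. outer (w k) (w k v* X)) + (\<Sum>k\<in>{r<..CARD('n)}. outer (w k) (w k v* X))"
    by (simp add: sum.union_disjoint disjoint_iff)
  have "(\<Sum>k = 1..CARD('n). outer (w k) (w k v* X)) = X"
    using w unfolding sing_basis_def by blast
  from iffD2[OF diff_eq_eq trans[OF trans[OF this[symmetric] split] add.commute]]
  have "X - (\<Sum>k = 1..r. outer (w k) (w k v* X)) = (\<Sum>k\<in>{r<..CARD('n)}. outer (w k) (w k v* X))"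
    .
  also have "norm \<dots> \<le> (\<Sum>k\<in>{r<..CARD('n)}. norm (outer (w k) (w k v* X)))" by (rule norm_sum)
  also have "\<dots> = tail_sum r X" unfolding tail_sum_eq[OF r]
    by (intro sum.cong refl) (auto simp: norm_outer norm_sing_basis[OF w])
  finally show ?thesis .
qed

lemma low_rank_approx:
  fixes X :: "real^'m^'n"
  assumes "r \<le> CARD('n)"
  obtains P where "rank P \<le> r" "norm (X - P) \<le> tail_sum r X"
proof -
  obtain w where w: "sing_basis w X" using sing_basis_exists by metis
  show thesis
    using that[OF _ norm_diff_truncation_le[OF w assms]]
      rank_sum_outer_le[of "{1..r}" w "\<lambda>k. w k v* X"] by simp
qed

lemma sym_mats_sum_outer: "(\<Sum>k\<in>K. outer (x k) (c k *\<^sub>R x k)) \<in> sym_mats"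
  by (simp add: sym_mats_def transpose_def outer_def vec_eq_iff mult.left_commute mult.commute)

lemma inner_sum_outer:
  "v \<bullet> ((\<Sum>k\<in>K. outer (x k) (c k *\<^sub>R x k)) *v v) = (\<Sum>k\<in>K. c k * (x k \<bullet> v)\<^sup>2)"
  by (simp add: sum_outer_mult_vec inner_sum_right inner_commute power2_eq_square mult.assoc)

text \<open>Truncate in an eigenbasis of \<open>X\<close>: the terms are multiples \<open>\<mu> u u\<^sup>T\<close>, so symmetry is kept, and so is positive
semidefiniteness when all \<open>\<mu>\<close> are nonnegative.\<close>

lemma low_rank_approx_sym:
  fixes X :: "real^'n^'n"
  assumes r: "r \<le> CARD('n)" and X: "X \<in> sym_mats"
  obtains P where "rank P \<le> r" "norm (X - P) \<le> tail_sum r X" "P \<in> sym_mats"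
    "X \<in> psd_mats \<Longrightarrow> P \<in> psd_mats"
proof -
  have tX: "transpose X = X" using X by (simp add: sym_mats_def)
  obtain u :: "'n \<Rightarrow> real^'n" and \<mu> where u: "orthonormal u" "\<And>i. X *v u i = \<mu> i *\<^sub>R u i"
    using spectral_theorem[OF tX] by metis
  have "(X ** transpose X) *v u i = (\<mu> i)\<^sup>2 *\<^sub>R u i" for i
    by (simp add: tX matrix_vector_mul_assoc[symmetric] u(2) matrix_vector_mult_scaleR power2_eq_square)
  then obtain b where b: "sing_basis (u \<circ> b) X"
    by (rule sing_basis_of_eigenbasis[OF u(1)])
  have vX: "(u \<circ> b) k v* X = \<mu> (b k) *\<^sub>R (u \<circ> b) k" for k
    by (metis tX u(2) transpose_matrix_vector comp_apply)
  define P where "P = (\<Sum>k = 1..r. outer ((u \<circ> b) k) ((u \<circ> b) k v* X))"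
  have P: "P = (\<Sum>k = 1..r. outer ((u \<circ> b) k) (\<mu> (b k) *\<^sub>R (u \<circ> b) k))" unfolding P_def vX ..
  show thesis
  proof (rule that)
    show "rank P \<le> r" unfolding P_def by (rule order_trans[OF rank_sum_outer_le]) auto
    show "norm (X - P) \<le> tail_sum r X" unfolding P_def by (rule norm_diff_truncation_le[OF b r])
    show sP: "P \<in> sym_mats" unfolding P by (rule sym_mats_sum_outer)
    assume psd: "X \<in> psd_mats"
    have "0 \<le> \<mu> i" for i
    proof -
      have "0 \<le> u i \<bullet> (X *v u i)" using psd by (simp add: psd_mats_def)
      then show ?thesis using u by (simp add: orthonormal_def)
    qed
    then have "0 \<le> v \<bullet> (P *v v)" for v unfolding P inner_sum_outer by (intro sum_nonneg) auto
    then show "P \<in> psd_mats" using sP by (simp add: psd_mats_def)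
  qed
qed

text \<open>The span of the first \<open>r + 1\<close> left singular vectors contains a nonzero \<open>x\<close> with \<open>x v* Y = 0\<close> by counting
dimensions; on this span \<open>X\<close> stretches by at least the \<open>(r + 1)\<close>-st singular value, so
\<open>X - Y\<close> does so at \<open>x\<close>. The tail has at most \<open>n\<close> terms, none exceeding that singular value.\<close>

lemma tail_sum_le_dist:
  fixes X Y :: "real^'m^'n"
  assumes r: "r \<le> CARD('n)" and Y: "rank Y \<le> r"
  shows "tail_sum r X \<le> real CARD('n) * norm (X - Y)"
proof (cases "r = CARD('n)")
  case True
  then show ?thesis by (simp add: tail_sum_eq)
next
  case False
  then have rn: "Suc r \<in> {1..CARD('n)}" using r by auto
  obtain w where w: "sing_basis w X" using sing_basis_exists by metis
  let ?K = "{1..Suc r}"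
  have K: "?K \<subseteq> {1..CARD('n)}" using rn by auto
  have ww: "w j \<bullet> w k = (if j = k then 1 else 0)" if "j \<in> ?K" "k \<in> ?K" for j k
    using w K that unfolding sing_basis_def by blast
  have vv: "(w j v* X) \<bullet> (w k v* X) = (if j = k then (sing_val k X)\<^sup>2 else 0)" if "j \<in> ?K" "k \<in> ?K" for j k
    using w K that unfolding sing_basis_def by blast
  have inj: "inj_on w ?K" by (rule inj_onI) (metis ww zero_neq_one)
  have "pairwise orthogonal (w ` ?K)"
    using ww by (auto simp: pairwise_def orthogonal_def)
  moreover have "0 \<notin> w ` ?K" using ww by force
  ultimately have "independent (w ` ?K)" by (rule pairwise_orthogonal_independent)
  then have dimK: "dim (w ` ?K) = Suc r" using inj by (simp add: dim_eq_card_independent card_image)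
  define g where "g = (\<lambda>x. x v* Y)"
  have lin: "linear g" unfolding g_def using matrix_vector_mul_linear[of "transpose Y"] by simp
  have "\<exists>x\<in>span (w ` ?K). x \<noteq> 0 \<and> g x = 0"
  proof (rule ccontr)
    assume "\<not> ?thesis"
    then have "inj_on g (span (w ` ?K))"
      using linear_injective_on_subspace_0[OF lin subspace_span] by blast
    then have "dim (g ` (w ` ?K)) = Suc r" using dim_image_eq[OF lin] dimK by metis
    moreover have "dim (g ` (w ` ?K)) \<le> rank (transpose Y)"
      unfolding rank_dim_range by (rule dim_subset) (auto simp: g_def)
    ultimately show False using Y by (simp add: rank_transpose)
  qed
  then obtain x where x: "x \<in> span (w ` ?K)" "x \<noteq> 0" "x v* Y = 0" by (auto simp: g_def)
  obtain c where "x = (\<Sum>y\<in>w ` ?K. c y *\<^sub>R y)" using x(1) by (auto simp: span_finite)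
  then have xc: "x = (\<Sum>k\<in>?K. c (w k) *\<^sub>R w k)" unfolding sum.reindex[OF inj] comp_def .
  have linX: "linear (\<lambda>x. x v* X)" using matrix_vector_mul_linear[of "transpose X"] by simp
  have xX: "x v* X = (\<Sum>k\<in>?K. c (w k) *\<^sub>R (w k v* X))"
    unfolding xc using linear_sum[OF linX, of "\<lambda>k. c (w k) *\<^sub>R w k" ?K] linear_scale[OF linX]
    by (simp only:)
  define s where "s = sing_val (Suc r) X"
  have s0: "0 \<le> s" unfolding s_def by (rule sing_val_nonneg[OF rn])
  have "(s * norm x)\<^sup>2 = (\<Sum>k\<in>?K. (c (w k))\<^sup>2 * s\<^sup>2)"
  proof -
    have "(norm x)\<^sup>2 = (\<Sum>k\<in>?K. (c (w k))\<^sup>2 * (w k \<bullet> w k))"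
      unfolding dot_square_norm[symmetric] xc by (rule inner_sum_orthogonal) (simp_all add: ww)
    also have "\<dots> = (\<Sum>k\<in>?K. (c (w k))\<^sup>2)" by (intro sum.cong) (auto simp: ww)
    finally show ?thesis unfolding power_mult_distrib sum_distrib_right[symmetric]
      by (simp only: mult.commute)
  qed
  also have "\<dots> \<le> (\<Sum>k\<in>?K. (c (w k))\<^sup>2 * ((w k v* X) \<bullet> (w k v* X)))"
  proof (intro sum_mono mult_left_mono)
    fix k assume k: "k \<in> ?K"
    have "s \<le> sing_val k X" unfolding s_def using k rn by (intro sing_val_antimono) auto
    then show "s\<^sup>2 \<le> (w k v* X) \<bullet> (w k v* X)" using vv[OF k k] s0 by (simp add: power_mono)
  qed simp
  also have "\<dots> = (norm (x v* X))\<^sup>2"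
    unfolding dot_square_norm[symmetric] xX by (rule inner_sum_orthogonal[symmetric]) (simp_all add: vv)
  finally have "s * norm x \<le> norm (x v* X)" by (rule power2_le_imp_le) simp
  also have "x v* X = x v* (X - Y)" using x(3)
    by (simp add: vector_matrix_mult_def vec_eq_iff algebra_simps sum_subtractf)
  also have "norm \<dots> \<le> norm x * norm (X - Y)" by (rule norm_vector_matrix_mult_le)
  finally have sle: "s \<le> norm (X - Y)" using x(2) by (simp add: mult.commute)
  have "tail_sum r X \<le> (\<Sum>k\<in>{r<..CARD('n)}. s)" unfolding tail_sum_eq[OF r] s_def
    by (intro sum_mono sing_val_antimono) auto
  also have "\<dots> = real (CARD('n) - r) * s" by simp
  also have "\<dots> \<le> real CARD('n) * norm (X - Y)" using s0 sle by (intro mult_mono) auto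
  finally show ?thesis .
qed

lemma tail_sum_eq_0_iff:
  fixes X :: "real^'m^'n"
  assumes r: "r \<le> CARD('n)"
  shows "tail_sum r X = 0 \<longleftrightarrow> rank X \<le> r"
proof
  assume "tail_sum r X = 0"
  moreover obtain P where "rank P \<le> r" "norm (X - P) \<le> tail_sum r X"
    using low_rank_approx[OF r] by metis
  ultimately show "rank X \<le> r" by auto
next
  assume "rank X \<le> r"
  then show "tail_sum r X = 0"
    using tail_sum_le_dist[OF r, of X X] tail_sum_nonneg[OF r, of X] by simp
qed

text \<open>A matrix of larger rank has a positive tail sum, which bounds its distance to the set from below.\<close>

lemma closed_rank_le:
  assumes r: "r \<le> CARD('n)"
  shows "closed {X :: real^'m^'n. rank X \<le> r}"
  unfolding closed_def
proof (rule openI)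
  fix X :: "real^'m^'n" assume "X \<in> - {X. rank X \<le> r}"
  then have "tail_sum r X \<noteq> 0" using tail_sum_eq_0_iff[OF r] by auto
  then have t: "tail_sum r X > 0" using tail_sum_nonneg[OF r, of X] by simp
  let ?e = "tail_sum r X / real CARD('n)"
  have "ball X ?e \<subseteq> - {X. rank X \<le> r}"
  proof
    fix Y assume "Y \<in> ball X ?e"
    then have "real CARD('n) * norm (X - Y) < tail_sum r X" by (simp add: dist_norm field_simps)
    then show "Y \<in> - {X. rank X \<le> r}" using tail_sum_le_dist[OF r, of Y X] by force
  qed
  then show "\<exists>e>0. ball X e \<subseteq> - {X. rank X \<le> r}" using t by (intro exI[of _ ?e]) simp
qed

lemma rank_eq_card_sing_val:
  fixes X :: "real^'m^'n"
  shows "rank X = card {k \<in> {1..CARD('n)}. sing_val k X > 0}"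
proof -
  let ?r = "rank X"
  have r: "?r \<le> CARD('n)" using rank_bound[of X] by simp
  have "sing_val k X = 0" if "k \<in> {?r<..CARD('n)}" for k
  proof -
    have "(\<Sum>k\<in>{?r<..CARD('n)}. sing_val k X) = 0"
      using tail_sum_eq_0_iff[OF r, of X] tail_sum_eq[OF r, of X] by simp
    then show ?thesis using that sing_val_nonneg[of _ X] by (subst (asm) sum_nonneg_eq_0_iff) auto
  qed
  moreover have "sing_val k X > 0" if k: "k \<in> {1..?r}" for k
  proof (rule ccontr)
    assume "\<not> ?thesis"
    then have "sing_val k X \<le> 0" by simp
    then have "sing_val j X = 0" if "j \<in> {k - 1<..CARD('n)}" for j
      using sing_val_antimono[of k j X] sing_val_nonneg[of j X] that k by force
    then have "tail_sum (k - 1) X = 0" using k r by (subst tail_sum_eq) auto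
    then have "?r \<le> k - 1" using k r by (subst (asm) tail_sum_eq_0_iff) auto
    then show False using k by auto
  qed
  ultimately have "{k \<in> {1..CARD('n)}. sing_val k X > 0} = {1..?r}"
    using r by (auto simp: not_le) (metis greaterThanAtMost_iff less_irrefl not_le)
  then show ?thesis by simp
qed

section \<open>Calmness as an error bound; balls and spheres\<close>

text \<open>Only points with small tail sum need to be treated: where the tail sum exceeds \<open>c\<close>, the reference point \<open>Xb\<close>
itself is an admissible choice, at distance at most \<open>\<delta> \<le> \<delta> / c * tail_sum r X\<close>.\<close>

lemma all_calmI:
  fixes \<Omega> :: "(real^'m^'n) set"
  assumes "\<And>r Xb. 1 \<le> r \<Longrightarrow> r \<le> CARD('n) \<Longrightarrow> Xb \<in> \<Omega> \<Longrightarrow> rank Xb \<le> r \<Longrightarrow>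
    \<exists>c>0. \<exists>\<delta>>0. \<exists>\<gamma>. \<forall>X\<in>\<Omega>. norm (X - Xb) \<le> \<delta> \<longrightarrow> tail_sum r X \<le> c \<longrightarrow>
      (\<exists>Y\<in>\<Omega>. rank Y \<le> r \<and> norm (X - Y) \<le> \<gamma> * tail_sum r X)"
  shows "all_calm \<Omega>"
  unfolding all_calm_def
proof (intro ballI)
  fix r Xb assume r: "r \<in> {1..CARD('n)}" and Xb: "Xb \<in> S_map \<Omega> r 0"
  have S: "X \<in> S_map \<Omega> r y \<longleftrightarrow> X \<in> \<Omega> \<and> tail_sum r X = y" for X y
    by (simp add: S_map_def tail_sum_def)
  have rn: "r \<le> CARD('n)" "1 \<le> r" using r by auto
  have Xb': "Xb \<in> \<Omega>" "rank Xb \<le> r" using Xb tail_sum_eq_0_iff[OF rn(1), of Xb] by (auto simp: S)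
  obtain c \<delta> \<gamma> where c: "c > 0" "\<delta> > 0"
    and Y: "\<And>X. X \<in> \<Omega> \<Longrightarrow> norm (X - Xb) \<le> \<delta> \<Longrightarrow> tail_sum r X \<le> c \<Longrightarrow>
      \<exists>Y\<in>\<Omega>. rank Y \<le> r \<and> norm (X - Y) \<le> \<gamma> * tail_sum r X"
    using assms[OF rn(2,1) Xb'] by blast
  \<comment> \<open>The second argument serves the points with tail sum above \<open>c\<close>.\<close>
  define g where "g = max \<gamma> (\<delta> / c)"
  have g: "g > 0" using c by (simp add: g_def less_max_iff_disj)
  have ex: "\<exists>Y\<in>\<Omega>. rank Y \<le> r \<and> norm (X - Y) \<le> g * tail_sum r X"
    if X: "X \<in> \<Omega>" "norm (X - Xb) \<le> \<delta>" for X
  proof (cases "tail_sum r X \<le> c")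
    case True
    then obtain Y where "Y \<in> \<Omega>" "rank Y \<le> r" "norm (X - Y) \<le> \<gamma> * tail_sum r X" using Y X by blast
    moreover have "\<gamma> * tail_sum r X \<le> g * tail_sum r X"
      using tail_sum_nonneg[OF rn(1)] by (intro mult_right_mono) (auto simp: g_def)
    ultimately show ?thesis by force
  next
    case False
    have "\<delta> = \<delta> / c * c" using c by simp
    also have "\<dots> \<le> g * tail_sum r X"
      using False c g by (intro mult_mono) (auto simp: g_def)
    finally show ?thesis using X Xb' by force
  qed
  show "calm_at (S_map \<Omega> r) 0 Xb"
    unfolding calm_at_def
  proof (rule conjI[OF Xb], rule exI[of _ g], intro conjI less_imp_le[OF g], rule exI[of _ 1],
      intro conjI zero_less_one, rule exI[of _ \<delta>], intro conjI c allI impI subsetI)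
    fix y :: real and X assume X: "X \<in> S_map \<Omega> r y \<inter> cball Xb \<delta>"
    then have y: "y = tail_sum r X" and XO: "X \<in> \<Omega>" and "norm (X - Xb) \<le> \<delta>"
      by (auto simp: S dist_norm norm_minus_commute)
    then obtain Y where YO: "Y \<in> \<Omega>" "rank Y \<le> r" and n: "norm (X - Y) \<le> g * y" using ex by blast
    have y0: "y \<ge> 0" using tail_sum_nonneg[OF rn(1)] y by simp
    define u where "u = (1 / (g * y)) *\<^sub>R (X - Y)"
    have "X = Y + (g * norm (y - 0)) *\<^sub>R u" using g y0 n by (cases "y = 0") (auto simp: u_def)
    moreover have "u \<in> cball 0 1"
      using g y0 n by (cases "y = 0") (auto simp: u_def divide_le_eq)
    moreover have "Y \<in> S_map \<Omega> r 0" using YO tail_sum_eq_0_iff[OF rn(1), of Y] by (simp add: S)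
    ultimately show "X \<in> {z + (g * norm (y - 0)) *\<^sub>R u |z u. z \<in> S_map \<Omega> r 0 \<and> u \<in> cball 0 1}"
      by blast
  qed
qed

text \<open>The properties that all matrices, the symmetric ones and the positive semidefinite ones share and that the
treatment of balls and spheres needs: truncation and rescaling do not leave the set.\<close>

definition truncatable_cone :: "(real^'m^'n) set \<Rightarrow> bool" where
  "truncatable_cone K \<longleftrightarrow>
     (\<forall>X\<in>K. \<forall>r\<le>CARD('n). \<exists>P\<in>K. rank P \<le> r \<and> norm (X - P) \<le> tail_sum r X) \<and>
     (\<forall>a\<ge>0. \<forall>X\<in>K. a *\<^sub>R X \<in> K)"

lemma rank_scaleR_le:
  fixes P :: "real^'m^'n"
  shows "rank (a *\<^sub>R P) \<le> rank P"
proof -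
  have "(a *\<^sub>R mat 1) ** P = a *\<^sub>R P"
    by (simp add: scalar_matrix_assoc[symmetric])
  then show ?thesis using rank_mul_le_right by metis
qed

lemma truncatable_cone_UNIV: "truncatable_cone (UNIV :: (real^'m^'n) set)"
  unfolding truncatable_cone_def using low_rank_approx by (metis UNIV_I)

lemma truncatable_cone_sym_mats: "truncatable_cone (sym_mats :: (real^'n^'n) set)"
  unfolding truncatable_cone_def
proof (intro conjI ballI allI impI)
  fix X :: "real^'n^'n" and r assume "X \<in> sym_mats" "r \<le> CARD('n)"
  then show "\<exists>P\<in>sym_mats. rank P \<le> r \<and> norm (X - P) \<le> tail_sum r X"
    using low_rank_approx_sym by metis
qed (auto simp: sym_mats_def transpose_scalar)

lemma truncatable_cone_psd_mats: "truncatable_cone (psd_mats :: (real^'n^'n) set)"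
  unfolding truncatable_cone_def
proof (intro conjI ballI allI impI)
  fix X :: "real^'n^'n" and r assume X: "X \<in> psd_mats" "r \<le> CARD('n)"
  then have "X \<in> sym_mats" by (simp add: psd_mats_def)
  then show "\<exists>P\<in>psd_mats. rank P \<le> r \<and> norm (X - P) \<le> tail_sum r X"
    using low_rank_approx_sym[OF X(2)] X by metis
qed (auto simp: psd_mats_def sym_mats_def transpose_scalar scaleR_matrix_vector_assoc[symmetric])

text \<open>Expand in an orthonormal basis of \<open>V\<close> and use the triangle inequality.\<close>

lemma norm_on_subspace_bounded:
  fixes V :: "'a::euclidean_space set"
  assumes V: "subspace V" and N: "norm_on V N"
  shows "\<exists>L. \<forall>x\<in>V. N x \<le> L * norm x"
proof -
  obtain B where B: "B \<subseteq> V" "pairwise orthogonal B" "\<And>x. x \<in> B \<Longrightarrow> norm x = 1"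
    "independent B" "span B = V" using orthonormal_basis_subspace[OF V] by metis
  have fin: "finite B" using B(4) independent_imp_finite by blast
  have N0: "N 0 = 0" using N V unfolding norm_on_def by (metis subspace_0)
  have sum: "N (\<Sum>b\<in>C. c b *\<^sub>R b) \<le> (\<Sum>b\<in>C. \<bar>c b\<bar> * N b)" if "finite C" "C \<subseteq> B" for C c
    using that
  proof (induction C rule: finite_induct)
    case (insert b C)
    have "c b *\<^sub>R b \<in> V" "(\<Sum>b\<in>C. c b *\<^sub>R b) \<in> V"
      using insert.prems B(1) V by (auto intro!: subspace_sum subspace_scale)
    then have "N (c b *\<^sub>R b + (\<Sum>b\<in>C. c b *\<^sub>R b)) \<le> N (c b *\<^sub>R b) + N (\<Sum>b\<in>C. c b *\<^sub>R b)"
      using N unfolding norm_on_def by blast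
    moreover have "N (c b *\<^sub>R b) = \<bar>c b\<bar> * N b" using N insert.prems B(1) unfolding norm_on_def by blast
    ultimately show ?case using insert by simp
  qed (simp add: N0)
  have "N x \<le> (\<Sum>b\<in>B. N b) * norm x" if x: "x \<in> V" for x
  proof -
    have "(\<Sum>b\<in>B. (x \<bullet> b) *\<^sub>R b) = x"
      using B x fin by (intro orthonormal_basis_expand) auto
    then have "N x \<le> (\<Sum>b\<in>B. \<bar>x \<bullet> b\<bar> * N b)" using sum[OF fin order_refl, of "\<lambda>b. x \<bullet> b"] by simp
    also have "\<dots> \<le> (\<Sum>b\<in>B. norm x * N b)"
    proof (intro sum_mono mult_right_mono)
      fix b assume b: "b \<in> B"
      show "\<bar>x \<bullet> b\<bar> \<le> norm x" using Cauchy_Schwarz_ineq2[of x b] B(3)[OF b] by simp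
      show "0 \<le> N b" using N B(1) b unfolding norm_on_def by blast
    qed
    finally show ?thesis by (simp add: sum_distrib_left mult.commute)
  qed
  then show ?thesis by blast
qed

text \<open>If the truncation \<open>P\<close> leaves the ball, it does so by \<open>N P - \<rho> \<le> N (P - X) = O(tail_sum r X)\<close>, so shrinking it
to the boundary moves it by the same order.\<close>

lemma all_calm_norm_ball:
  fixes K :: "(real^'m^'n) set"
  assumes K: "truncatable_cone K" "K \<subseteq> V" and V: "subspace V" and N: "norm_on V N" and \<rho>: "\<rho> > 0"
  shows "all_calm {Z \<in> K. N Z \<le> \<rho>}"
proof (rule all_calmI)
  fix r and Xb :: "real^'m^'n" assume r: "r \<le> CARD('n)"
  obtain L0 where L0: "\<And>x. x \<in> V \<Longrightarrow> N x \<le> L0 * norm x" using norm_on_subspace_bounded[OF V N] by blast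
  define L where "L = max L0 0"
  have L: "N x \<le> L * norm x" if "x \<in> V" for x
  proof -
    have "N x \<le> L0 * norm x" using L0 that by blast
    also have "\<dots> \<le> L * norm x" by (intro mult_right_mono) (auto simp: L_def)
    finally show ?thesis .
  qed
  have Lpos: "L \<ge> 0" by (simp add: L_def)
  show "\<exists>c>0. \<exists>\<delta>>0. \<exists>\<gamma>. \<forall>X\<in>{Z \<in> K. N Z \<le> \<rho>}. norm (X - Xb) \<le> \<delta> \<longrightarrow> tail_sum r X \<le> c \<longrightarrow>
      (\<exists>Y\<in>{Z \<in> K. N Z \<le> \<rho>}. rank Y \<le> r \<and> norm (X - Y) \<le> \<gamma> * tail_sum r X)"
  proof (rule exI[of _ 1], intro conjI zero_less_one, rule exI[of _ 1], intro conjI zero_less_one,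
      rule exI[of _ "1 + (norm Xb + 2) / \<rho> * L"], intro ballI impI)
    fix X assume X: "X \<in> {Z \<in> K. N Z \<le> \<rho>}" and d: "norm (X - Xb) \<le> 1" and T: "tail_sum r X \<le> 1"
    define T where "T = tail_sum r X"
    have T0: "T \<ge> 0" using tail_sum_nonneg[OF r] by (simp add: T_def)
    obtain P where P: "P \<in> K" "rank P \<le> r" "norm (X - P) \<le> T"
      using K(1) X r unfolding truncatable_cone_def T_def by blast
    have nP: "norm P \<le> norm Xb + 2"
      using norm_triangle_ineq3[of X Xb] norm_triangle_ineq3[of X P] P(3) d T by (simp add: T_def)
    show "\<exists>Y\<in>{Z \<in> K. N Z \<le> \<rho>}. rank Y \<le> r \<and> norm (X - Y) \<le> (1 + (norm Xb + 2) / \<rho> * L) * tail_sum r X"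
    proof (cases "N P \<le> \<rho>")
      case True
      have "T \<le> (1 + (norm Xb + 2) / \<rho> * L) * T"
        using T0 Lpos \<rho> by (simp add: algebra_simps)
      then show ?thesis using True P by (intro bexI[of _ P]) (auto simp: T_def)
    next
      case False
      define a where "a = \<rho> / N P"
      have a: "0 \<le> a" "a \<le> 1" using False \<rho> by (auto simp: a_def)
      have aP: "a *\<^sub>R P \<in> K" using K(1) P(1) a unfolding truncatable_cone_def by blast
      have "N (a *\<^sub>R P) = \<bar>a\<bar> * N P" using N P(1) K(2) unfolding norm_on_def by blast
      then have Na: "N (a *\<^sub>R P) = \<rho>" using a False \<rho> by (simp add: a_def)
      have PX: "P - X \<in> V" "X \<in> V" using K(2) P(1) X V by (auto intro: subspace_diff)
      then have "N (X + (P - X)) \<le> N X + N (P - X)" using N unfolding norm_on_def by blast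
      also have "\<dots> \<le> \<rho> + L * T"
        using L[OF PX(1)] X P(3) Lpos by (smt (verit) mem_Collect_eq mult_left_mono norm_minus_commute)
      finally have NP: "N P - \<rho> \<le> L * T" by simp
      have "norm (P - a *\<^sub>R P) = (1 - a) * norm P"
      proof -
        have "P - a *\<^sub>R P = (1 - a) *\<^sub>R P" by (simp add: scaleR_left_diff_distrib)
        then show ?thesis using a by simp
      qed
      also have "1 - a = (N P - \<rho>) / N P" using False \<rho> by (simp add: a_def field_simps)
      also have "\<dots> \<le> (L * T) / \<rho>" using NP False \<rho> by (intro frac_le) auto
      finally have "norm (P - a *\<^sub>R P) \<le> (L * T) / \<rho> * norm P" by (simp add: mult_right_mono)
      also have "\<dots> \<le> (L * T) / \<rho> * (norm Xb + 2)" using nP Lpos T0 \<rho> by (intro mult_left_mono) auto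
      finally have "norm (X - a *\<^sub>R P) \<le> T + (L * T) / \<rho> * (norm Xb + 2)"
        using P(3) norm_triangle_ineq[of "X - P" "P - a *\<^sub>R P"] by simp
      also have "\<dots> = (1 + (norm Xb + 2) / \<rho> * L) * T" by (simp add: field_simps)
      finally show ?thesis using aP Na rank_scaleR_le[of a P] P(2)
        by (intro bexI[of _ "a *\<^sub>R P"]) (auto simp: T_def)
    qed
  qed
qed

text \<open>For a small tail sum the truncation is nonzero with norm close to \<open>\<rho>\<close>, and can be scaled back to the sphere.\<close>

lemma all_calm_sphere:
  fixes K :: "(real^'m^'n) set"
  assumes K: "truncatable_cone K" and \<rho>: "\<rho> > 0"
  shows "all_calm {Z \<in> K. norm Z = \<rho>}"
proof (rule all_calmI)
  fix r and Xb :: "real^'m^'n" assume r: "r \<le> CARD('n)"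
  show "\<exists>c>0. \<exists>\<delta>>0. \<exists>\<gamma>. \<forall>X\<in>{Z \<in> K. norm Z = \<rho>}. norm (X - Xb) \<le> \<delta> \<longrightarrow> tail_sum r X \<le> c \<longrightarrow>
      (\<exists>Y\<in>{Z \<in> K. norm Z = \<rho>}. rank Y \<le> r \<and> norm (X - Y) \<le> \<gamma> * tail_sum r X)"
  proof (rule exI[of _ "\<rho> / 2"], intro conjI, use \<rho> in simp,
      rule exI[of _ 1], intro conjI zero_less_one, rule exI[of _ 2], intro ballI impI)
    fix X assume X: "X \<in> {Z \<in> K. norm Z = \<rho>}" and T: "tail_sum r X \<le> \<rho> / 2"
    obtain P where P: "P \<in> K" "rank P \<le> r" "norm (X - P) \<le> tail_sum r X"
      using K X r unfolding truncatable_cone_def by blast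
    have nP: "\<bar>norm P - \<rho>\<bar> \<le> tail_sum r X" using norm_triangle_ineq3[of X P] P(3) X by simp
    then have P0: "norm P > 0" using T \<rho> by linarith
    define a where "a = \<rho> / norm P"
    have a: "a \<ge> 0" using P0 \<rho> by (simp add: a_def)
    have aP: "a *\<^sub>R P \<in> K" using K P(1) a unfolding truncatable_cone_def by blast
    have "P - a *\<^sub>R P = (1 - a) *\<^sub>R P" by (simp add: scaleR_left_diff_distrib)
    then have "norm (P - a *\<^sub>R P) = \<bar>1 - a\<bar> * norm P" by simp
    also have "\<dots> = \<bar>(1 - a) * norm P\<bar>" by (simp add: abs_mult)
    also have "(1 - a) * norm P = norm P - \<rho>" using P0 by (simp add: a_def field_simps)
    finally have "norm (X - a *\<^sub>R P) \<le> 2 * tail_sum r X"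
      using P(3) nP norm_triangle_ineq[of "X - P" "P - a *\<^sub>R P"] by simp
    moreover have "norm (a *\<^sub>R P) = \<rho>" using P0 \<rho> by (simp add: a_def)
    ultimately show "\<exists>Y\<in>{Z \<in> K. norm Z = \<rho>}. rank Y \<le> r \<and> norm (X - Y) \<le> 2 * tail_sum r X"
      using aP rank_scaleR_le[of a P] P(2) by (intro bexI[of _ "a *\<^sub>R P"]) auto
  qed
qed

lemma subspace_sym_mats: "subspace (sym_mats :: (real^'n^'n) set)"
  by (auto simp: subspace_def sym_mats_def transpose_def vec_eq_iff)

section \<open>Stochastic and doubly stochastic matrices\<close>

text \<open>Minimise \<open>infdist Z R + \<kappa> / (2 D) * norm (Z - X)\<close> over \<open>\<Omega>\<close>. At a minimiser outside \<open>R\<close>, a short step towards the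
\<open>W\<close> supplied by the slope condition would decrease the first term at rate more than \<open>\<kappa> / 2\<close> and
increase the second at rate at most \<open>\<kappa> / 2\<close>. So the minimiser lies in \<open>R\<close>, and comparing its value
with that of \<open>X\<close> bounds its distance from \<open>X\<close>.\<close>

lemma descent_error_bound:
  fixes \<Omega> R :: "'a::euclidean_space set"
  assumes \<Omega>: "compact \<Omega>" "convex \<Omega>" and R: "closed R" "R \<noteq> {}"
    and D: "D > 0" "\<And>x y. x \<in> \<Omega> \<Longrightarrow> y \<in> \<Omega> \<Longrightarrow> norm (x - y) \<le> D" and \<kappa>: "\<kappa> > 0"
    and slope: "\<And>Z P. Z \<in> \<Omega> \<Longrightarrow> P \<in> R \<Longrightarrow> (\<And>Q. Q \<in> R \<Longrightarrow> norm (Z - P) \<le> norm (Z - Q)) \<Longrightarrow>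
      0 < norm (Z - P) \<Longrightarrow> norm (Z - P) \<le> \<eta> \<Longrightarrow> \<exists>W\<in>\<Omega>. (W - Z) \<bullet> (Z - P) \<le> - \<kappa> * norm (Z - P)"
    and X: "X \<in> \<Omega>" "infdist X R \<le> \<eta>"
  shows "\<exists>Y\<in>\<Omega> \<inter> R. norm (X - Y) \<le> 2 * D / \<kappa> * infdist X R"
proof -
  let ?F = "\<lambda>Z. infdist Z R + \<kappa> / (2 * D) * norm (Z - X)"
  have "continuous_on \<Omega> ?F" by (intro continuous_intros)
  then obtain Z where Z: "Z \<in> \<Omega>" and mn: "\<And>Z'. Z' \<in> \<Omega> \<Longrightarrow> ?F Z \<le> ?F Z'"
    using continuous_attains_inf[OF \<Omega>(1), of ?F] X(1) by blast
  have FX: "?F Z \<le> infdist X R" using mn[OF X(1)] by simp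
  have nn: "0 \<le> \<kappa> / (2 * D) * norm (Z - X)" using \<kappa> D by simp
  have dist: "norm (X - Z) \<le> 2 * D / \<kappa> * infdist X R"
  proof -
    have "\<kappa> / (2 * D) * norm (Z - X) \<le> infdist X R" using FX infdist_nonneg[of Z R] by linarith
    then show ?thesis using \<kappa> D by (simp add: field_simps norm_minus_commute)
  qed
  have "infdist Z R = 0"
  proof (rule ccontr)
    assume "infdist Z R \<noteq> 0"
    then have pos: "infdist Z R > 0" using infdist_nonneg[of Z R] by simp
    obtain P where P: "P \<in> R" "infdist Z R = dist Z P" using infdist_attains_inf[OF R] by blast
    define e where "e = norm (Z - P)"
    have e: "e > 0" "e \<le> \<eta>" "infdist Z R = e"
      using pos P FX X(2) nn by (auto simp: e_def dist_norm)
    have near: "norm (Z - P) \<le> norm (Z - Q)" if "Q \<in> R" for Q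
      using infdist_le[OF that, of Z] P(2) by (simp add: dist_norm)
    obtain W where W: "W \<in> \<Omega>" "(W - Z) \<bullet> (Z - P) \<le> - \<kappa> * e"
      using slope[OF Z P(1) near] e unfolding e_def by blast
    \<comment> \<open>A step short enough for the second-order term \<open>s\<^sup>2 D\<^sup>2\<close> to consume less than half of the first-order
      gain \<open>2 s \<kappa> e\<close>.\<close>
    define s where "s = min (1/2) (\<kappa> * e / (2 * D\<^sup>2))"
    have s: "0 < s" "s < 1" "s * D\<^sup>2 < \<kappa> * e"
    proof -
      show "0 < s" "s < 1" using \<kappa> e D by (auto simp: s_def)
      have "s * D\<^sup>2 \<le> \<kappa> * e / (2 * D\<^sup>2) * D\<^sup>2" by (intro mult_right_mono) (auto simp: s_def)
      also have "\<dots> = \<kappa> * e / 2" using D by simp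
      also have "\<dots> < \<kappa> * e" using \<kappa> e by simp
      finally show "s * D\<^sup>2 < \<kappa> * e" .
    qed
    define Zs where "Zs = Z + s *\<^sub>R (W - Z)"
    have Zs: "Zs \<in> \<Omega>"
    proof -
      have "Zs = (1 - s) *\<^sub>R Z + s *\<^sub>R W" by (simp add: Zs_def algebra_simps)
      then show ?thesis using convexD[OF \<Omega>(2) Z W(1), of "1 - s" s] s by simp
    qed
    have WZ: "norm (W - Z) \<le> D" using D W Z by blast
    have "(norm (Zs - P))\<^sup>2 = e\<^sup>2 + 2 * s * ((W - Z) \<bullet> (Z - P)) + s\<^sup>2 * (norm (W - Z))\<^sup>2"
    proof -
      have "(norm (A + s *\<^sub>R B))\<^sup>2 = (norm A)\<^sup>2 + 2 * s * (B \<bullet> A) + s\<^sup>2 * (norm B)\<^sup>2" for A B :: 'a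
        unfolding power2_norm_eq_inner
        by (simp add: inner_add_left inner_add_right inner_commute[of A B] power2_eq_square algebra_simps)
      moreover have "Zs - P = (Z - P) + s *\<^sub>R (W - Z)" by (simp add: Zs_def)
      ultimately show ?thesis unfolding e_def by (simp only:)
    qed
    also have "\<dots> \<le> e\<^sup>2 + 2 * s * (- \<kappa> * e) + s\<^sup>2 * D\<^sup>2"
      using W(2) s WZ e by (intro add_mono mult_left_mono power_mono) auto
    also have "\<dots> < e\<^sup>2 - s * \<kappa> * e + (s * \<kappa> / 2)\<^sup>2"
    proof -
      have "s * (s * D\<^sup>2) < s * (\<kappa> * e)" using s by (intro mult_strict_left_mono) auto
      moreover have "0 \<le> (s * \<kappa> / 2)\<^sup>2" by simp
      ultimately show ?thesis by (simp add: power2_eq_square algebra_simps)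
    qed
    also have "\<dots> = (e - s * \<kappa> / 2)\<^sup>2" by (simp add: power2_eq_square algebra_simps)
    finally have sq: "(norm (Zs - P))\<^sup>2 < (e - s * \<kappa> / 2)\<^sup>2" .
    have "e - s * \<kappa> / 2 \<ge> 0"
    proof -
      have "\<kappa> * e \<le> norm (W - Z) * e"
        using W(2) Cauchy_Schwarz_ineq2[of "W - Z" "Z - P"] by (simp add: e_def)
      then have "\<kappa> \<le> D" using e WZ by simp
      have "s * \<kappa> \<le> \<kappa> * e / (2 * D\<^sup>2) * \<kappa>" using \<kappa> by (intro mult_right_mono) (auto simp: s_def)
      also have "\<dots> = e * (\<kappa> * \<kappa>) / (2 * D\<^sup>2)" by simp
      also have "\<dots> \<le> e * (D * D) / (2 * D\<^sup>2)" using \<open>\<kappa> \<le> D\<close> \<kappa> e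
        by (intro divide_right_mono mult_left_mono mult_mono) auto
      also have "\<dots> = e / 2" using D by (simp add: power2_eq_square)
      finally show ?thesis using e by simp
    qed
    then have "norm (Zs - P) < e - s * \<kappa> / 2" using sq by (simp add: power2_less_imp_less)
    moreover have "infdist Zs R \<le> norm (Zs - P)" using infdist_le[OF P(1), of Zs] by (simp add: dist_norm)
    moreover have "\<kappa> / (2 * D) * norm (Zs - X) \<le> \<kappa> / (2 * D) * norm (Z - X) + s * \<kappa> / 2"
    proof -
      have eq: "Zs - X = (Z - X) + s *\<^sub>R (W - Z)" by (simp add: Zs_def)
      have "norm (Zs - X) \<le> norm (Z - X) + s * norm (W - Z)"
        unfolding eq using norm_triangle_ineq[of "Z - X" "s *\<^sub>R (W - Z)"] s by simp
      also have "\<dots> \<le> norm (Z - X) + s * D" using WZ s by simp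
      finally have "\<kappa> / (2 * D) * norm (Zs - X) \<le> \<kappa> / (2 * D) * (norm (Z - X) + s * D)"
        using \<kappa> D by (intro mult_left_mono) auto
      also have "\<dots> = \<kappa> / (2 * D) * norm (Z - X) + s * \<kappa> / 2" using D by (simp add: field_simps)
      finally show ?thesis .
    qed
    ultimately have "?F Zs < ?F Z" using e(3) by linarith
    then show False using mn[OF Zs] by simp
  qed
  then have "Z \<in> R" using in_closed_iff_infdist_zero[OF R] by simp
  then show ?thesis using Z dist by blast
qed

lemma matrix_add_rdistrib: "(A + B) ** C = A ** C + B ** (C :: real^'k^'m)"
  by (simp add: matrix_matrix_mult_def vec_eq_iff distrib_right sum.distrib)

lemma row_matrix_matrix_mult: "(A ** B) $ i = A $ i v* (B :: real^'k^'m)"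
  by (simp add: matrix_matrix_mult_def vector_matrix_mult_def vec_eq_iff mult.commute)

lemma inner_matrix_mult_right:
  fixes A :: "real^'m^'n" and B :: "real^'k^'n" and C :: "real^'m^'k"
  shows "A \<bullet> (B ** C) = (A ** transpose C) \<bullet> B"
proof -
  have "A $ i \<bullet> (B $ i v* C) = (A $ i v* transpose C) \<bullet> B $ i" for i
    by (simp add: inner_commute[of "A $ i"] dot_lmul_matrix inner_commute[of "B $ i"])
  then show ?thesis by (simp add: inner_vec_def[of A] inner_vec_def[of _ B] row_matrix_matrix_mult)
qed

lemma inner_transpose: "transpose A \<bullet> transpose B = A \<bullet> (B :: real^'m^'n)"
  unfolding inner_vec_def transpose_def by (simp, rule sum.swap)

lemma inner_matrix_mult_left:
  fixes A :: "real^'m^'n" and B :: "real^'k^'n" and C :: "real^'m^'k"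
  shows "A \<bullet> (B ** C) = (transpose B ** A) \<bullet> C"
proof -
  have "A \<bullet> (B ** C) = transpose A \<bullet> (transpose C ** transpose B)"
    by (metis inner_transpose matrix_transpose_mul)
  also have "\<dots> = (transpose A ** B) \<bullet> transpose C" by (simp add: inner_matrix_mult_right)
  also have "\<dots> = (transpose B ** A) \<bullet> C"
    by (metis inner_transpose matrix_transpose_mul transpose_transpose)
  finally show ?thesis .
qed

lemma inner_eq_0_if_minimal:
  fixes E V :: "'a::real_inner"
  assumes "\<And>s. norm E \<le> norm (E - s *\<^sub>R V)"
  shows "E \<bullet> V = 0"
proof (rule ccontr)
  assume h: "E \<bullet> V \<noteq> 0"
  then have V: "V \<bullet> V > 0" by auto
  define s where "s = (E \<bullet> V) / (V \<bullet> V)"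
  have "(norm E)\<^sup>2 \<le> (norm (E - s *\<^sub>R V))\<^sup>2" using assms by (intro power_mono) auto
  also have "\<dots> = (norm E)\<^sup>2 - (E \<bullet> V)\<^sup>2 / (V \<bullet> V)"
    using V unfolding power2_norm_eq_inner s_def
    by (simp add: inner_diff_left inner_diff_right inner_commute power2_eq_square field_simps)
  finally show False using V h by (simp add: divide_le_0_iff)
qed

text \<open>Multiplying \<open>P\<close> on either side by \<open>mat 1 + s *\<^sub>R M\<close> does not raise its rank, so \<open>Z - P\<close> is orthogonal to all
\<open>P ** M\<close> and all \<open>M ** P\<close>; the choices \<open>M = P\<^sup>T (Z - P)\<close> and \<open>M = (Z - P) P\<^sup>T\<close> give the claim.\<close>

lemma nearest_low_rank_normal:
  fixes Z P :: "real^'m^'n"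
  assumes P: "rank P \<le> r" and near: "\<And>Q. rank Q \<le> r \<Longrightarrow> norm (Z - P) \<le> norm (Z - Q)"
  shows "transpose P ** (Z - P) = 0" "(Z - P) ** transpose P = 0"
proof -
  define E where "E = Z - P"
  have "norm E \<le> norm (E - s *\<^sub>R (P ** M))" for s M
  proof -
    have "P ** (mat 1 + s *\<^sub>R M) = P + s *\<^sub>R (P ** M)"
      by (simp add: matrix_add_ldistrib matrix_scalar_ac scalar_matrix_assoc)
    then have "rank (P + s *\<^sub>R (P ** M)) \<le> r" using rank_mul_le_left[of P "mat 1 + s *\<^sub>R M"] P by simp
    from near[OF this] show ?thesis by (simp add: E_def algebra_simps)
  qed
  then have "E \<bullet> (P ** (transpose P ** E)) = 0" by (rule inner_eq_0_if_minimal)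
  then show "transpose P ** (Z - P) = 0" unfolding inner_matrix_mult_left[of E P] by (simp add: E_def)
  have "norm E \<le> norm (E - s *\<^sub>R (M ** P))" for s M
  proof -
    have "(mat 1 + s *\<^sub>R M) ** P = P + s *\<^sub>R (M ** P)"
      by (simp add: matrix_add_rdistrib scalar_matrix_assoc)
    then have "rank (P + s *\<^sub>R (M ** P)) \<le> r" using rank_mul_le_right[of "mat 1 + s *\<^sub>R M" P] P by simp
    from near[OF this] show ?thesis by (simp add: E_def algebra_simps)
  qed
  then have "E \<bullet> ((E ** transpose P) ** P) = 0" by (rule inner_eq_0_if_minimal)
  then show "(Z - P) ** transpose P = 0" unfolding inner_matrix_mult_right[of E _ P] by (simp add: E_def)
qed

text \<open>The two matrix equations express that \<open>E = Z - P\<close> for a nearest matrix \<open>P\<close> of rank at most \<open>r\<close>, through \<open>Z\<close> and \<open>E\<close>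
alone.\<close>

lemma all_calm_if_descent:
  fixes \<Omega> :: "(real^'m^'n) set"
  assumes \<Omega>: "compact \<Omega>" "convex \<Omega>" and \<kappa>: "\<kappa> > 0" and \<eta>: "\<eta> > 0"
    and slope: "\<And>Z E. Z \<in> \<Omega> \<Longrightarrow> transpose Z ** E = transpose E ** E \<Longrightarrow> Z ** transpose E = E ** transpose E \<Longrightarrow>
      0 < norm E \<Longrightarrow> norm E \<le> \<eta> \<Longrightarrow> \<exists>W\<in>\<Omega>. (W - Z) \<bullet> E \<le> - \<kappa> * norm E"
  shows "all_calm \<Omega>"
proof (rule all_calmI)
  fix r and Xb :: "real^'m^'n" assume r: "r \<le> CARD('n)" and Xb: "rank Xb \<le> r"
  obtain D0 where D0: "\<And>x. x \<in> \<Omega> \<Longrightarrow> norm x \<le> D0"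
    using compact_imp_bounded[OF \<Omega>(1)] unfolding bounded_iff by blast
  define D where "D = 2 * \<bar>D0\<bar> + 1"
  have D: "D > 0" "norm (x - y) \<le> D" if "x \<in> \<Omega>" "y \<in> \<Omega>" for x y
    using norm_triangle_ineq4[of x y] D0[OF that(1)] D0[OF that(2)] unfolding D_def by linarith+
  have D: "D > 0" "\<And>x y. x \<in> \<Omega> \<Longrightarrow> y \<in> \<Omega> \<Longrightarrow> norm (x - y) \<le> D"
    using D by (auto simp: D_def)
  let ?R = "{P :: real^'m^'n. rank P \<le> r}"
  show "\<exists>c>0. \<exists>\<delta>>0. \<exists>\<gamma>. \<forall>X\<in>\<Omega>. norm (X - Xb) \<le> \<delta> \<longrightarrow> tail_sum r X \<le> c \<longrightarrow>
      (\<exists>Y\<in>\<Omega>. rank Y \<le> r \<and> norm (X - Y) \<le> \<gamma> * tail_sum r X)"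
  proof (rule exI[of _ \<eta>], intro conjI \<eta>, rule exI[of _ 1], intro conjI zero_less_one,
      rule exI[of _ "2 * D / \<kappa>"], intro ballI impI)
    fix X assume X: "X \<in> \<Omega>" and T: "tail_sum r X \<le> \<eta>"
    obtain P where P: "rank P \<le> r" "norm (X - P) \<le> tail_sum r X" using low_rank_approx[OF r] by metis
    then have id: "infdist X ?R \<le> tail_sum r X"
      using infdist_le[of P ?R X] by (simp add: dist_norm)
    have "\<exists>Y\<in>\<Omega> \<inter> ?R. norm (X - Y) \<le> 2 * D / \<kappa> * infdist X ?R"
    proof (rule descent_error_bound[OF \<Omega> closed_rank_le[OF r] _ D \<kappa> _ X])
      show "?R \<noteq> {}" using Xb by blast
      show "infdist X ?R \<le> \<eta>" using id T by linarith
      fix Z P assume Z: "Z \<in> \<Omega>" and P: "P \<in> ?R"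
        and near: "\<And>Q. Q \<in> ?R \<Longrightarrow> norm (Z - P) \<le> norm (Z - Q)"
        and e: "0 < norm (Z - P)" "norm (Z - P) \<le> \<eta>"
      have n: "transpose P ** (Z - P) = 0" "(Z - P) ** transpose P = 0"
        using nearest_low_rank_normal[of P r Z] P near by auto
      define E where "E = Z - P"
      have ZE: "Z = P + E" by (simp add: E_def)
      have "transpose (P + E) = transpose P + transpose E" by (simp add: transpose_def vec_eq_iff)
      then have 1: "transpose Z ** E = transpose E ** E"
        using n unfolding ZE by (simp add: matrix_add_rdistrib)
      have "P ** transpose E = transpose (E ** transpose P)" by (simp add: matrix_transpose_mul)
      also have "\<dots> = 0" using n by (simp add: E_def transpose_def vec_eq_iff)
      finally have 2: "Z ** transpose E = E ** transpose E"
        unfolding ZE by (simp add: matrix_add_rdistrib)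
      show "\<exists>W\<in>\<Omega>. (W - Z) \<bullet> (Z - P) \<le> - \<kappa> * norm (Z - P)"
        using slope[OF Z 1 2] e by (simp add: E_def)
    qed
    then obtain Y where Y: "Y \<in> \<Omega>" "rank Y \<le> r" "norm (X - Y) \<le> 2 * D / \<kappa> * infdist X ?R" by blast
    have "2 * D / \<kappa> * infdist X ?R \<le> 2 * D / \<kappa> * tail_sum r X" using id D \<kappa> by (intro mult_left_mono) auto
    then show "\<exists>Y\<in>\<Omega>. rank Y \<le> r \<and> norm (X - Y) \<le> 2 * D / \<kappa> * tail_sum r X" using Y by force
  qed
qed

lemma norm_matrix_le_sum: "norm (A :: real^'m^'n) \<le> (\<Sum>i\<in>UNIV. \<Sum>j\<in>UNIV. \<bar>A $ i $ j\<bar>)"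
proof -
  have "norm A \<le> (\<Sum>i\<in>UNIV. norm (A $ i))" by (simp add: norm_vec_def[of A] L2_set_le_sum)
  also have "\<dots> \<le> (\<Sum>i\<in>UNIV. \<Sum>j\<in>UNIV. \<bar>A $ i $ j\<bar>)" by (intro sum_mono norm_le_l1_cart)
  finally show ?thesis .
qed

lemma norm_matrix_le_entries:
  assumes "\<And>i j. \<bar>(A :: real^'m^'n) $ i $ j\<bar> \<le> B"
  shows "norm A \<le> real CARD('n) * real CARD('m) * B"
proof -
  have "(\<Sum>i\<in>UNIV. \<Sum>j\<in>UNIV. \<bar>A $ i $ j\<bar>) \<le> (\<Sum>i\<in>(UNIV::'n set). \<Sum>j\<in>(UNIV::'m set). B)"
    by (intro sum_mono assms)
  then show ?thesis using norm_matrix_le_sum[of A] by simp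
qed

definition stochastic_mats :: "(real^'n^'n) set" where
  "stochastic_mats = {X. (\<forall>i j. 0 \<le> X $ i $ j) \<and> X *v 1 = 1}"

definition doubly_stochastic_mats :: "(real^'n^'n) set" where
  "doubly_stochastic_mats = {X. (\<forall>i j. 0 \<le> X $ i $ j) \<and> X *v 1 = 1 \<and> transpose X *v 1 = 1}"

lemma mult_one_eq_iff: "X *v 1 = (1 :: real^'n) \<longleftrightarrow> (\<forall>i. (\<Sum>j\<in>UNIV. X $ i $ j) = 1)"
  by (simp add: matrix_vector_mult_def vec_eq_iff)

lemma transpose_mult_one_eq_iff: "transpose X *v 1 = (1 :: real^'n) \<longleftrightarrow> (\<forall>j. (\<Sum>i\<in>UNIV. X $ i $ j) = 1)"
  by (simp add: matrix_vector_mult_def transpose_def vec_eq_iff)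

lemma stochastic_compact_convex:
  "compact (stochastic_mats :: (real^'n^'n) set)" "convex (stochastic_mats :: (real^'n^'n) set)"
proof -
  have "closed (stochastic_mats :: (real^'n^'n) set)"
    unfolding stochastic_mats_def mult_one_eq_iff
    by (intro closed_Collect_conj closed_Collect_all closed_Collect_le closed_Collect_eq continuous_intros)
  moreover have "bounded (stochastic_mats :: (real^'n^'n) set)"
    unfolding bounded_iff
  proof (intro exI ballI)
    fix X :: "real^'n^'n" assume X: "X \<in> stochastic_mats"
    show "norm X \<le> real CARD('n)"
      using norm_matrix_le_sum[of X] X by (simp add: stochastic_mats_def mult_one_eq_iff)
  qed
  ultimately show "compact (stochastic_mats :: (real^'n^'n) set)" by (simp add: compact_eq_bounded_closed)
  show "convex (stochastic_mats :: (real^'n^'n) set)"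
    by (auto simp: convex_def stochastic_mats_def algebra_simps scaleR_left_distrib[symmetric] mult_one_eq_iff
        sum.distrib sum_distrib_left[symmetric])
qed

lemma doubly_stochastic_compact_convex:
  "compact (doubly_stochastic_mats :: (real^'n^'n) set)" "convex (doubly_stochastic_mats :: (real^'n^'n) set)"
proof -
  have "closed {X :: real^'n^'n. transpose X *v 1 = 1}"
    unfolding transpose_mult_one_eq_iff
    by (intro closed_Collect_all closed_Collect_eq continuous_intros)
  moreover have *: "doubly_stochastic_mats = stochastic_mats \<inter> {X :: real^'n^'n. transpose X *v 1 = 1}"
    by (auto simp: doubly_stochastic_mats_def stochastic_mats_def)
  ultimately show "compact (doubly_stochastic_mats :: (real^'n^'n) set)"
    using stochastic_compact_convex(1) unfolding * by (intro compact_Int_closed)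
  have "convex {X :: real^'n^'n. transpose X *v 1 = 1}"
    unfolding convex_def transpose_mult_one_eq_iff by (auto simp: sum.distrib sum_distrib_left[symmetric])
  then show "convex (doubly_stochastic_mats :: (real^'n^'n) set)"
    unfolding * by (intro convex_Int stochastic_compact_convex(2))
qed

text \<open>Since \<open>1 = Z 1\<close>, the column sums of \<open>E\<close> are \<open>E\<^sup>T Z 1 = E\<^sup>T E 1\<close>, which is quadratic in \<open>E\<close>.\<close>

lemma norm_col_sums_le:
  fixes Z E :: "real^'n^'n"
  assumes "Z *v 1 = 1" "transpose Z ** E = transpose E ** E"
  shows "norm (1 v* E) \<le> norm (1 :: real^'n) * (norm E)\<^sup>2"
proof -
  have a: "1 v* E = (Z *v 1) v* E" by (simp add: assms(1))
  have b: "(Y *v x) v* E = (transpose E ** Y) *v x" for Y :: "real^'n^'n" and x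
    by (simp add: transpose_matrix_vector[symmetric] matrix_vector_mul_assoc)
  have "transpose E ** Z = transpose (transpose Z ** E)" by (simp add: matrix_transpose_mul)
  also have "\<dots> = transpose E ** E" unfolding assms(2) by (simp add: matrix_transpose_mul)
  finally have "1 v* E = (transpose E ** E) *v 1" using a b[of Z 1] by simp
  also have "norm \<dots> \<le> norm (transpose E ** E) * norm (1 :: real^'n)" by (rule norm_matrix_vector_mult_le)
  also have "\<dots> \<le> (norm E)\<^sup>2 * norm (1 :: real^'n)"
    using norm_matrix_matrix_mult_le[of "transpose E" E] by (intro mult_right_mono) (auto simp: power2_eq_square)
  finally show ?thesis by (simp add: mult.commute)
qed

lemma row_inner_self:
  fixes Z E :: "real^'m^'n"
  assumes "Z ** transpose E = E ** transpose E"
  shows "Z $ i \<bullet> E $ i = (norm (E $ i))\<^sup>2"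
proof -
  have "(Y ** transpose E) $ i $ i = Y $ i \<bullet> E $ i" for Y :: "real^'m^'n"
    by (simp add: matrix_matrix_mult_def transpose_def inner_vec_def)
  then show ?thesis using assms by (metis dot_square_norm)
qed

lemma vec_one_mult: "((1 :: real^'n) v* E) $ j = (\<Sum>i\<in>UNIV. E $ i $ j)"
  by (simp add: vector_matrix_mult_def)

text \<open>The columns of \<open>E\<close> have nearly vanishing sums, so \<open>E\<close> has a markedly negative entry, say at \<open>(i, j)\<close>. Replacing the
\<open>i\<close>-th row of \<open>Z\<close> by the \<open>j\<close>-th unit vector stays stochastic and decreases the inner product with \<open>E\<close>
by at least the modulus of that entry, because the inner product of the \<open>i\<close>-th rows of \<open>Z\<close> and \<open>E\<close>
is nonnegative.\<close>

lemma all_calm_stochastic: "all_calm (stochastic_mats :: (real^'n^'n) set)"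
proof -
  define n where "n = real CARD('n)"
  have n: "n \<ge> 1" by (simp add: n_def Suc_leI)
  define c where "c = norm (1 :: real^'n) + 1"
  have c: "c \<ge> 1" by (simp add: c_def)
  define \<kappa> where "\<kappa> = 1 / (4 * n ^ 3)"
  \<comment> \<open>If all entries exceeded \<open>- \<kappa> e\<close>, the column sums would bound all of them by \<open>c e\<^sup>2 + n \<kappa> e\<close> in modulus;
    the constants make \<open>n\<^sup>2\<close> times this at most \<open>e / 2\<close>.\<close>
  define \<eta> where "\<eta> = 1 / (4 * n\<^sup>2 * c)"
  have \<kappa>: "\<kappa> > 0" and \<eta>: "\<eta> > 0" using n c by (auto simp: \<kappa>_def \<eta>_def)
  show ?thesis
  proof (rule all_calm_if_descent[OF stochastic_compact_convex \<kappa> \<eta>])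
    fix Z E :: "real^'n^'n"
    assume Z: "Z \<in> stochastic_mats" and 1: "transpose Z ** E = transpose E ** E"
      and 2: "Z ** transpose E = E ** transpose E" and e0: "0 < norm E" "norm E \<le> \<eta>"
    define e where "e = norm E"
    have Z1: "Z *v 1 = 1" "\<And>i j. 0 \<le> Z $ i $ j" using Z by (auto simp: stochastic_mats_def)
    have col: "\<bar>\<Sum>i\<in>UNIV. E $ i $ j\<bar> \<le> c * e\<^sup>2" for j
    proof -
      have "\<bar>\<Sum>i\<in>UNIV. E $ i $ j\<bar> \<le> norm (1 v* E)"
        using component_le_norm_cart[of "1 v* E" j] by (simp add: vec_one_mult)
      also have "\<dots> \<le> norm (1 :: real^'n) * e\<^sup>2" unfolding e_def by (rule norm_col_sums_le[OF Z1(1) 1])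
      also have "\<dots> \<le> c * e\<^sup>2" by (intro mult_right_mono) (auto simp: c_def)
      finally show ?thesis .
    qed
    have "\<exists>i j. E $ i $ j \<le> - \<kappa> * e"
    proof (rule ccontr)
      assume "\<not> ?thesis"
      then have lo: "- \<kappa> * e < E $ i $ j" for i j by (meson not_le)
      have "\<bar>E $ i $ j\<bar> \<le> c * e\<^sup>2 + n * \<kappa> * e" for i j
      proof -
        have "(\<Sum>k\<in>UNIV. E $ k $ j) = E $ i $ j + (\<Sum>k\<in>UNIV - {i}. E $ k $ j)" by (simp add: sum.remove)
        moreover have "(\<Sum>k\<in>UNIV - {i}. - \<kappa> * e) \<le> (\<Sum>k\<in>UNIV - {i}. E $ k $ j)"
          using lo by (intro sum_mono) (auto intro: less_imp_le)
        moreover have "(\<Sum>k\<in>UNIV - {i}. - \<kappa> * e) = - (n - 1) * (\<kappa> * e)"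
          by (simp add: n_def card_Diff_singleton of_nat_diff Suc_leI algebra_simps)
        ultimately have up: "E $ i $ j \<le> c * e\<^sup>2 + (n - 1) * (\<kappa> * e)" using col[of j] by linarith
        have "0 \<le> \<kappa> * e" "0 \<le> (n - 1) * (\<kappa> * e)" "0 \<le> c * e\<^sup>2" using n \<kappa> c by (auto simp: e_def)
        then show ?thesis using up lo[of i j] by (simp add: algebra_simps abs_le_iff)
      qed
      then have "e \<le> n * n * (c * e\<^sup>2 + n * \<kappa> * e)" unfolding e_def n_def by (rule norm_matrix_le_entries)
      also have "\<dots> = (n\<^sup>2 * c * e) * e + e / 4" using n by (simp add: \<kappa>_def power2_eq_square power3_eq_cube field_simps)
      also have "(n\<^sup>2 * c * e) * e \<le> (n\<^sup>2 * c * \<eta>) * e"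
        using e0 n c by (intro mult_right_mono mult_left_mono) (auto simp: e_def)
      also have "n\<^sup>2 * c * \<eta> = 1 / 4" using n c by (simp add: \<eta>_def)
      finally show False using e0 by (simp add: e_def)
    qed
    then obtain i j where ij: "E $ i $ j \<le> - \<kappa> * e" by blast
    define W where "W = (\<chi> k. if k = i then axis j 1 else Z $ k)"
    have "W \<in> stochastic_mats"
      using Z by (auto simp: stochastic_mats_def mult_one_eq_iff W_def axis_def)
    moreover have "(W - Z) \<bullet> E = (\<Sum>k\<in>UNIV. if k = i then (axis j 1 - Z $ i) \<bullet> E $ i else 0)"
      unfolding inner_vec_def[of "W - Z"] by (intro sum.cong) (auto simp: W_def)
    then have "(W - Z) \<bullet> E = E $ i $ j - (norm (E $ i))\<^sup>2"
      using row_inner_self[OF 2, of i] by (simp add: inner_diff_left inner_axis')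
    then have "(W - Z) \<bullet> E \<le> - \<kappa> * norm E"
      using ij zero_le_power2[of "norm (E $ i)"] unfolding e_def by linarith
    ultimately show "\<exists>W\<in>stochastic_mats. (W - Z) \<bullet> E \<le> - \<kappa> * norm E" by blast
  qed
qed

text \<open>Both row and column sums of \<open>E\<close> are of second order, so subtracting a small multiple of the doubly centred
\<open>E\<close> from the barycentre of the polytope gives a doubly stochastic \<open>W\<close> with markedly negative inner
product with \<open>E\<close>.\<close>

lemma all_calm_doubly_stochastic: "all_calm (doubly_stochastic_mats :: (real^'n^'n) set)"
proof -
  define n where "n = real CARD('n)"
  have n: "n \<ge> 1" by (simp add: n_def Suc_leI)
  define c where "c = norm (1 :: real^'n) + 1"
  have c: "c \<ge> 1" by (simp add: c_def)
  define \<kappa> where "\<kappa> = 1 / (16 * n)"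
  define \<eta> where "\<eta> = 1 / (16 * n * c)"
  have \<kappa>: "\<kappa> > 0" and \<eta>: "\<eta> > 0" using n c by (auto simp: \<kappa>_def \<eta>_def)
  show ?thesis
  proof (rule all_calm_if_descent[OF doubly_stochastic_compact_convex \<kappa> \<eta>])
    fix Z E :: "real^'n^'n"
    assume Z: "Z \<in> doubly_stochastic_mats" and 1: "transpose Z ** E = transpose E ** E"
      and 2: "Z ** transpose E = E ** transpose E" and e0: "0 < norm E" "norm E \<le> \<eta>"
    define e where "e = norm E"
    have e: "e > 0" "c * e \<le> 1 / (16 * n)"
    proof -
      have "c * e \<le> c * \<eta>" using e0 c by (intro mult_left_mono) (auto simp: e_def)
      also have "\<dots> = 1 / (16 * n)" using c by (simp add: \<eta>_def)
      finally show "c * e \<le> 1 / (16 * n)" .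
    qed (use e0 in \<open>simp add: e_def\<close>)
    have ce16: "c * e \<le> 1 / 16"
      using e(2) n by (smt (verit) frac_le mult_le_cancel_left1)
    have Z1: "Z *v 1 = 1" "transpose Z *v 1 = 1" using Z by (auto simp: doubly_stochastic_mats_def)
    define row where "row = (\<chi> i. \<Sum>j\<in>UNIV. E $ i $ j)"
    define col where "col = (\<chi> j. \<Sum>i\<in>UNIV. E $ i $ j)"
    define s where "s = (\<Sum>i\<in>UNIV. \<Sum>j\<in>UNIV. E $ i $ j)"
    have "col = 1 v* E" by (simp add: col_def vec_eq_iff vec_one_mult)
    then have "norm col \<le> norm (1 :: real^'n) * e\<^sup>2" unfolding e_def using norm_col_sums_le[OF Z1(1) 1] by simp
    also have "\<dots> \<le> c * e\<^sup>2" by (intro mult_right_mono) (auto simp: c_def)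
    finally have ncol: "norm col \<le> c * e\<^sup>2" .
    have "row = 1 v* transpose E" by (simp add: row_def vec_eq_iff vec_one_mult transpose_def)
    then have "norm row \<le> norm (1 :: real^'n) * e\<^sup>2"
      using norm_col_sums_le[of "transpose Z" "transpose E"] Z1(2) 2 by (simp add: e_def)
    also have "\<dots> \<le> c * e\<^sup>2" by (intro mult_right_mono) (auto simp: c_def)
    finally have nrow: "norm row \<le> c * e\<^sup>2" .
    have srow: "s = (\<Sum>i\<in>UNIV. row $ i)" by (simp add: s_def row_def)
    have scol: "s = (\<Sum>j\<in>UNIV. col $ j)" unfolding s_def col_def by (subst sum.swap) simp
    have ri: "\<bar>row $ i\<bar> \<le> c * e\<^sup>2" for i using component_le_norm_cart[of row i] nrow by simp
    have cj: "\<bar>col $ j\<bar> \<le> c * e\<^sup>2" for j using component_le_norm_cart[of col j] ncol by simp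
    have sn: "\<bar>s\<bar> \<le> n * (c * e\<^sup>2)"
    proof -
      have "\<bar>s\<bar> \<le> (\<Sum>i\<in>UNIV. \<bar>row $ i\<bar>)" unfolding srow by (rule sum_abs)
      also have "\<dots> \<le> (\<Sum>i\<in>(UNIV::'n set). c * e\<^sup>2)" by (intro sum_mono ri)
      finally show ?thesis by (simp add: n_def)
    qed
    \<comment> \<open>\<open>N\<close> is the doubly centred \<open>E\<close>, and \<open>t\<close> below makes the entries of \<open>t N\<close> at most \<open>1 / n\<close>.\<close>
    define N where "N = (\<chi> i j. E $ i $ j - row $ i / n - col $ j / n + s / n\<^sup>2)"
    have nn: "real CARD('n) = n" by (simp add: n_def)
    have Nrow: "(\<Sum>j\<in>UNIV. N $ i $ j) = 0" for i
    proof -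
      have "(\<Sum>j\<in>UNIV. N $ i $ j) = row $ i - n * (row $ i / n) - s / n + n * (s / n\<^sup>2)"
        by (simp add: N_def sum.distrib sum_subtractf row_def scol nn sum_divide_distrib)
      then show ?thesis using n by (simp add: power2_eq_square)
    qed
    have Ncol: "(\<Sum>i\<in>UNIV. N $ i $ j) = 0" for j
    proof -
      have "(\<Sum>i\<in>UNIV. N $ i $ j) = col $ j - s / n - n * (col $ j / n) + n * (s / n\<^sup>2)"
        by (simp add: N_def sum.distrib sum_subtractf col_def srow nn sum_divide_distrib)
      then show ?thesis using n by (simp add: power2_eq_square)
    qed
    have N4: "\<bar>N $ i $ j\<bar> \<le> 4 * e" for i j
    proof -
      have a: "\<bar>E $ i $ j\<bar> \<le> e"
        using component_le_norm_cart[of "E $ i" j] Finite_Cartesian_Product.norm_nth_le[of E i]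
        unfolding e_def by linarith
      have ce2: "c * e\<^sup>2 \<le> e" using ce16 e(1) by (simp add: power2_eq_square mult.assoc[symmetric])
      have div: "\<bar>x / n\<bar> \<le> e" if "\<bar>x\<bar> \<le> c * e\<^sup>2" for x
      proof -
        have "\<bar>x / n\<bar> \<le> \<bar>x\<bar>" using n mult_left_mono[of 1 n "\<bar>x\<bar>"] by (simp add: abs_divide divide_le_eq)
        then show ?thesis using that ce2 by simp
      qed
      have "\<bar>s / n\<bar> \<le> c * e\<^sup>2" using sn n by (simp add: abs_divide divide_le_eq mult.commute)
      from div[OF this] have "\<bar>s / n\<^sup>2\<bar> \<le> e" by (simp add: power2_eq_square)
      then show ?thesis using a div[OF ri[of i]] div[OF cj[of j]]
        unfolding N_def vec_lambda_beta by linarith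
    qed
    define t where "t = 1 / (4 * n * e)"
    have t: "t > 0" using n e by (simp add: t_def)
    define J where "J = ((\<chi> i j. 1 / n) :: real^'n^'n)"
    define W where "W = J - t *\<^sub>R N"
    have "W \<in> doubly_stochastic_mats"
      unfolding doubly_stochastic_mats_def mem_Collect_eq transpose_mult_one_eq_iff
      unfolding mult_one_eq_iff
    proof (intro conjI allI)
      show "(\<Sum>j\<in>UNIV. W $ i $ j) = 1" for i using n Nrow[of i]
        by (simp add: W_def J_def sum_subtractf sum_distrib_left[symmetric] nn)
      show "(\<Sum>i\<in>UNIV. W $ i $ j) = 1" for j using n Ncol[of j]
        by (simp add: W_def J_def sum_subtractf sum_distrib_left[symmetric] nn)
      fix i j
      have "t * N $ i $ j \<le> t * (4 * e)" using N4[of i j] t by (intro mult_left_mono) auto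
      then show "0 \<le> W $ i $ j" using n e by (simp add: W_def J_def t_def)
    qed
    moreover have "(W - Z) \<bullet> E \<le> - \<kappa> * norm E"
    proof -
      have ZE: "Z \<bullet> E \<ge> 0"
        unfolding inner_vec_def[of Z] row_inner_self[OF 2] by (intro sum_nonneg) simp
      have JE: "J \<bullet> E \<le> c * e\<^sup>2"
      proof -
        have "J \<bullet> E = s / n" by (simp add: J_def inner_vec_def s_def sum_divide_distrib)
        also have "\<dots> \<le> c * e\<^sup>2" using sn n by (simp add: divide_le_eq mult.commute abs_le_iff)
        finally show ?thesis .
      qed
      have NE: "N \<bullet> E \<ge> e\<^sup>2 / 2"
      proof -
        have rowi: "(\<Sum>j\<in>UNIV. E $ i $ j) = row $ i" and colj: "(\<Sum>i\<in>UNIV. E $ i $ j) = col $ j" for i j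
          by (simp_all add: row_def col_def)
        have "N \<bullet> E = (\<Sum>i\<in>UNIV. \<Sum>j\<in>UNIV. (E $ i $ j)\<^sup>2) - (\<Sum>i\<in>UNIV. \<Sum>j\<in>UNIV. row $ i / n * E $ i $ j)
           - (\<Sum>i\<in>UNIV. \<Sum>j\<in>UNIV. col $ j / n * E $ i $ j) + (\<Sum>i\<in>UNIV. \<Sum>j\<in>UNIV. s / n\<^sup>2 * E $ i $ j)"
          by (simp add: N_def inner_vec_def sum.distrib sum_subtractf algebra_simps power2_eq_square)
        also have "(\<Sum>i\<in>UNIV. \<Sum>j\<in>UNIV. (E $ i $ j)\<^sup>2) = e\<^sup>2"
          unfolding e_def power2_norm_eq_inner inner_vec_def by (simp add: power2_eq_square)
        also have "(\<Sum>i\<in>UNIV. \<Sum>j\<in>UNIV. row $ i / n * E $ i $ j) = (norm row)\<^sup>2 / n"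
          unfolding power2_norm_eq_inner inner_vec_def sum_distrib_left[symmetric] rowi
          by (simp add: sum_divide_distrib)
        also have "(\<Sum>i\<in>UNIV. \<Sum>j\<in>UNIV. col $ j / n * E $ i $ j) = (norm col)\<^sup>2 / n"
          unfolding power2_norm_eq_inner inner_vec_def
          by (subst sum.swap, unfold sum_distrib_left[symmetric] colj) (simp add: sum_divide_distrib)
        also have "(\<Sum>i\<in>UNIV. \<Sum>j\<in>UNIV. s / n\<^sup>2 * E $ i $ j) = s\<^sup>2 / n\<^sup>2"
          unfolding sum_distrib_left[symmetric] s_def[symmetric] by (simp add: power2_eq_square)
        finally have eq: "N \<bullet> E = e\<^sup>2 - (norm row)\<^sup>2 / n - (norm col)\<^sup>2 / n + s\<^sup>2 / n\<^sup>2" .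
        have small: "y\<^sup>2 / n \<le> e\<^sup>2 / 4" if "0 \<le> y" "y \<le> c * e\<^sup>2" for y
        proof -
          have "c * e\<^sup>2 = (c * e) * e" by (simp add: power2_eq_square)
          also have "\<dots> \<le> 1 / 16 * e" using ce16 e by (intro mult_right_mono) auto
          finally have "y \<le> e / 16" using that by simp
          then have "y\<^sup>2 \<le> (e / 16)\<^sup>2" using that by (intro power_mono) auto
          moreover have "y\<^sup>2 / n \<le> y\<^sup>2 / 1" using n by (intro divide_left_mono) auto
          moreover have "(e / 16)\<^sup>2 \<le> e\<^sup>2 / 4" by (simp add: power2_eq_square)
          ultimately show ?thesis by linarith
        qed
        have "0 \<le> s\<^sup>2 / n\<^sup>2" by simp
        then show ?thesis using eq small[OF norm_ge_zero nrow] small[OF norm_ge_zero ncol] by linarith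
      qed
      have "(W - Z) \<bullet> E = J \<bullet> E - t * (N \<bullet> E) - Z \<bullet> E" by (simp add: W_def inner_diff_left)
      also have "\<dots> \<le> c * e\<^sup>2 - t * (e\<^sup>2 / 2)" using JE ZE NE t by (smt (verit) mult_left_mono)
      also have "t * (e\<^sup>2 / 2) = e / (8 * n)" using e n by (simp add: t_def power2_eq_square)
      also have "c * e\<^sup>2 = (c * e) * e" by (simp add: power2_eq_square)
      also have "(c * e) * e \<le> 1 / (16 * n) * e" using e by (intro mult_right_mono) auto
      finally show ?thesis using n by (simp add: \<kappa>_def e_def field_simps)
    qed
    ultimately show "\<exists>W\<in>doubly_stochastic_mats. (W - Z) \<bullet> E \<le> - \<kappa> * norm E" by blast
  qed
qed

section \<open>Slices of the positive semidefinite cone\<close>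

lemma entry_le_norm: "\<bar>(A :: real^'m^'n) $ i $ j\<bar> \<le> norm A"
  using component_le_norm_cart[of "A $ i" j] Finite_Cartesian_Product.norm_nth_le[of A i] by linarith

lemma congruence_entry:
  fixes L :: "real^'m^'n" and P :: "real^'m^'m"
  shows "(L ** P ** transpose L) $ i $ j = L $ i \<bullet> (P *v L $ j)"
proof -
  have "(A ** transpose L) $ i $ j = A $ i \<bullet> L $ j" for A :: "real^'m^'n"
    by (simp add: matrix_matrix_mult_def transpose_def inner_vec_def)
  from this[of "L ** P"] show ?thesis unfolding row_matrix_matrix_mult dot_lmul_matrix .
qed

lemma psd_mats_congruence:
  fixes L P :: "real^'n^'n"
  assumes "P \<in> psd_mats"
  shows "L ** P ** transpose L \<in> psd_mats"
proof -
  have "transpose (L ** P ** transpose L) = L ** P ** transpose L"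
    using assms by (simp add: matrix_transpose_mul psd_mats_def sym_mats_def matrix_mul_assoc)
  moreover have "v \<bullet> ((L ** P ** transpose L) *v v) = (v v* L) \<bullet> (P *v (v v* L))" for v
    by (simp add: matrix_vector_mul_assoc[symmetric] dot_lmul_matrix)
  ultimately show ?thesis using assms by (simp add: psd_mats_def sym_mats_def)
qed

lemma norm_congruence_diff_le:
  fixes L P :: "real^'n^'n"
  assumes L: "norm (L - mat 1) \<le> K * d" and K: "0 \<le> K" "0 \<le> d" "d \<le> c" and P: "norm P \<le> B"
  shows "norm L \<le> norm (mat 1 :: real^'n^'n) + K * c"
    "norm (L ** P ** transpose L - P) \<le> (norm (mat 1 :: real^'n^'n) + K * c + 1) * B * K * d"
proof -
  let ?M = "L - mat 1"
  have Kd: "K * d \<le> K * c" using K by (intro mult_left_mono) auto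
  have "norm L \<le> norm (mat 1 :: real^'n^'n) + norm ?M"
    using norm_triangle_ineq[of "mat 1" ?M] by simp
  then show nL: "norm L \<le> norm (mat 1 :: real^'n^'n) + K * c" using L Kd by linarith
  have B: "B \<ge> 0" using P norm_ge_zero order_trans by blast
  have tM: "transpose L = mat 1 + transpose ?M"
    by (simp add: transpose_def vec_eq_iff mat_def)
  have "L ** P ** transpose L = (mat 1 + ?M) ** P ** transpose L" by simp
  also have "\<dots> = P ** transpose L + ?M ** P ** transpose L" by (simp only: matrix_add_rdistrib matrix_mul_lid)
  also have "P ** transpose L = P + P ** transpose ?M" unfolding tM by (simp only: matrix_add_ldistrib matrix_mul_rid)
  finally have eq: "L ** P ** transpose L - P = P ** transpose ?M + ?M ** P ** transpose L" by simp
  have "norm (P ** transpose ?M) \<le> B * (K * d)"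
    using norm_matrix_matrix_mult_le[of P "transpose ?M"] L P B K
    by (intro order_trans[OF norm_matrix_matrix_mult_le] mult_mono) auto
  moreover have "norm (?M ** P ** transpose L) \<le> (K * d) * B * (norm (mat 1 :: real^'n^'n) + K * c)"
  proof -
    have "norm (?M ** P) \<le> (K * d) * B"
      using L P K by (intro order_trans[OF norm_matrix_matrix_mult_le] mult_mono) auto
    then show ?thesis using nL B K
      by (intro order_trans[OF norm_matrix_matrix_mult_le[of "?M ** P" "transpose L"]] mult_mono) auto
  qed
  ultimately have "norm (L ** P ** transpose L - P) \<le> B * (K * d) + (K * d) * B * (norm (mat 1 :: real^'n^'n) + K * c)"
    unfolding eq by (intro order_trans[OF norm_triangle_ineq]) simp
  also have "\<dots> = (norm (mat 1 :: real^'n^'n) + K * c + 1) * B * K * d" by (simp add: algebra_simps)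
  finally show "norm (L ** P ** transpose L - P) \<le> (norm (mat 1 :: real^'n^'n) + K * c + 1) * B * K * d" .
qed

text \<open>Near \<open>Xb\<close>, every semidefinite \<open>P\<close> close to a feasible \<open>X\<close> can be made feasible by a congruence whose distance from
the identity is of the order of \<open>norm (X - P)\<close>. Applied to a truncation of \<open>X\<close>, this does not raise the rank.\<close>

definition congruence_repairable :: "(real^'n^'n) set \<Rightarrow> real^'n^'n \<Rightarrow> bool" where
  "congruence_repairable \<Omega> Xb \<longleftrightarrow> (\<exists>c>0. \<exists>\<kappa>\<ge>0. \<forall>X\<in>\<Omega>. \<forall>P\<in>psd_mats.
     norm (X - Xb) \<le> c \<longrightarrow> norm (X - P) \<le> c \<longrightarrow>
     (\<exists>L. norm (L - mat 1) \<le> \<kappa> * norm (X - P) \<and> L ** P ** transpose L \<in> \<Omega>))"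

lemma all_calm_if_congruence_repairable:
  fixes \<Omega> :: "(real^'n^'n) set"
  assumes psd: "\<Omega> \<subseteq> psd_mats" and rep: "\<And>Xb. Xb \<in> \<Omega> \<Longrightarrow> congruence_repairable \<Omega> Xb"
  shows "all_calm \<Omega>"
proof (rule all_calmI)
  fix r and Xb :: "real^'n^'n" assume r: "r \<le> CARD('n)" and Xb: "Xb \<in> \<Omega>"
  obtain c \<kappa> where c: "c > 0" and \<kappa>: "\<kappa> \<ge> 0"
    and L: "\<And>X P. X \<in> \<Omega> \<Longrightarrow> P \<in> psd_mats \<Longrightarrow> norm (X - Xb) \<le> c \<Longrightarrow> norm (X - P) \<le> c \<Longrightarrow>
      \<exists>L. norm (L - mat 1) \<le> \<kappa> * norm (X - P) \<and> L ** P ** transpose L \<in> \<Omega>"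
    using rep[OF Xb] unfolding congruence_repairable_def by meson
  define B where "B = norm Xb + 2 * c"
  define G where "G = (norm (mat 1 :: real^'n^'n) + \<kappa> * c + 1) * B * \<kappa>"
  have G: "G \<ge> 0" using c \<kappa> by (simp add: G_def B_def)
  show "\<exists>c>0. \<exists>\<delta>>0. \<exists>\<gamma>. \<forall>X\<in>\<Omega>. norm (X - Xb) \<le> \<delta> \<longrightarrow> tail_sum r X \<le> c \<longrightarrow>
      (\<exists>Y\<in>\<Omega>. rank Y \<le> r \<and> norm (X - Y) \<le> \<gamma> * tail_sum r X)"
  proof (rule exI[of _ c], intro conjI c, rule exI[of _ c], intro conjI c,
      rule exI[of _ "1 + G"], intro ballI impI)
    fix X assume X: "X \<in> \<Omega>" and d: "norm (X - Xb) \<le> c" and T: "tail_sum r X \<le> c"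
    obtain P where P: "P \<in> psd_mats" "rank P \<le> r" "norm (X - P) \<le> tail_sum r X"
      using truncatable_cone_psd_mats X psd r unfolding truncatable_cone_def by blast
    have XPc: "norm (X - P) \<le> c" using P T by simp
    obtain L where L: "norm (L - mat 1) \<le> \<kappa> * norm (X - P)" "L ** P ** transpose L \<in> \<Omega>"
      using L[OF X P(1) d XPc] by blast
    have "norm P \<le> B"
      using norm_triangle_ineq3[of X Xb] norm_triangle_ineq3[of X P] XPc d by (simp add: B_def)
    from norm_congruence_diff_le(2)[OF L(1) \<kappa> norm_ge_zero XPc this]
    have "norm (L ** P ** transpose L - P) \<le> G * norm (X - P)" by (simp add: G_def)
    then have "norm (X - L ** P ** transpose L) \<le> (1 + G) * norm (X - P)"
      using norm_triangle_ineq[of "X - P" "P - L ** P ** transpose L"]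
      by (simp add: norm_minus_commute algebra_simps)
    also have "\<dots> \<le> (1 + G) * tail_sum r X" using G P(3) by (intro mult_left_mono) auto
    finally have "norm (X - L ** P ** transpose L) \<le> (1 + G) * tail_sum r X" .
    moreover have "rank (L ** P ** transpose L) \<le> r"
      using rank_mul_le_left[of "L ** P" "transpose L"] rank_mul_le_right[of L P] P(2) by linarith
    ultimately show "\<exists>Y\<in>\<Omega>. rank Y \<le> r \<and> norm (X - Y) \<le> (1 + G) * tail_sum r X" using L(2) by blast
  qed
qed

lemma inverse_sqrt_near_1:
  assumes "\<bar>x - 1\<bar> \<le> 1 / 2"
  shows "\<bar>1 / sqrt x - 1\<bar> \<le> \<bar>x - 1\<bar>"
proof -
  define y where "y = sqrt x"
  have x: "x \<ge> 1 / 2" using assms by linarith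
  have y: "y * y = x" "y \<ge> 0" using x by (auto simp: y_def)
  have y2: "y \<ge> 1 / 2"
  proof (rule ccontr)
    assume "\<not> ?thesis"
    then have "y * y \<le> 1 / 2 * (1 / 2)" using y(2) by (intro mult_mono) auto
    then show False using y(1) x by simp
  qed
  have "(1 / y - 1) * (y * (1 + y)) = 1 - y * y" using y2 by (simp add: field_simps)
  then have "\<bar>1 / y - 1\<bar> * (y * (1 + y)) = \<bar>x - 1\<bar>"
    using y y2 by (metis abs_minus_commute abs_mult abs_of_nonneg add_nonneg_nonneg mult_nonneg_nonneg zero_le_one)
  moreover have "y * (1 + y) \<ge> 1" using y x y2 by (simp add: algebra_simps)
  ultimately have "\<bar>1 / y - 1\<bar> \<le> \<bar>x - 1\<bar>"
    using mult_left_mono[of 1 "y * (1 + y)" "\<bar>1 / y - 1\<bar>"] by simp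
  then show ?thesis by (simp add: y_def)
qed

text \<open>Acting on Gram vectors, this scales the \<open>i\<close>-th vector by \<open>\<beta> i\<close> and adds \<open>\<tau> i\<close> times the vector with index \<open>c\<close>.\<close>

definition row_op :: "'n \<Rightarrow> ('n \<Rightarrow> real) \<Rightarrow> ('n \<Rightarrow> real) \<Rightarrow> real^'n^'n" where
  "row_op c \<beta> \<tau> = (\<chi> i. \<beta> i *\<^sub>R axis i 1 + \<tau> i *\<^sub>R axis c 1)"

lemma row_op_congruence_entry:
  "(row_op c \<beta> \<tau> ** P ** transpose (row_op c \<beta> \<tau>)) $ i $ j =
     \<beta> i * \<beta> j * P $ i $ j + \<beta> i * \<tau> j * P $ i $ c + \<tau> i * \<beta> j * P $ c $ j + \<tau> i * \<tau> j * P $ c $ c"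
  unfolding congruence_entry
  by (simp add: row_op_def inner_add_left matrix_vector_right_distrib matrix_vector_mult_scaleR
      matrix_vector_mult_basis inner_axis' column_def algebra_simps)

lemma norm_row_op_diff_le:
  fixes \<beta> :: "'n::finite \<Rightarrow> real"
  assumes "\<And>i. \<bar>\<beta> i - 1\<bar> \<le> B" "\<And>i. \<bar>\<tau> i\<bar> \<le> B"
  shows "norm (row_op c \<beta> \<tau> - mat 1) \<le> real CARD('n) * real CARD('n) * (2 * B)"
proof (rule norm_matrix_le_entries)
  fix i j
  have "(row_op c \<beta> \<tau> - mat 1) $ i $ j = (if i = j then \<beta> i - 1 else 0) + (if j = c then \<tau> i else 0)"
    by (auto simp: row_op_def mat_def axis_def)
  then show "\<bar>(row_op c \<beta> \<tau> - mat 1) $ i $ j\<bar> \<le> 2 * B"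
    using assms(1)[of i] assms(2)[of i] by (auto split: if_splits)
qed

text \<open>Scale the Gram vectors of the truncation to unit length.\<close>

lemma all_calm_correlation:
  "all_calm (psd_mats \<inter> {X \<in> sym_mats :: (real^'n^'n) set. \<forall>i. X $ i $ i = 1})" (is "all_calm ?\<Omega>")
proof (rule all_calm_if_congruence_repairable)
  fix Xb :: "real^'n^'n"
  define N where "N = real CARD('n) * real CARD('n) * 2"
  show "congruence_repairable ?\<Omega> Xb"
    unfolding congruence_repairable_def
  proof (rule exI[of _ "1/2"], intro conjI, simp, rule exI[of _ N], intro conjI ballI impI)
    fix X P :: "real^'n^'n" assume X: "X \<in> ?\<Omega>" and P: "P \<in> psd_mats" and XP: "norm (X - P) \<le> 1 / 2"
    have d: "\<bar>P $ i $ i - 1\<bar> \<le> norm (X - P)" for i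
      using entry_le_norm[of "X - P" i i] X by (simp add: abs_minus_commute)
    define \<beta> where "\<beta> i = 1 / sqrt (P $ i $ i)" for i
    \<comment> \<open>With all \<open>\<tau>\<close> zero the index \<open>c\<close> is immaterial.\<close>
    define L where "L = row_op undefined \<beta> (\<lambda>_. 0)"
    have "\<bar>\<beta> i - 1\<bar> \<le> norm (X - P)" for i
      unfolding \<beta>_def using inverse_sqrt_near_1[of "P $ i $ i"] d[of i] XP by linarith
    then have "norm (L - mat 1) \<le> N * norm (X - P)"
      unfolding L_def N_def using norm_row_op_diff_le[of \<beta> "norm (X - P)" "\<lambda>_. 0"] by (simp add: mult.assoc)
    moreover have Y: "L ** P ** transpose L \<in> psd_mats" by (rule psd_mats_congruence[OF P])
    have pos: "P $ i $ i > 0" for i using d[of i] XP by linarith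
    have "(L ** P ** transpose L) $ i $ i = 1" for i
      unfolding L_def row_op_congruence_entry using pos[of i] by (simp add: \<beta>_def)
    ultimately show "\<exists>L. norm (L - mat 1) \<le> N * norm (X - P) \<and> L ** P ** transpose L \<in> ?\<Omega>"
      using Y by (intro exI[of _ L]) (auto simp: psd_mats_def)
  qed (simp add: N_def)
qed auto

text \<open>Write \<open>P\<close> as the Gram matrix of vectors \<open>g\<^sub>i\<close>. The constraints say that \<open>g\<^sub>c\<close> is a unit vector and that
every other \<open>g\<^sub>i\<close> lies on the sphere with centre \<open>g\<^sub>c / 2\<close> and radius \<open>1 / 2\<close>. So normalise \<open>g\<^sub>c\<close> and
project the other vectors radially to the resulting sphere; this is a row operation.\<close>

lemma all_calm_lifted_binary:
  fixes c :: "'n::finite"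
  shows "all_calm (psd_mats \<inter> {X \<in> sym_mats :: (real^'n^'n) set. X $ c $ c = 1 \<and>
      (\<forall>i. i \<noteq> c \<longrightarrow> X $ i $ i - 1 / 2 * (X $ c $ i + X $ i $ c) = 0)})" (is "all_calm ?\<Omega>")
proof (rule all_calm_if_congruence_repairable)
  fix Xb :: "real^'n^'n"
  define H where "H = 12 + 4 * norm Xb + 4"
  have H: "H \<ge> 16" by (simp add: H_def)
  define N where "N = real CARD('n) * real CARD('n) * (2 * H)"
  have symE: "Y $ i $ j = Y $ j $ i" if "Y \<in> psd_mats" for Y :: "real^'n^'n" and i j
  proof -
    have "transpose Y $ i $ j = Y $ i $ j" using that by (simp add: psd_mats_def sym_mats_def)
    then show ?thesis by (simp add: transpose_def)
  qed
  show "congruence_repairable ?\<Omega> Xb"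
    unfolding congruence_repairable_def
  proof (rule exI[of _ "1/(2*H)"], intro conjI, use H in simp, rule exI[of _ N], intro conjI ballI impI)
    fix X P :: "real^'n^'n" assume X: "X \<in> ?\<Omega>" and P: "P \<in> psd_mats"
      and Xn: "norm (X - Xb) \<le> 1 / (2 * H)" and XP: "norm (X - P) \<le> 1 / (2 * H)"
    define d where "d = norm (X - P)"
    have Hd: "H * d \<le> 1 / 2" using XP H by (simp add: d_def field_simps)
    have d0: "d \<ge> 0" by (simp add: d_def)
    have dH: "d \<le> H * d" using H d0 by (simp add: mult_le_cancel_right1)
    have c1: "1 / (2 * H) \<le> 1 / 2" using H by (simp add: field_simps)
    have en: "\<bar>P $ i $ j - X $ i $ j\<bar> \<le> d" for i j
      using entry_le_norm[of "X - P" i j] by (simp add: d_def abs_minus_commute)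
    have nP: "norm P \<le> norm Xb + 1"
      using norm_triangle_ineq3[of X Xb] norm_triangle_ineq3[of X P] Xn XP c1 by linarith
    have Pci: "\<bar>P $ c $ i\<bar> \<le> norm Xb + 1" for i using entry_le_norm[of P c i] nP by linarith
    have Xcc: "X $ c $ c = 1" and Xii: "i \<noteq> c \<Longrightarrow> X $ i $ i = X $ c $ i" for i
      using X symE[of X c i] by auto
    define \<alpha> where "\<alpha> = 1 / sqrt (P $ c $ c)"
    have pcc: "\<bar>P $ c $ c - 1\<bar> \<le> d" using en[of c c] Xcc by simp
    have \<alpha>1: "\<bar>\<alpha> - 1\<bar> \<le> d"
      unfolding \<alpha>_def using inverse_sqrt_near_1[of "P $ c $ c"] pcc dH Hd by linarith
    have pccpos: "P $ c $ c > 0" using pcc dH Hd by linarith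
    have \<alpha>sq: "\<alpha> * \<alpha> * P $ c $ c = 1" using pccpos by (simp add: \<alpha>_def)
    \<comment> \<open>four times the squared distance of the i-th Gram vector to the centre of the sphere\<close>
    define q where "q i = 4 * (P $ i $ i - \<alpha> * P $ c $ i) + 1" for i
    have q1: "\<bar>q i - 1\<bar> \<le> H * d" if "i \<noteq> c" for i
    proof -
      have "\<bar>P $ i $ i - P $ c $ i\<bar> \<le> 2 * d" using en[of i i] en[of c i] Xii[OF that] by linarith
      moreover have "\<bar>(1 - \<alpha>) * P $ c $ i\<bar> \<le> d * (norm Xb + 1)"
        unfolding abs_mult using \<alpha>1 Pci[of i] by (intro mult_mono) auto
      moreover have "q i - 1 = 4 * (P $ i $ i - P $ c $ i) + 4 * ((1 - \<alpha>) * P $ c $ i)"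
        by (simp add: q_def algebra_simps)
      moreover have "\<bar>x\<bar> \<le> a \<Longrightarrow> \<bar>y\<bar> \<le> b \<Longrightarrow> z = 4 * x + 4 * y \<Longrightarrow> \<bar>z\<bar> \<le> 4 * a + 4 * b" for x y z a b :: real
        by linarith
      ultimately have "\<bar>q i - 1\<bar> \<le> 4 * (2 * d) + 4 * (d * (norm Xb + 1))" by blast
      also have "\<dots> \<le> H * d" using d0 by (simp add: H_def algebra_simps)
      finally show ?thesis .
    qed
    define \<beta> where "\<beta> i = (if i = c then \<alpha> else 1 / sqrt (q i))" for i
    define \<tau> where "\<tau> i = (if i = c then 0 else \<alpha> * (1 - \<beta> i) / 2)" for i
    define L where "L = row_op c \<beta> \<tau>"
    have \<beta>1: "\<bar>\<beta> i - 1\<bar> \<le> H * d" for i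
    proof (cases "i = c")
      case True then show ?thesis using \<alpha>1 dH by (simp add: \<beta>_def)
    next
      case False
      then show ?thesis using inverse_sqrt_near_1[of "q i"] q1[OF False] Hd by (simp add: \<beta>_def)
    qed
    have \<tau>1: "\<bar>\<tau> i\<bar> \<le> H * d" for i
    proof (cases "i = c")
      case True then show ?thesis using H d0 by (simp add: \<tau>_def)
    next
      case False
      have "\<bar>\<alpha> * (1 - \<beta> i)\<bar> \<le> 2 * (H * d)"
        unfolding abs_mult using \<alpha>1 dH Hd \<beta>1[of i] by (intro mult_mono) auto
      then show ?thesis using False by (simp add: \<tau>_def)
    qed
    have "norm (L - mat 1) \<le> N * d"
      unfolding L_def N_def using norm_row_op_diff_le[of \<beta> "H * d" \<tau> c] \<beta>1 \<tau>1 by (simp add: mult.assoc)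
    moreover have Y: "L ** P ** transpose L \<in> psd_mats" by (rule psd_mats_congruence[OF P])
    moreover have "(L ** P ** transpose L) $ c $ c = 1"
      unfolding L_def row_op_congruence_entry using \<alpha>sq by (simp add: \<beta>_def \<tau>_def)
    moreover have "(L ** P ** transpose L) $ i $ i = (L ** P ** transpose L) $ c $ i" if i: "i \<noteq> c" for i
    proof -
      define b where "b = \<beta> i"
      have qpos: "q i > 0" using q1[OF i] Hd by linarith
      then have bq: "b * b * q i = 1" using i by (simp add: b_def \<beta>_def)
      have ic: "P $ i $ c = P $ c $ i" using symE[OF P] .
      have \<tau>i: "\<tau> i = \<alpha> * (1 - b) / 2" using i by (simp add: \<tau>_def b_def)
      have c: "\<beta> c = \<alpha>" "\<tau> c = 0" by (auto simp: \<beta>_def \<tau>_def)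
      have 1: "(L ** P ** transpose L) $ c $ i = \<alpha> * b * P $ c $ i + (1 - b) / 2"
        unfolding L_def row_op_congruence_entry c \<tau>i using \<alpha>sq by (simp add: b_def algebra_simps) algebra
      have 2: "(L ** P ** transpose L) $ i $ i = b * b * P $ i $ i + b * (1 - b) * \<alpha> * P $ c $ i + (1 - b)\<^sup>2 / 4"
        unfolding L_def row_op_congruence_entry ic \<tau>i using \<alpha>sq
        by (simp add: b_def[symmetric] power2_eq_square field_simps) algebra
      have "b * b * (4 * (P $ i $ i - \<alpha> * P $ c $ i) + 1) = 1" using bq by (simp add: q_def)
      then show ?thesis unfolding 1 2 by (simp add: power2_eq_square field_simps)
    qed
    ultimately show "\<exists>L. norm (L - mat 1) \<le> N * norm (X - P) \<and> L ** P ** transpose L \<in> ?\<Omega>"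
      using symE[OF Y] by (intro exI[of _ L]) (auto simp: d_def psd_mats_def)
  qed (use H in \<open>simp add: N_def\<close>)
qed auto

lemma norm_mat_1_pos: "norm (mat 1 :: real^'n^'n) > 0"
proof -
  have "(mat 1 :: real^'n^'n) $ undefined $ undefined = 1" by (simp add: mat_def)
  then have "(mat 1 :: real^'n^'n) \<noteq> 0" by (metis zero_index zero_neq_one)
  then show ?thesis by simp
qed

lemma scaleR_congruence:
  "(s *\<^sub>R L) ** P ** transpose (s *\<^sub>R L) = (s * s) *\<^sub>R (L ** P ** transpose (L :: real^'n^'n))"
  by (simp add: transpose_scalar matrix_scalar_ac scalar_matrix_assoc[symmetric])

text \<open>After the repair within the cone \<open>K\<close>, a scaling by a factor close to \<open>1\<close> restores the value of \<open>C \<bullet> X\<close>.\<close>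

lemma congruence_repairable_slice:
  fixes K :: "(real^'n^'n) set"
  assumes cone: "\<And>X a. X \<in> K \<Longrightarrow> 0 \<le> a \<Longrightarrow> a *\<^sub>R X \<in> K" and b: "b \<noteq> 0"
    and rep: "congruence_repairable K Xb"
  shows "congruence_repairable {X \<in> K. C \<bullet> X = b} Xb"
proof -
  obtain c \<kappa> where c: "c > 0" and \<kappa>: "\<kappa> \<ge> 0"
    and L: "\<And>X P. X \<in> K \<Longrightarrow> P \<in> psd_mats \<Longrightarrow> norm (X - Xb) \<le> c \<Longrightarrow> norm (X - P) \<le> c \<Longrightarrow>
      \<exists>L. norm (L - mat 1) \<le> \<kappa> * norm (X - P) \<and> L ** P ** transpose L \<in> K"
    using rep unfolding congruence_repairable_def by meson
  define B where "B = norm Xb + 2 * c"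
  define M where "M = norm (mat 1 :: real^'n^'n) + \<kappa> * c"
  define G where "G = (M + 1) * B * \<kappa>"
  define H where "H = norm C * (G + 1) / \<bar>b\<bar>"
  have nn: "M \<ge> 0" "G \<ge> 0" "H \<ge> 0" using c \<kappa> by (simp_all add: M_def G_def B_def H_def)
  \<comment> \<open>\<open>H d\<close> will bound the relative error in \<open>C \<bullet> X\<close>; it must stay below \<open>1 / 2\<close>.\<close>
  define c' where "c' = min c (1 / (2 * (H + 1)))"
  have c': "c' > 0" "c' \<le> c" "H * c' \<le> 1 / 2"
  proof -
    show "c' > 0" "c' \<le> c" using c nn by (auto simp: c'_def)
    have "H * c' \<le> H * (1 / (2 * (H + 1)))" using nn by (intro mult_left_mono) (auto simp: c'_def)
    also have "\<dots> \<le> 1 / 2" using nn by (simp add: field_simps)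
    finally show "H * c' \<le> 1 / 2" .
  qed
  show ?thesis
    unfolding congruence_repairable_def
  proof (rule exI[of _ c'], intro conjI c', rule exI[of _ "H * M + \<kappa>"], intro conjI ballI impI)
    show "0 \<le> H * M + \<kappa>" using nn \<kappa> by simp
    fix X P assume X: "X \<in> {X \<in> K. C \<bullet> X = b}" and P: "P \<in> psd_mats"
      and Xn: "norm (X - Xb) \<le> c'" and XPn: "norm (X - P) \<le> c'"
    define d where "d = norm (X - P)"
    have d: "d \<ge> 0" "d \<le> c" "d \<le> c'" using XPn c' by (auto simp: d_def)
    obtain L where L: "norm (L - mat 1) \<le> \<kappa> * d" "L ** P ** transpose L \<in> K"
      using L[of X P] X P Xn XPn c' unfolding d_def by force
    let ?Q = "L ** P ** transpose L"
    have "norm P \<le> B"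
      using norm_triangle_ineq3[of X Xb] norm_triangle_ineq3[of X P] XPn Xn c' by (simp add: B_def)
    note bd = norm_congruence_diff_le[OF L(1) \<kappa> d(1,2) this]
    have QX: "norm (?Q - X) \<le> (G + 1) * d"
      using bd(2) norm_triangle_ineq[of "?Q - P" "P - X"]
      by (simp add: G_def M_def d_def norm_minus_commute algebra_simps)
    define x where "x = C \<bullet> ?Q / b"
    have "x - 1 = C \<bullet> (?Q - X) / b" using X b by (simp add: x_def inner_diff_right diff_divide_distrib)
    then have "\<bar>x - 1\<bar> = \<bar>C \<bullet> (?Q - X)\<bar> / \<bar>b\<bar>" by (simp add: abs_divide)
    also have "\<dots> \<le> norm C * ((G + 1) * d) / \<bar>b\<bar>"
      using Cauchy_Schwarz_ineq2[of C "?Q - X"] mult_left_mono[OF QX norm_ge_zero[of C]]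
      by (intro divide_right_mono) auto
    also have "\<dots> = H * d" by (simp add: H_def)
    finally have x1: "\<bar>x - 1\<bar> \<le> H * d" .
    have Hd: "H * d \<le> 1 / 2" using mult_left_mono[OF d(3) nn(3)] c'(3) by linarith
    define s where "s = 1 / sqrt x"
    have s1: "\<bar>s - 1\<bar> \<le> H * d" unfolding s_def using inverse_sqrt_near_1[of x] x1 Hd by linarith
    have x: "x > 0" using x1 Hd by linarith
    have ss: "s * s = 1 / x" using x by (simp add: s_def)
    have "norm (s *\<^sub>R L - mat 1) \<le> (H * M + \<kappa>) * d"
    proof -
      have "s *\<^sub>R L - mat 1 = (s - 1) *\<^sub>R L + (L - mat 1)" by (simp add: algebra_simps)
      then have "norm (s *\<^sub>R L - mat 1) \<le> \<bar>s - 1\<bar> * norm L + norm (L - mat 1)"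
        by (metis norm_scaleR norm_triangle_ineq)
      also have "\<dots> \<le> (H * d) * M + \<kappa> * d"
        using s1 bd(1) L(1) nn d by (intro add_mono mult_mono) (auto simp: M_def)
      finally show ?thesis by (simp add: algebra_simps)
    qed
    moreover have "(s *\<^sub>R L) ** P ** transpose (s *\<^sub>R L) = (1 / x) *\<^sub>R ?Q"
      by (simp only: scaleR_congruence ss)
    moreover have "(1 / x) *\<^sub>R ?Q \<in> K" using cone[OF L(2)] x by simp
    moreover have "C \<bullet> ((1 / x) *\<^sub>R ?Q) = b"
    proof -
      have "C \<bullet> ?Q = b * x" using b by (simp add: x_def)
      then show ?thesis using x by simp
    qed
    ultimately show "\<exists>L. norm (L - mat 1) \<le> (H * M + \<kappa>) * norm (X - P) \<and>
        L ** P ** transpose L \<in> {X \<in> K. C \<bullet> X = b}"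
      by (intro exI[of _ "s *\<^sub>R L"]) (simp add: d_def)
  qed
qed

lemma psd_mats_scaleR: "X \<in> psd_mats \<Longrightarrow> 0 \<le> a \<Longrightarrow> a *\<^sub>R X \<in> (psd_mats :: (real^'n^'n) set)"
  using truncatable_cone_psd_mats unfolding truncatable_cone_def by blast

lemma congruence_repairable_psd: "congruence_repairable psd_mats (Xb :: real^'n^'n)"
  unfolding congruence_repairable_def
  by (rule exI[of _ 1], intro conjI zero_less_one, rule exI[of _ 0]) (auto intro!: exI[of _ "mat 1"])

lemma all_calm_psd_slice:
  fixes C :: "real^'n^'n"
  assumes "b \<noteq> 0"
  shows "all_calm {X \<in> psd_mats. C \<bullet> X = b}"
proof (rule all_calm_if_congruence_repairable)
  show "congruence_repairable {X \<in> psd_mats. C \<bullet> X = b} Xb" for Xb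
    by (rule congruence_repairable_slice[OF psd_mats_scaleR assms congruence_repairable_psd])
qed auto

lemma trace_pos_if_psd:
  fixes X :: "real^'n^'n"
  assumes X: "X \<in> psd_mats" "X \<noteq> 0"
  shows "mat 1 \<bullet> X > 0"
proof -
  have tr: "mat 1 \<bullet> X = (\<Sum>i\<in>UNIV. X $ i $ i)"
    by (simp add: inner_vec_def mat_def if_distrib[of "\<lambda>x. x * _"] cong: if_cong)
  have sym: "X $ i $ j = X $ j $ i" for i j
  proof -
    have "transpose X $ i $ j = X $ i $ j" using X by (simp add: psd_mats_def sym_mats_def)
    then show ?thesis by (simp add: transpose_def)
  qed
  have q: "0 \<le> v \<bullet> (X *v v)" for v using X by (simp add: psd_mats_def)
  have ax: "axis i 1 \<bullet> (X *v axis j 1) = X $ i $ j" for i j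
    by (simp add: matrix_vector_mult_basis inner_axis' column_def)
  have dg: "0 \<le> X $ i $ i" for i using q[of "axis i 1"] ax by simp
  have "mat 1 \<bullet> X \<noteq> 0"
  proof
    assume "mat 1 \<bullet> X = 0"
    then have z: "X $ i $ i = 0" for i using dg unfolding tr by (simp add: sum_nonneg_eq_0_iff)
    have "X $ i $ j = 0" for i j
    proof -
      have "0 \<le> 2 * s * X $ i $ j" for s
        using q[of "axis i 1 + s *\<^sub>R axis j 1"]
        by (simp add: matrix_vector_right_distrib matrix_vector_mult_scaleR inner_add_left inner_add_right ax z sym[of j i])
      from this[of 1] this[of "-1"] show ?thesis by simp
    qed
    then show False using X(2) by (simp add: vec_eq_iff)
  qed
  moreover have "mat 1 \<bullet> X \<ge> 0" unfolding tr using dg by (intro sum_nonneg) auto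
  ultimately show ?thesis by simp
qed

text \<open>At \<open>t = \<plusminus>\<bar>a\<bar> / p0\<close> the linear term has modulus at least \<open>2 \<bar>a\<bar>\<close> and the quadratic one at most \<open>\<bar>a\<bar>\<close>, so the
intermediate value theorem applies.\<close>

lemma small_root_of_quadratic:
  fixes a p q :: real
  assumes p0: "0 < p0" "p0 \<le> p" and q: "\<bar>q\<bar> \<le> Q" and small: "\<bar>a\<bar> * Q \<le> p0\<^sup>2"
  obtains t where "\<bar>t\<bar> \<le> \<bar>a\<bar> / p0" "a + 2 * t * p + t\<^sup>2 * q = 0"
proof -
  define h where "h = (\<lambda>t. a + 2 * t * p + t\<^sup>2 * q)"
  define T where "T = \<bar>a\<bar> / p0"
  have T0: "T \<ge> 0" using p0 by (simp add: T_def)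
  have Tp: "\<bar>a\<bar> \<le> T * p" using mult_left_mono[OF p0(2) T0] p0(1) by (simp add: T_def)
  have "\<bar>T\<^sup>2 * q\<bar> \<le> T\<^sup>2 * Q" unfolding abs_mult using q by (simp add: mult_left_mono)
  also have "\<dots> = \<bar>a\<bar> * (\<bar>a\<bar> * Q) / p0\<^sup>2" by (simp add: T_def power2_eq_square)
  also have "\<dots> \<le> \<bar>a\<bar> * p0\<^sup>2 / p0\<^sup>2" using small by (intro divide_right_mono mult_left_mono) auto
  also have "\<dots> = \<bar>a\<bar>" using p0 by simp
  finally have Tq: "\<bar>T\<^sup>2 * q\<bar> \<le> \<bar>a\<bar>" .
  have "h (-T) \<le> 0" "0 \<le> h T" using Tp Tq by (auto simp: h_def)
  moreover have "continuous_on {-T..T} h" unfolding h_def by (intro continuous_intros)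
  ultimately obtain t where "-T \<le> t" "t \<le> T" "h t = 0"
    using IVT'[of h "-T" 0 T] T0 by auto
  then show thesis using that[of t] by (auto simp: h_def T_def abs_le_iff)
qed

text \<open>With \<open>M\<close> the inverse of \<open>A\<close> and \<open>L = mat 1 + t *\<^sub>R M\<close>, the residual \<open>A \<bullet> (L P L\<^sup>T)\<close> is quadratic in \<open>t\<close>, and its
linear coefficient is twice the trace of \<open>P\<close>, which stays away from zero near \<open>Xb \<noteq> 0\<close>. Hence it has
a root \<open>t\<close> of the order of \<open>A \<bullet> P\<close>.\<close>

lemma congruence_repairable_hyperplane:
  fixes A Xb :: "real^'n^'n"
  assumes A: "A \<in> sym_mats" "invertible A" and Xb: "Xb \<in> psd_mats" "Xb \<noteq> 0"
  shows "congruence_repairable {X \<in> psd_mats. A \<bullet> X = 0} Xb"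
proof -
  obtain M where M: "A ** M = mat 1" "M ** A = mat 1" using A(2) unfolding invertible_def by blast
  have tA: "transpose A = A" using A by (simp add: sym_mats_def)
  have MA: "transpose M ** A = mat 1"
    by (metis M(1) tA matrix_transpose_mul transpose_mat)
  define m where "m = norm (mat 1 :: real^'n^'n)"
  have m: "m > 0" unfolding m_def by (rule norm_mat_1_pos)
  define p0 where "p0 = (mat 1 \<bullet> Xb) / 2"
  have p0: "p0 > 0" using trace_pos_if_psd[OF Xb] by (simp add: p0_def)
  define Q where "Q = norm A * (norm M * (norm Xb + 2) * norm M)"
  \<comment> \<open>The second entry keeps the trace of \<open>P\<close> above \<open>p0\<close>, the third makes the quadratic equation solvable.\<close>
  define c where "c = min 1 (min (p0 / (2 * m)) (p0\<^sup>2 / ((norm A + 1) * (Q + 1))))"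
  have Q: "Q \<ge> 0" by (simp add: Q_def)
  have c: "c > 0" "c \<le> 1" "2 * m * c \<le> p0" "norm A * c * Q \<le> p0\<^sup>2"
  proof -
    show "c \<le> 1" by (simp add: c_def)
    have A1: "norm A + 1 > 0" using norm_ge_zero[of A] by linarith
    show c0: "c > 0" using p0 m Q A1 by (simp add: c_def)
    have "2 * m * c \<le> 2 * m * (p0 / (2 * m))" using m by (intro mult_left_mono) (auto simp: c_def)
    then show "2 * m * c \<le> p0" using m by simp
    have "norm A * c * Q \<le> (norm A + 1) * c * (Q + 1)" using c0 Q by (intro mult_mono) auto
    also have "\<dots> = ((norm A + 1) * (Q + 1)) * c" by simp
    also have "\<dots> \<le> ((norm A + 1) * (Q + 1)) * (p0\<^sup>2 / ((norm A + 1) * (Q + 1)))"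
      using A1 Q by (intro mult_left_mono) (auto simp: c_def)
    also have "\<dots> = p0\<^sup>2" using A1 Q by simp
    finally show "norm A * c * Q \<le> p0\<^sup>2" .
  qed
  show ?thesis
    unfolding congruence_repairable_def
  proof (rule exI[of _ c], intro conjI c, rule exI[of _ "norm A * norm M / p0"], intro conjI ballI impI)
    show "0 \<le> norm A * norm M / p0" using p0 by simp
    fix X P assume X: "X \<in> {X \<in> psd_mats. A \<bullet> X = 0}" and P: "P \<in> psd_mats"
      and Xn: "norm (X - Xb) \<le> c" and XPn: "norm (X - P) \<le> c"
    define d where "d = norm (X - P)"
    define a where "a = A \<bullet> P"
    define p where "p = mat 1 \<bullet> P"
    define q where "q = A \<bullet> (M ** P ** transpose M)"
    have "a = A \<bullet> (P - X)" using X by (simp add: a_def inner_diff_right)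
    then have a: "\<bar>a\<bar> \<le> norm A * d"
      using Cauchy_Schwarz_ineq2[of A "P - X"] by (simp add: d_def norm_minus_commute)
    have PXb: "norm (P - Xb) \<le> 2 * c"
      using norm_triangle_ineq[of "P - X" "X - Xb"] Xn XPn by (simp add: norm_minus_commute)
    have "\<bar>mat 1 \<bullet> (P - Xb)\<bar> \<le> m * (2 * c)"
      using Cauchy_Schwarz_ineq2[of "mat 1" "P - Xb"] mult_left_mono[OF PXb, of m] m
      unfolding m_def by linarith
    then have p: "p0 \<le> p" using c(3) by (simp add: p_def p0_def inner_diff_right)
    have nP: "norm P \<le> norm Xb + 2" using norm_triangle_ineq3[of P Xb] PXb c(2) by linarith
    have q: "\<bar>q\<bar> \<le> Q"
    proof -
      have "norm (M ** P) \<le> norm M * (norm Xb + 2)"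
        using nP by (intro order_trans[OF norm_matrix_matrix_mult_le[of M P]] mult_left_mono) auto
      then have "norm (M ** P ** transpose M) \<le> norm M * (norm Xb + 2) * norm M"
        by (intro order_trans[OF norm_matrix_matrix_mult_le[of "M ** P" "transpose M"]] mult_mono) auto
      then show ?thesis unfolding q_def Q_def
        by (intro order_trans[OF Cauchy_Schwarz_ineq2] mult_left_mono) auto
    qed
    have "\<bar>a\<bar> * Q \<le> norm A * c * Q"
      using a XPn Q mult_left_mono[OF XPn norm_ge_zero[of A]] by (intro mult_right_mono) (auto simp: d_def)
    then have small: "\<bar>a\<bar> * Q \<le> p0\<^sup>2" using c(4) by linarith
    obtain t where t: "\<bar>t\<bar> \<le> \<bar>a\<bar> / p0" "a + 2 * t * p + t\<^sup>2 * q = 0"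
      using small_root_of_quadratic[OF p0 p q small] by blast
    define L where "L = mat 1 + t *\<^sub>R M"
    have "norm (L - mat 1) = \<bar>t\<bar> * norm M" by (simp add: L_def)
    also have "\<dots> \<le> (norm A * d / p0) * norm M"
      using t(1) divide_right_mono[OF a, of p0] p0 by (intro mult_right_mono) auto
    finally have L1: "norm (L - mat 1) \<le> norm A * norm M / p0 * d" by (simp add: mult.commute mult.left_commute)
    have tL: "transpose L = mat 1 + t *\<^sub>R transpose M"
      by (simp add: L_def transpose_def vec_eq_iff mat_def)
    have "L ** P = P + t *\<^sub>R (M ** P)"
      unfolding L_def matrix_add_rdistrib by (simp add: scalar_matrix_assoc)
    moreover have "\<And>Y. Y ** transpose L = Y + t *\<^sub>R (Y ** transpose M)" for Y :: "real^'n^'n"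
      unfolding tL matrix_add_ldistrib by (simp add: matrix_scalar_ac scalar_matrix_assoc)
    ultimately have "L ** P ** transpose L = P + t *\<^sub>R (M ** P) + t *\<^sub>R ((P + t *\<^sub>R (M ** P)) ** transpose M)"
      by simp
    also have "(P + t *\<^sub>R (M ** P)) ** transpose M = P ** transpose M + t *\<^sub>R (M ** P ** transpose M)"
      unfolding matrix_add_rdistrib by (simp add: scalar_matrix_assoc)
    finally have "A \<bullet> (L ** P ** transpose L) = a + t * (A \<bullet> (M ** P)) + t * (A \<bullet> (P ** transpose M)) + t\<^sup>2 * q"
      by (simp add: inner_add_right a_def q_def power2_eq_square distrib_left)
    also have "A \<bullet> (M ** P) = p" unfolding inner_matrix_mult_left[of A M] MA p_def ..
    also have "A \<bullet> (P ** transpose M) = p" unfolding inner_matrix_mult_right[of A P] transpose_transpose M(1) p_def ..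
    finally have "A \<bullet> (L ** P ** transpose L) = 0" using t(2) by (simp add: algebra_simps)
    then show "\<exists>L. norm (L - mat 1) \<le> norm A * norm M / p0 * norm (X - P) \<and>
        L ** P ** transpose L \<in> {X \<in> psd_mats. A \<bullet> X = 0}"
      using L1 psd_mats_congruence[OF P] unfolding d_def by blast
  qed
qed

text \<open>Given the second equation, the first one is equivalent to the homogeneous equation for \<open>B - (b1 / b2) *\<^sub>R C\<close>, which
defines a cone.\<close>

lemma all_calm_psd_two_slices:
  fixes B C :: "real^'n^'n"
  assumes B: "B \<in> sym_mats" and C: "C \<in> sym_mats" and b2: "b2 \<noteq> 0"
    and inv: "invertible (B - (b1 / b2) *\<^sub>R C)"
  shows "all_calm {X \<in> psd_mats. B \<bullet> X = b1 \<and> C \<bullet> X = b2}"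
proof -
  let ?A = "B - (b1 / b2) *\<^sub>R C"
  have A: "?A \<in> sym_mats"
    using B C subspace_sym_mats by (intro subspace_diff subspace_scale) auto
  have eq: "{X \<in> psd_mats. B \<bullet> X = b1 \<and> C \<bullet> X = b2} = {X \<in> {X \<in> psd_mats. ?A \<bullet> X = 0}. C \<bullet> X = b2}"
    using b2 by (auto simp: inner_diff_left)
  show ?thesis
    unfolding eq
  proof (rule all_calm_if_congruence_repairable)
    fix Xb assume Xb: "Xb \<in> {X \<in> {X \<in> psd_mats. ?A \<bullet> X = 0}. C \<bullet> X = b2}"
    then have "Xb \<noteq> 0" using b2 by auto
    then show "congruence_repairable {X \<in> {X \<in> psd_mats. ?A \<bullet> X = 0}. C \<bullet> X = b2} Xb"
      using Xb congruence_repairable_hyperplane[OF A inv, of Xb]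
      by (intro congruence_repairable_slice[OF _ b2]) (auto simp: psd_mats_scaleR)
  qed auto
qed

lemma matrix_eq_on_orthonormal:
  fixes A B :: "real^'n^'n" and u :: "'n \<Rightarrow> real^'n"
  assumes u: "orthonormal u" and eq: "\<And>i. A *v u i = B *v u i"
  shows "A = B"
  unfolding matrix_eq
proof
  fix x
  have "M *v x = (\<Sum>i\<in>UNIV. (u i \<bullet> x) *\<^sub>R (M *v u i))" for M :: "real^'n^'n"
  proof -
    have "M *v x = M *v (\<Sum>i\<in>UNIV. (u i \<bullet> x) *\<^sub>R u i)" by (simp add: orthonormal_expansion[OF u])
    also have "\<dots> = (\<Sum>i\<in>UNIV. M *v ((u i \<bullet> x) *\<^sub>R u i))"
      by (rule linear_sum[OF matrix_vector_mul_linear])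
    finally show ?thesis by (simp add: matrix_vector_mult_scaleR)
  qed
  then show "A *v x = B *v x" using eq by simp
qed

text \<open>The inverse square root of \<open>G\<close>, formed in an eigenbasis of \<open>G\<close>.\<close>

lemma inverse_sqrt_matrix_near_identity:
  fixes G :: "real^'n^'n"
  assumes G: "transpose G = G" and near: "norm (G - mat 1) \<le> 1 / 2"
  obtains R where "R ** G ** transpose R = mat 1" "norm (R - mat 1) \<le> real CARD('n) * norm (G - mat 1)"
proof -
  obtain u :: "'n \<Rightarrow> real^'n" and \<mu> where u: "orthonormal u" "\<And>i. G *v u i = \<mu> i *\<^sub>R u i"
    using spectral_theorem[OF G] by metis
  have uu: "u i \<bullet> u j = (if i = j then 1 else 0)" for i j using u(1) by (simp add: orthonormal_def)
  have nu: "norm (u i) = 1" for i using uu[of i i] by (simp add: norm_eq_1)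
  have \<mu>1: "\<bar>\<mu> i - 1\<bar> \<le> norm (G - mat 1)" for i
  proof -
    have "u i \<bullet> ((G - mat 1) *v u i) = \<mu> i - 1"
      by (simp add: matrix_vector_mult_diff_rdistrib u(2) inner_diff_right uu)
    moreover have "\<bar>u i \<bullet> ((G - mat 1) *v u i)\<bar> \<le> norm (G - mat 1)"
      using Cauchy_Schwarz_ineq2[of "u i" "(G - mat 1) *v u i"]
        norm_matrix_vector_mult_le[of "G - mat 1" "u i"] by (simp add: nu)
    ultimately show ?thesis by simp
  qed
  define \<gamma> where "\<gamma> i = 1 / sqrt (\<mu> i)" for i
  have \<gamma>1: "\<bar>\<gamma> i - 1\<bar> \<le> norm (G - mat 1)" for i
    unfolding \<gamma>_def using inverse_sqrt_near_1[of "\<mu> i"] \<mu>1[of i] near by linarith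
  have \<gamma>\<mu>: "\<gamma> i * (\<gamma> i * \<mu> i) = 1" for i
  proof -
    have "\<mu> i > 0" using \<mu>1[of i] near by linarith
    then show ?thesis by (simp add: \<gamma>_def)
  qed
  have S: "(\<Sum>k\<in>UNIV. outer (u k) (s k *\<^sub>R u k)) *v u i = s i *\<^sub>R u i" for s i
    by (simp add: sum_outer_mult_vec uu if_distrib[of "\<lambda>x. _ * x"] if_distrib[of "\<lambda>x. x *\<^sub>R _"] cong: if_cong)
  define R where "R = (\<Sum>k\<in>UNIV. outer (u k) (\<gamma> k *\<^sub>R u k))"
  have tR: "transpose R = R" unfolding R_def using sym_mats_sum_outer[of u \<gamma> UNIV] by (simp add: sym_mats_def)
  have Ru: "R *v u i = \<gamma> i *\<^sub>R u i" for i unfolding R_def by (rule S)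
  show thesis
  proof (rule that)
    show "R ** G ** transpose R = mat 1"
    proof (rule matrix_eq_on_orthonormal[OF u(1)])
      fix i
      have "(R ** G ** transpose R) *v u i = (\<gamma> i * (\<gamma> i * \<mu> i)) *\<^sub>R u i"
        by (simp add: tR matrix_vector_mul_assoc[symmetric] Ru u(2) matrix_vector_mult_scaleR mult.commute mult.left_commute)
      then show "(R ** G ** transpose R) *v u i = mat 1 *v u i" by (simp add: \<gamma>\<mu>)
    qed
    have "R - mat 1 = (\<Sum>k\<in>UNIV. outer (u k) ((\<gamma> k - 1) *\<^sub>R u k))"
    proof (rule matrix_eq_on_orthonormal[OF u(1)])
      fix i
      have "(\<Sum>k\<in>UNIV. outer (u k) ((\<gamma> k - 1) *\<^sub>R u k)) *v u i = (\<gamma> i - 1) *\<^sub>R u i" by (rule S)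
      then show "(R - mat 1) *v u i = (\<Sum>k\<in>UNIV. outer (u k) ((\<gamma> k - 1) *\<^sub>R u k)) *v u i"
        by (simp only: matrix_vector_mult_diff_rdistrib Ru scaleR_left_diff_distrib matrix_vector_mul_lid scaleR_one)
    qed
    also have "norm \<dots> \<le> (\<Sum>k\<in>UNIV. norm (outer (u k) ((\<gamma> k - 1) *\<^sub>R u k)))" by (rule norm_sum)
    also have "\<dots> \<le> (\<Sum>k\<in>(UNIV :: 'n set). norm (G - mat 1))"
      by (intro sum_mono) (simp add: norm_outer nu \<gamma>1)
    finally show "norm (R - mat 1) \<le> real CARD('n) * norm (G - mat 1)" by simp
  qed
qed

text \<open>The matrix of the traces of the blocks of \<open>X\<close>.\<close>

definition partial_trace :: "real^('k::finite \<times> 'p::finite)^('k \<times> 'p) \<Rightarrow> real^'k^'k" where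
  "partial_trace X = (\<chi> i j. \<Sum>a\<in>UNIV. X $ (i, a) $ (j, a))"

lemma mat_1_inner_block: "mat 1 \<bullet> block X i j = partial_trace X $ i $ j"
  by (simp add: partial_trace_def block_def inner_vec_def mat_def if_distrib[of "\<lambda>x. x * _"] cong: if_cong)

text \<open>The Kronecker product of \<open>R\<close> with the identity matrix: it combines whole blocks, and so acts on the partial trace
as \<open>R\<close> does.\<close>

definition kron_id :: "real^'k^'k \<Rightarrow> real^('k::finite \<times> 'p::finite)^('k \<times> 'p)" where
  "kron_id R = (\<chi> q q'. if snd q = snd q' then R $ fst q $ fst q' else 0)"

lemma kron_id_mult: "(kron_id R ** Y) $ (i, a) $ q = (\<Sum>k\<in>UNIV. R $ i $ k * Y $ (k, a) $ q)"
proof -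
  have "(kron_id R ** Y) $ (i, a) $ q = (\<Sum>(k, b)\<in>UNIV \<times> UNIV. (if a = b then R $ i $ k else 0) * Y $ (k, b) $ q)"
    unfolding matrix_matrix_mult_def kron_id_def UNIV_Times_UNIV
    by (auto simp: case_prod_unfold intro!: sum.cong)
  also have "\<dots> = (\<Sum>k\<in>UNIV. \<Sum>b\<in>UNIV. if b = a then R $ i $ k * Y $ (k, b) $ q else 0)"
    unfolding sum.cartesian_product[symmetric] by (intro sum.cong refl) auto
  finally show ?thesis by simp
qed

lemma mult_transpose_kron_id: "(Y ** transpose (kron_id R)) $ q $ (j, a) = (\<Sum>l\<in>UNIV. Y $ q $ (l, a) * R $ j $ l)"
proof -
  have "Y ** transpose (kron_id R) = transpose (kron_id R ** transpose Y)"
    by (simp add: matrix_transpose_mul)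
  then have "(Y ** transpose (kron_id R)) $ q $ (j, a) = (kron_id R ** transpose Y) $ (j, a) $ q"
    by (simp add: transpose_def)
  also have "\<dots> = (\<Sum>l\<in>UNIV. R $ j $ l * Y $ q $ (l, a))" unfolding kron_id_mult by (simp add: transpose_def)
  finally show ?thesis by (simp add: mult.commute)
qed

lemma partial_trace_congruence:
  "partial_trace (kron_id R ** X ** transpose (kron_id R)) = R ** partial_trace X ** transpose R"
proof -
  have "(\<Sum>a\<in>UNIV. \<Sum>l\<in>UNIV. (\<Sum>k\<in>UNIV. R $ i $ k * X $ (k, a) $ (l, a)) * R $ j $ l) =
     (\<Sum>l\<in>UNIV. (\<Sum>k\<in>UNIV. R $ i $ k * (\<Sum>a\<in>UNIV. X $ (k, a) $ (l, a))) * R $ j $ l)" for i j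
  proof -
    have "(\<Sum>a\<in>UNIV. \<Sum>l\<in>UNIV. (\<Sum>k\<in>UNIV. R $ i $ k * X $ (k, a) $ (l, a)) * R $ j $ l) =
      (\<Sum>l\<in>UNIV. (\<Sum>a\<in>UNIV. \<Sum>k\<in>UNIV. R $ i $ k * X $ (k, a) $ (l, a)) * R $ j $ l)"
      by (subst sum.swap) (simp add: sum_distrib_right)
    also have "\<dots> = (\<Sum>l\<in>UNIV. (\<Sum>k\<in>UNIV. \<Sum>a\<in>UNIV. R $ i $ k * X $ (k, a) $ (l, a)) * R $ j $ l)"
      by (intro sum.cong refl arg_cong[where f = "\<lambda>x. x * _"], subst sum.swap) simp
    finally show ?thesis by (simp add: sum_distrib_left)
  qed
  then show ?thesis
    unfolding partial_trace_def mult_transpose_kron_id kron_id_mult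
    by (simp add: matrix_matrix_mult_def transpose_def vec_eq_iff)
qed

text \<open>The constraints say that the partial trace is the identity. For a truncation it is a matrix \<open>G\<close> close to the identity,
and the congruence by the Kronecker product of the inverse square root of \<open>G\<close> with the identity
repairs it.\<close>

lemma all_calm_block_trace:
  "all_calm (psd_mats \<inter> {X \<in> sym_mats :: (real^('k::finite \<times> 'p::finite)^('k \<times> 'p)) set.
      (\<forall>i. mat 1 \<bullet> block X i i = 1) \<and> (\<forall>i j. i \<noteq> j \<longrightarrow> mat 1 \<bullet> block X i j = 0)})"
proof -
  have eq: "psd_mats \<inter> {X \<in> sym_mats :: (real^('k \<times> 'p)^('k \<times> 'p)) set.
      (\<forall>i. mat 1 \<bullet> block X i i = 1) \<and> (\<forall>i j. i \<noteq> j \<longrightarrow> mat 1 \<bullet> block X i j = 0)}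
     = {X \<in> psd_mats. partial_trace X = mat 1}" (is "_ = ?\<Omega>")
    unfolding mat_1_inner_block by (auto simp: psd_mats_def vec_eq_iff mat_def)
  have lin: "partial_trace (X - Y) = partial_trace X - partial_trace Y" for X Y :: "real^('k \<times> 'p)^('k \<times> 'p)"
    by (simp add: partial_trace_def vec_eq_iff sum_subtractf)
  define N where "N = real CARD('k) * real CARD('k) * real CARD('p)"
  have N: "N \<ge> 1" unfolding N_def by (intro mult_ge1_I) (simp_all add: Suc_leI)
  have bd: "norm (partial_trace X) \<le> N * norm X" for X :: "real^('k \<times> 'p)^('k \<times> 'p)"
  proof -
    have "\<bar>partial_trace X $ i $ j\<bar> \<le> real CARD('p) * norm X" for i j
    proof -
      have "\<bar>partial_trace X $ i $ j\<bar> \<le> (\<Sum>a\<in>UNIV. \<bar>X $ (i, a) $ (j, a)\<bar>)"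
        by (simp add: partial_trace_def)
      also have "\<dots> \<le> (\<Sum>a\<in>(UNIV :: 'p set). norm X)" by (intro sum_mono entry_le_norm)
      finally show ?thesis by simp
    qed
    then show ?thesis using norm_matrix_le_entries[of "partial_trace X"] by (simp add: N_def mult.assoc)
  qed
  define Q where "Q = real CARD('k \<times> 'p) * real CARD('k \<times> 'p) * (real CARD('k) * N)"
  show ?thesis
    unfolding eq
  proof (rule all_calm_if_congruence_repairable)
    fix Xb :: "real^('k \<times> 'p)^('k \<times> 'p)"
    show "congruence_repairable ?\<Omega> Xb"
      unfolding congruence_repairable_def
    proof (rule exI[of _ "1 / (2 * N)"], intro conjI, use N in simp, rule exI[of _ Q], intro conjI ballI impI)
      show "0 \<le> Q" using N by (simp add: Q_def)
      fix X P :: "real^('k \<times> 'p)^('k \<times> 'p)"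
      assume X: "X \<in> ?\<Omega>" and P: "P \<in> psd_mats" and XP: "norm (X - P) \<le> 1 / (2 * N)"
      define G where "G = partial_trace P"
      have "mat 1 - G = partial_trace (X - P)" using X by (simp add: lin G_def)
      then have G1: "norm (G - mat 1) \<le> N * norm (X - P)" using bd[of "X - P"] norm_minus_commute[of G "mat 1"] by simp
      have "N * norm (X - P) \<le> N * (1 / (2 * N))" using XP N by (intro mult_left_mono) auto
      then have near: "norm (G - mat 1) \<le> 1 / 2" using G1 N by simp
      have "transpose P = P" using P by (simp add: psd_mats_def sym_mats_def)
      then have "transpose P $ q $ q' = P $ q $ q'" for q q' by simp
      then have "P $ q $ q' = P $ q' $ q" for q q' by (simp add: transpose_def)
      then have "transpose G = G" by (simp add: G_def partial_trace_def transpose_def vec_eq_iff)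
      then obtain R where R: "R ** G ** transpose R = mat 1" "norm (R - mat 1) \<le> real CARD('k) * norm (G - mat 1)"
        using inverse_sqrt_matrix_near_identity near by blast
      define L where "L = (kron_id R :: real^('k \<times> 'p)^('k \<times> 'p))"
      have "\<bar>(L - mat 1) $ q $ q'\<bar> \<le> norm (R - mat 1)" for q q'
        using entry_le_norm[of "R - mat 1" "fst q" "fst q'"]
        by (auto simp: L_def kron_id_def mat_def prod_eq_iff)
      then have "norm (L - mat 1) \<le> real CARD('k \<times> 'p) * real CARD('k \<times> 'p) * norm (R - mat 1)"
        by (rule norm_matrix_le_entries)
      also have "norm (R - mat 1) \<le> real CARD('k) * (N * norm (X - P))"
        using R(2) mult_left_mono[OF G1, of "real CARD('k)"] by linarith
      finally have "norm (L - mat 1) \<le> Q * norm (X - P)" by (simp add: Q_def mult.assoc mult_left_mono)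
      moreover have "partial_trace (L ** P ** transpose L) = mat 1"
        unfolding L_def partial_trace_congruence using R(1) by (simp add: G_def)
      ultimately show "\<exists>L. norm (L - mat 1) \<le> Q * norm (X - P) \<and> L ** P ** transpose L \<in> ?\<Omega>"
        using psd_mats_congruence[OF P] by (intro exI[of _ L]) auto
    qed
  qed auto
qed

section \<open>Exactness of the penalty\<close>

text \<open>A point \<open>1 + \<delta>\<close> of the domain beyond \<open>1\<close> and convexity give \<open>\<phi> t \<ge> 1 - K (1 - t)\<close> on \<open>[0,1]\<close>. For
\<open>\<theta> = min 1 (s / K)\<close> one has \<open>s (1 - t) \<ge> \<theta> K (1 - t)\<close> and, as \<open>\<phi> \<ge> 0\<close>, also
\<open>\<phi> t \<ge> \<theta> \<phi> t \<ge> \<theta> (1 - K (1 - t))\<close>; adding these gives \<open>\<phi> t + s (1 - t) \<ge> \<theta>\<close>.\<close>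

lemma conjugate_bounds:
  assumes \<phi>: "\<phi> \<in> phi_class"
  obtains K h where "K \<ge> 1" "\<And>s. conjugate (psi_of \<phi>) s = ereal (h s)" "h 0 = 0"
    "\<And>s. s - 1 \<le> h s" "\<And>s. 0 \<le> s \<Longrightarrow> h s \<le> s - min 1 (s / K)"
proof -
  have ninf: "\<phi> t \<noteq> -\<infinity>" for t using \<phi> by (simp add: phi_class_def)
  have cvx: "convex {(t, a :: real). \<phi> t \<le> ereal a}" using \<phi> by (simp add: phi_class_def)
  have dom: "{0..1} \<subseteq> interior {t. \<phi> t < \<infinity>}" using \<phi> by (simp add: phi_class_def)
  have \<phi>1: "\<phi> 1 = 1" using \<phi> by (simp add: phi_class_def)
  obtain t0 where t0: "t0 \<in> {0..1}" "\<phi> t0 = 0" "\<And>t. t \<in> {0..1} \<Longrightarrow> \<not> \<phi> t < \<phi> t0"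
    using \<phi> unfolding phi_class_def is_arg_min_def by blast
  define p where "p t = real_of_ereal (\<phi> t)" for t
  have fin: "\<phi> t = ereal (p t)" if "\<phi> t < \<infinity>" for t
    using that ninf[of t] unfolding p_def by (cases "\<phi> t") auto
  have in01: "\<phi> t = ereal (p t)" if "t \<in> {0..1}" for t
    using dom that interior_subset by (intro fin) blast
  have p0: "0 \<le> p t" if "t \<in> {0..1}" for t
    using t0(2,3) in01 that by (metis ereal_less_eq(5) not_le)
  have p1: "p 1 = 1" by (simp add: p_def \<phi>1)
  have pt0: "p t0 = 0" by (simp add: p_def t0)
  have "1 \<in> interior {t. \<phi> t < \<infinity>}" using dom by auto
  then obtain e where e: "e > 0" "ball 1 e \<subseteq> {t. \<phi> t < \<infinity>}" unfolding mem_interior by blast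
  define \<delta> where "\<delta> = e / 2"
  have \<delta>: "\<delta> > 0" using e by (simp add: \<delta>_def)
  have "1 + \<delta> \<in> ball 1 e" using e by (simp add: \<delta>_def dist_real_def)
  then have f\<delta>: "\<phi> (1 + \<delta>) = ereal (p (1 + \<delta>))" using e fin by blast
  define a where "a = p (1 + \<delta>)"
  define K where "K = max 1 ((a - 1) / \<delta>)"
  have K: "K \<ge> 1" by (simp add: K_def)
  have low: "1 - K * (1 - t) \<le> p t" if t: "t \<in> {0..1}" for t
  proof -
    \<comment> \<open>The weight for which \<open>1\<close> is the convex combination \<open>l t + (1 - l) (1 + \<delta>)\<close>.\<close>
    define l where "l = \<delta> / (1 + \<delta> - t)"
    have pos: "1 + \<delta> - t > 0" using t \<delta> by simp
    have l: "0 < l" "l \<le> 1" using pos \<delta> t by (simp_all add: l_def)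
    have "(t, p t) \<in> {(t, a). \<phi> t \<le> ereal a}" "(1 + \<delta>, a) \<in> {(t, a). \<phi> t \<le> ereal a}"
      using in01[OF t] f\<delta> by (auto simp: a_def)
    from convexD[OF cvx this, of l "1 - l"] l
    have "\<phi> (l * t + (1 - l) * (1 + \<delta>)) \<le> ereal (l * p t + (1 - l) * a)" by simp
    also have "l * t + (1 - l) * (1 + \<delta>) = 1"
    proof -
      have "l * (1 + \<delta> - t) = \<delta>" using pos by (simp add: l_def)
      then show ?thesis by (simp add: algebra_simps)
    qed
    finally have "1 \<le> l * p t + (1 - l) * a" by (simp add: \<phi>1)
    then have "(1 + \<delta> - t) * 1 \<le> (1 + \<delta> - t) * (l * p t + (1 - l) * a)" using pos by (intro mult_left_mono) auto
    also have "\<dots> = ((1 + \<delta> - t) * l) * p t + ((1 + \<delta> - t) - (1 + \<delta> - t) * l) * a"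
      by (simp add: algebra_simps)
    also have "(1 + \<delta> - t) * l = \<delta>" using pos by (simp add: l_def)
    finally have "\<delta> \<le> \<delta> * p t + (1 - t) * (a - 1)" by (simp add: algebra_simps)
    then have "1 - (a - 1) / \<delta> * (1 - t) \<le> p t" using \<delta> by (simp add: field_simps)
    moreover have "(a - 1) / \<delta> * (1 - t) \<le> K * (1 - t)" using t by (intro mult_right_mono) (auto simp: K_def)
    ultimately show ?thesis by linarith
  qed
  have upper: "conjugate (psi_of \<phi>) s \<le> ereal B" if "\<And>t. t \<in> {0..1} \<Longrightarrow> s * t - p t \<le> B" for s B
    unfolding conjugate_def
  proof (rule SUP_least)
    fix t
    show "ereal (s * t) - psi_of \<phi> t \<le> ereal B"
      using that[of t] in01[of t] by (cases "t \<in> {0..1}") (auto simp: psi_of_def)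
  qed
  have lower: "ereal (s * t - p t) \<le> conjugate (psi_of \<phi>) s" if t: "t \<in> {0..1}" for s t
  proof -
    have "ereal (s * t) - psi_of \<phi> t \<le> conjugate (psi_of \<phi>) s"
      unfolding conjugate_def by (rule SUP_upper) simp
    then show ?thesis using t in01[OF t] by (simp add: psi_of_def)
  qed
  define h where "h s = real_of_ereal (conjugate (psi_of \<phi>) s)" for s
  have h: "conjugate (psi_of \<phi>) s = ereal (h s)" for s
  proof -
    have "s * t - p t \<le> \<bar>s\<bar>" if "t \<in> {0..1}" for t
    proof -
      have "s * t \<le> \<bar>s\<bar> * 1" using that by (intro order_trans[OF abs_ge_self[of "s * t"]]) (auto simp: abs_mult intro!: mult_left_le)
      then show ?thesis using p0[OF that] by simp
    qed
    then have "conjugate (psi_of \<phi>) s \<le> ereal \<bar>s\<bar>" by (rule upper)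
    moreover have "ereal (s * 1 - p 1) \<le> conjugate (psi_of \<phi>) s" by (rule lower) simp
    ultimately show ?thesis unfolding h_def by (cases "conjugate (psi_of \<phi>) s") auto
  qed
  show thesis
  proof (rule that[OF K h])
    have "h 0 \<le> 0" using upper[of 0 0] p0 by (simp add: h)
    moreover have "0 \<le> h 0" using lower[OF t0(1), of 0] pt0 by (simp add: h)
    ultimately show "h 0 = 0" by simp
    show "s - 1 \<le> h s" for s using lower[of 1 s] p1 by (simp add: h)
    show "h s \<le> s - min 1 (s / K)" if s: "0 \<le> s" for s
    proof -
      define \<theta> where "\<theta> = min 1 (s / K)"
      have \<theta>: "0 \<le> \<theta>" "\<theta> \<le> 1" "\<theta> * K \<le> s"
      proof -
        have "\<theta> * K \<le> s / K * K" using K by (intro mult_right_mono) (auto simp: \<theta>_def)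
        then show "\<theta> * K \<le> s" using K by simp
      qed (use s K in \<open>auto simp: \<theta>_def\<close>)
      have "s * t - p t \<le> s - \<theta>" if t: "t \<in> {0..1}" for t
      proof -
        have "\<theta> * (1 - K * (1 - t)) \<le> \<theta> * p t" using low[OF t] \<theta> by (intro mult_left_mono) auto
        moreover have "\<theta> * p t \<le> 1 * p t" using p0[OF t] \<theta> by (intro mult_right_mono) auto
        moreover have "\<theta> * K * (1 - t) \<le> s * (1 - t)" using \<theta>(3) t by (intro mult_right_mono) auto
        ultimately show ?thesis by (simp add: algebra_simps)
      qed
      then have "conjugate (psi_of \<phi>) s \<le> ereal (s - \<theta>)" by (rule upper)
      then show ?thesis by (simp add: h \<theta>_def)
    qed
  qed
qed

lemma solution_set_eq_if_dominated:
  assumes le: "\<And>X. X \<in> \<Omega> \<Longrightarrow> A X \<le> B X"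
    and dom: "\<And>X. X \<in> \<Omega> \<Longrightarrow> A X = B X \<or> (\<exists>Y\<in>\<Omega>. B Y < A X)"
  shows "solution_set \<Omega> A = solution_set \<Omega> B"
proof -
  have "(X \<in> \<Omega> \<and> (\<forall>Y\<in>\<Omega>. A X \<le> A Y)) \<longleftrightarrow> (X \<in> \<Omega> \<and> (\<forall>Y\<in>\<Omega>. B X \<le> B Y))" for X
    using le dom by (metis leD le_less_trans less_imp_le not_le order_trans order_refl)
  then show ?thesis
    unfolding solution_set_def is_arg_min_linorder by auto
qed

text \<open>Calmness at \<open>Xb\<close> gives the bound where the tail sum is small, and near \<open>Xb\<close> it is, as \<open>Xb\<close> has rank \<open>r\<close>. For \<open>r = 0\<close>,
which is not among the calmness hypotheses, \<open>Xb = 0\<close> and \<open>Y = Xb\<close> will do.\<close>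

lemma error_bound_if_all_calm:
  fixes \<Omega> :: "(real^'m^'n) set"
  assumes calm: "all_calm \<Omega>" and Xb: "Xb \<in> \<Omega>" and r: "r = rank Xb"
  obtains \<gamma> \<delta> where "\<gamma> \<ge> 0" "\<delta> > 0"
    "\<And>X. X \<in> \<Omega> \<Longrightarrow> norm (X - Xb) \<le> \<delta> \<Longrightarrow> \<exists>Y\<in>\<Omega>. rank Y \<le> r \<and> norm (X - Y) \<le> \<gamma> * tail_sum r X"
proof -
  have rn: "r \<le> CARD('n)" using r rank_bound[of Xb] by simp
  show thesis
  proof (cases "r = 0")
    case True
    then have z: "Xb = 0" using r by (simp add: rank_eq_0)
    show thesis
    proof (rule that[of 1 1])
      fix X assume "X \<in> \<Omega>"
      obtain P where "rank P \<le> r" "norm (X - P) \<le> tail_sum r X" using low_rank_approx[OF rn] by metis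
      then have "norm (X - Xb) \<le> 1 * tail_sum r X" using True z by (simp add: rank_eq_0)
      then show "\<exists>Y\<in>\<Omega>. rank Y \<le> r \<and> norm (X - Y) \<le> 1 * tail_sum r X" using Xb r by blast
    qed auto
  next
    case False
    have S: "X \<in> S_map \<Omega> r y \<longleftrightarrow> X \<in> \<Omega> \<and> tail_sum r X = y" for X y
      by (simp add: S_map_def tail_sum_def)
    have "Xb \<in> S_map \<Omega> r 0" unfolding S using Xb tail_sum_eq_0_iff[OF rn, of Xb] r by simp
    moreover have "r \<in> {1..CARD('n)}" using False rn by simp
    ultimately have "calm_at (S_map \<Omega> r) 0 Xb" using calm unfolding all_calm_def by blast
    then obtain g e d where g: "g \<ge> 0" "e > 0" "d > 0"
      and sub: "\<And>y. norm (y - 0) \<le> e \<Longrightarrow> S_map \<Omega> r y \<inter> cball Xb d \<subseteq>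
        {z + (g * norm (y - 0)) *\<^sub>R u |z u. z \<in> S_map \<Omega> r 0 \<and> u \<in> cball 0 1}"
      unfolding calm_at_def by blast
    define n where "n = real CARD('n)"
    have n: "n > 0" by (simp add: n_def)
    show thesis
    proof (rule that[of g "min d (e / n)"])
      fix X assume X: "X \<in> \<Omega>" and Xn: "norm (X - Xb) \<le> min d (e / n)"
      define y where "y = tail_sum r X"
      have y0: "y \<ge> 0" unfolding y_def by (rule tail_sum_nonneg[OF rn])
      have "y \<le> n * norm (X - Xb)" unfolding y_def n_def using r by (intro tail_sum_le_dist[OF rn]) auto
      also have "\<dots> \<le> n * (e / n)" using Xn n by (intro mult_left_mono) auto
      finally have "norm (y - 0) \<le> e" using y0 n by simp
      moreover have "X \<in> S_map \<Omega> r y \<inter> cball Xb d" using X Xn by (simp add: S y_def dist_norm norm_minus_commute)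
      ultimately obtain z u where zu: "X = z + (g * norm (y - 0)) *\<^sub>R u" "z \<in> S_map \<Omega> r 0" "u \<in> cball 0 1"
        using sub by blast
      have "norm (X - z) = g * y * norm u" using zu(1) g y0 by simp
      also have "\<dots> \<le> g * y * 1" using zu(3) g y0 by (intro mult_left_mono) auto
      finally have "norm (X - z) \<le> g * tail_sum r X" by (simp add: y_def)
      moreover have "rank z \<le> r" "z \<in> \<Omega>" using zu(2) tail_sum_eq_0_iff[OF rn, of z] by (auto simp: S)
      ultimately show "\<exists>Y\<in>\<Omega>. rank Y \<le> r \<and> norm (X - Y) \<le> g * tail_sum r X" by blast
    qed (use g n in auto)
  qed
qed

text \<open>Near \<open>Xb\<close> the distance to the matrices of rank at most \<open>r - 1\<close> stays positive; it is at most the tail sum after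
\<open>r - 1\<close>, hence at most \<open>n\<close> times the \<open>r\<close>-th singular value.\<close>

lemma leading_sing_vals_bounded_below:
  fixes Xb :: "real^'m^'n"
  assumes r: "r = rank Xb"
  obtains \<delta> s where "\<delta> > 0" "s > 0" "\<And>X. norm (X - Xb) \<le> \<delta> \<Longrightarrow> r \<le> rank X"
    "\<And>X k. norm (X - Xb) \<le> \<delta> \<Longrightarrow> k \<in> {1..r} \<Longrightarrow> s \<le> sing_val k X"
proof (cases "r = 0")
  case True
  then show thesis using that[of 1 1] by auto
next
  case False
  have rn: "r \<le> CARD('n)" using r rank_bound[of Xb] by simp
  then have rn1: "r - 1 \<le> CARD('n)" by simp
  have "open (- {X :: real^'m^'n. rank X \<le> r - 1})" by (rule open_Compl[OF closed_rank_le[OF rn1]])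
  moreover have "Xb \<in> - {X. rank X \<le> r - 1}" using r False by auto
  ultimately obtain e where e: "e > 0" "ball Xb e \<subseteq> - {X. rank X \<le> r - 1}" by (meson open_contains_ball)
  define n where "n = real CARD('n)"
  have n: "n > 0" by (simp add: n_def)
  show thesis
  proof (rule that[of "e / 2" "e / (2 * n)"])
    fix X assume X: "norm (X - Xb) \<le> e / 2"
    then have "X \<in> ball Xb e" using e by (simp add: dist_norm norm_minus_commute)
    then show "r \<le> rank X" using e by force
    fix k assume k: "k \<in> {1..r}"
    obtain P where P: "rank P \<le> r - 1" "norm (X - P) \<le> tail_sum (r - 1) X" using low_rank_approx[OF rn1] by metis
    have "P \<notin> ball Xb e" using P e by auto
    then have "e \<le> norm (P - Xb)" by (simp add: dist_norm norm_minus_commute)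
    also have "\<dots> \<le> norm (X - Xb) + norm (X - P)"
      using norm_triangle_ineq[of "P - X" "X - Xb"] by (simp add: norm_minus_commute)
    finally have "e / 2 \<le> tail_sum (r - 1) X" using X P(2) by linarith
    also have "\<dots> \<le> (\<Sum>j\<in>{r - 1<..CARD('n)}. sing_val k X)"
      unfolding tail_sum_eq[OF rn1] using k by (intro sum_mono sing_val_antimono) auto
    also have "\<dots> = real (CARD('n) - (r - 1)) * sing_val k X" by simp
    also have "\<dots> \<le> n * sing_val k X"
      unfolding n_def using k rn by (intro mult_right_mono sing_val_nonneg) auto
    finally show "e / (2 * n) \<le> sing_val k X" using n by (simp add: field_simps)
  qed (use e n in auto)
qed

lemma min_1_sum_le:
  fixes a :: "'i \<Rightarrow> real"
  assumes "finite I" "\<And>i. i \<in> I \<Longrightarrow> 0 \<le> a i"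
  shows "min 1 (\<Sum>i\<in>I. a i) \<le> (\<Sum>i\<in>I. min 1 (a i))"
  using assms
proof (induction I rule: finite_induct)
  case (insert i I)
  then have "min 1 (\<Sum>i\<in>I. a i) \<le> (\<Sum>i\<in>I. min 1 (a i))" "0 \<le> (\<Sum>i\<in>I. a i)" "0 \<le> a i"
    by (auto intro: sum_nonneg)
  moreover have "min 1 (x + y) \<le> min 1 x + min 1 y" if "0 \<le> x" "0 \<le> y" for x y :: real
    using that by (simp add: min_def)
  ultimately show ?case using insert.hyps by (simp add: order_trans[OF _ add_left_mono])
qed simp

text \<open>The term that the surrogate puts in place of the rank, for \<open>G s = s - \<psi>\<^sup>* s\<close>.\<close>

definition rank_penalty :: "(real \<Rightarrow> real) \<Rightarrow> real \<Rightarrow> real^'m^'n \<Rightarrow> real" where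
  "rank_penalty G \<rho> X = (\<Sum>k = 1..CARD('n). G (\<rho> * sing_val k X))"

lemma surrogate_objective_eq:
  fixes X :: "real^'m^'n"
  assumes h: "\<And>s. conjugate (psi_of \<phi>) s = ereal (h s)" and \<rho>: "\<rho> > 0" and fX: "f X = ereal x"
  shows "surrogate_objective f \<nu> \<phi> \<rho> X = ereal (x + \<nu> * rank_penalty (\<lambda>s. s - h s) \<rho> X)"
proof -
  have "(\<Sum>i = 1..CARD('n). conjugate (psi_of \<phi>) (\<rho> * sing_val i X)) =
      ereal (\<Sum>i = 1..CARD('n). h (\<rho> * sing_val i X))"
    by (simp add: h)
  moreover have "\<nu> * \<rho> * (nuclear_norm X - inverse \<rho> * (\<Sum>i = 1..CARD('n). h (\<rho> * sing_val i X)))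
      = \<nu> * rank_penalty (\<lambda>s. s - h s) \<rho> X"
    unfolding rank_penalty_def sum_subtractf sum_distrib_left[symmetric] nuclear_norm_def[symmetric]
    using \<rho> by (simp add: algebra_simps)
  ultimately show ?thesis by (simp add: surrogate_objective_def fX)
qed

lemma rank_penalty_le_rank:
  fixes X :: "real^'m^'n"
  assumes "G 0 = 0" "\<And>s. G s \<le> 1" and \<rho>: "\<rho> > 0"
  shows "rank_penalty G \<rho> X \<le> real (rank X)"
proof -
  have "rank_penalty G \<rho> X \<le> (\<Sum>k = 1..CARD('n). if sing_val k X > 0 then 1 else 0)"
    unfolding rank_penalty_def
  proof (rule sum_mono)
    fix k assume "k \<in> {1..CARD('n)}"
    then show "G (\<rho> * sing_val k X) \<le> (if 0 < sing_val k X then 1 else 0)"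
      using sing_val_nonneg[of k X] assms by (cases "sing_val k X = 0") auto
  qed
  also have "\<dots> = real (rank X)" unfolding rank_eq_card_sing_val
    by (simp add: sum.If_cases Int_def)
  finally show ?thesis .
qed

text \<open>Let \<open>T\<close> be the tail sum of \<open>X\<close>. If \<open>T = 0\<close>, then \<open>X\<close> has rank exactly \<open>r\<close> and the penalty equals it. Otherwise the
error bound gives a feasible \<open>Y\<close> of rank at most \<open>r\<close> with \<open>F Y - F X \<le> L \<gamma> T\<close>, while the penalty of \<open>X\<close>
exceeds \<open>r\<close> by at least \<open>min 1 (\<rho> T / K)\<close>.\<close>

lemma local_exactness:
  fixes \<Omega> :: "(real^'m^'n) set" and F :: "real^'m^'n \<Rightarrow> real"
  assumes calm: "all_calm \<Omega>" and Xb: "Xb \<in> \<Omega>"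
    and lip: "open U" "Xb \<in> U" "L-lipschitz_on (U \<inter> \<Omega>) F"
    and \<nu>: "\<nu> > 0" and K: "K \<ge> 1"
    and G: "G 0 = 0" "\<And>s. G s \<le> 1" "\<And>s. 0 \<le> s \<Longrightarrow> min 1 (s / K) \<le> G s"
  shows "\<exists>\<epsilon>>0. \<exists>\<rho>1>0. \<forall>\<rho>\<ge>\<rho>1. \<forall>X\<in>\<Omega> \<inter> ball Xb \<epsilon>. rank_penalty G \<rho> X = real (rank X) \<or>
    (\<exists>Y\<in>\<Omega>. F Y + \<nu> * real (rank Y) < F X + \<nu> * rank_penalty G \<rho> X)"
proof -
  define r where "r = rank Xb"
  define n where "n = real CARD('n)"
  have n: "n > 0" by (simp add: n_def)
  have rn: "r \<le> CARD('n)" using rank_bound[of Xb] by (simp add: r_def)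
  obtain \<gamma> \<delta>1 where \<gamma>: "\<gamma> \<ge> 0" "\<delta>1 > 0" and eb: "\<And>X. X \<in> \<Omega> \<Longrightarrow> norm (X - Xb) \<le> \<delta>1 \<Longrightarrow>
      \<exists>Y\<in>\<Omega>. rank Y \<le> r \<and> norm (X - Y) \<le> \<gamma> * tail_sum r X"
    using error_bound_if_all_calm[OF calm Xb r_def] by metis
  obtain \<delta>2 s where s: "\<delta>2 > 0" "s > 0" and rk: "\<And>X. norm (X - Xb) \<le> \<delta>2 \<Longrightarrow> r \<le> rank X"
    and sv: "\<And>X k. norm (X - Xb) \<le> \<delta>2 \<Longrightarrow> k \<in> {1..r} \<Longrightarrow> s \<le> sing_val k X"
    using leading_sing_vals_bounded_below[OF r_def] by metis
  obtain \<eta> where \<eta>: "\<eta> > 0" "ball Xb \<eta> \<subseteq> U" using lip by (meson open_contains_ball)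
  have L: "L \<ge> 0" using lip(3) by (rule lipschitz_on_nonneg)
  \<comment> \<open>The third entry keeps \<open>Y\<close> inside \<open>U\<close>; the fourth makes the increase \<open>L \<gamma> T\<close> of \<open>F\<close> smaller than \<open>\<nu>\<close>.\<close>
  define \<epsilon> where "\<epsilon> = min (min \<delta>1 \<delta>2) (min (\<eta> / (1 + \<gamma> * n)) (\<nu> / (L * \<gamma> * n + 1)))"
  have g1: "1 + \<gamma> * n > 0" "L * \<gamma> * n + 1 > 0" using \<gamma> n L by (simp_all add: add_pos_nonneg add_nonneg_pos)
  have \<epsilon>: "\<epsilon> > 0" using \<gamma> s \<eta> \<nu> g1 by (simp add: \<epsilon>_def)
  \<comment> \<open>The first entry makes each of the first \<open>r\<close> terms of the penalty equal to \<open>1\<close>; the second makes its growth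
    rate \<open>\<nu> \<rho> / K\<close> in \<open>T\<close> exceed \<open>L \<gamma>\<close>.\<close>
  define \<rho>1 where "\<rho>1 = max (K / s) ((L * \<gamma> + 1) * K / \<nu>)"
  have \<rho>1: "\<rho>1 > 0" using K s by (simp add: \<rho>1_def less_max_iff_disj)
  show ?thesis
  proof (rule exI[of _ \<epsilon>], intro conjI \<epsilon>, rule exI[of _ \<rho>1], intro conjI \<rho>1 allI impI ballI)
    fix \<rho> X assume \<rho>: "\<rho>1 \<le> \<rho>" and X: "X \<in> \<Omega> \<inter> ball Xb \<epsilon>"
    define d where "d = norm (X - Xb)"
    have d: "0 \<le> d" "d < \<epsilon>" using X by (auto simp: d_def dist_norm norm_minus_commute)
    have d2: "norm (X - Xb) \<le> \<delta>1" "norm (X - Xb) \<le> \<delta>2" using d by (auto simp: \<epsilon>_def d_def)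
    have \<rho>0: "\<rho> > 0" using \<rho> \<rho>1 by linarith
    define T where "T = tail_sum r X"
    have T: "0 \<le> T" "T \<le> n * d" unfolding T_def n_def d_def
      using tail_sum_nonneg[OF rn, of X] tail_sum_le_dist[OF rn, of Xb X] r_def by simp_all
    have lead: "G (\<rho> * sing_val k X) = 1" if k: "k \<in> {1..r}" for k
    proof -
      have "K / s \<le> \<rho>" using \<rho> by (simp add: \<rho>1_def)
      then have "K \<le> \<rho> * s" using s by (simp add: field_simps)
      also have "\<dots> \<le> \<rho> * sing_val k X" using sv[OF d2(2) k] \<rho>0 by simp
      finally have "K \<le> \<rho> * sing_val k X" .
      then have "1 \<le> \<rho> * sing_val k X / K" "0 \<le> \<rho> * sing_val k X" using K by simp_all
      then show ?thesis using G(3)[of "\<rho> * sing_val k X"] G(2)[of "\<rho> * sing_val k X"] by simp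
    qed
    have "{1..CARD('n)} = {1..r} \<union> {r<..CARD('n)}" using rn by auto
    then have "rank_penalty G \<rho> X = (\<Sum>k\<in>{1..r}. G (\<rho> * sing_val k X)) + (\<Sum>k\<in>{r<..CARD('n)}. G (\<rho> * sing_val k X))"
      unfolding rank_penalty_def by (simp add: sum.union_disjoint disjoint_iff)
    moreover have "(\<Sum>k\<in>{1..r}. G (\<rho> * sing_val k X)) = r" using lead by simp
    ultimately have split: "rank_penalty G \<rho> X = real r + (\<Sum>k\<in>{r<..CARD('n)}. G (\<rho> * sing_val k X))" by simp
    have snn: "0 \<le> sing_val k X" if "k \<in> {r<..CARD('n)}" for k using that by (intro sing_val_nonneg) auto
    show "rank_penalty G \<rho> X = real (rank X) \<or> (\<exists>Y\<in>\<Omega>. F Y + \<nu> * real (rank Y) < F X + \<nu> * rank_penalty G \<rho> X)"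
    proof (cases "T = 0")
      case True
      then have "(\<Sum>k\<in>{r<..CARD('n)}. sing_val k X) = 0" using tail_sum_eq[OF rn, of X] by (simp add: T_def)
      then have "\<forall>k\<in>{r<..CARD('n)}. sing_val k X = 0" using snn by (subst (asm) sum_nonneg_eq_0_iff) auto
      then have "rank_penalty G \<rho> X = real r" unfolding split using G(1) by simp
      moreover have "rank X \<le> r" using True tail_sum_eq_0_iff[OF rn, of X] by (simp add: T_def)
      ultimately show ?thesis using rk[OF d2(2)] by simp
    next
      case False
      then have Tpos: "T > 0" using T by simp
      obtain Y where Y: "Y \<in> \<Omega>" "rank Y \<le> r" "norm (X - Y) \<le> \<gamma> * T"
        using eb[OF _ d2(1)] X unfolding T_def by blast
      have "norm (Y - Xb) \<le> norm (X - Y) + d"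
        using norm_triangle_ineq[of "Y - X" "X - Xb"] by (simp add: d_def norm_minus_commute)
      also have "\<dots> \<le> \<gamma> * (n * d) + d" using Y(3) mult_left_mono[OF T(2) \<gamma>(1)] by linarith
      also have "\<dots> = (1 + \<gamma> * n) * d" by (simp add: algebra_simps)
      also have "\<dots> < \<eta>"
      proof -
        have "d < \<eta> / (1 + \<gamma> * n)" using d by (simp add: \<epsilon>_def)
        then show ?thesis using g1(1) by (simp add: field_simps)
      qed
      finally have YU: "Y \<in> U \<inter> \<Omega>" using \<eta> Y(1) by (auto simp: dist_norm norm_minus_commute)
      have "d \<le> (1 + \<gamma> * n) * d" using d \<gamma> n by (simp add: algebra_simps)
      also have "\<dots> < \<eta>"
      proof -
        have "d < \<eta> / (1 + \<gamma> * n)" using d by (simp add: \<epsilon>_def)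
        then show ?thesis using g1(1) by (simp add: field_simps)
      qed
      finally have XU: "X \<in> U \<inter> \<Omega>" using \<eta> X by (auto simp: d_def dist_norm norm_minus_commute)
      have "dist (F X) (F Y) \<le> L * dist X Y" by (rule lipschitz_onD[OF lip(3) XU YU])
      also have "\<dots> \<le> L * (\<gamma> * T)" using Y(3) L by (intro mult_left_mono) (auto simp: dist_norm)
      finally have FXY: "F Y - L * (\<gamma> * T) \<le> F X" by (simp add: dist_real_def abs_le_iff)
      have "min 1 (\<rho> * T / K) = min 1 (\<Sum>k\<in>{r<..CARD('n)}. \<rho> * sing_val k X / K)"
        unfolding T_def tail_sum_eq[OF rn] by (simp add: sum_distrib_left sum_divide_distrib)
      also have "\<dots> \<le> (\<Sum>k\<in>{r<..CARD('n)}. min 1 (\<rho> * sing_val k X / K))"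
        using snn \<rho>0 K by (intro min_1_sum_le) auto
      also have "\<dots> \<le> (\<Sum>k\<in>{r<..CARD('n)}. G (\<rho> * sing_val k X))"
        using snn \<rho>0 by (intro sum_mono G(3)) auto
      finally have pen: "real r + min 1 (\<rho> * T / K) \<le> rank_penalty G \<rho> X" unfolding split by simp
      have "L * (\<gamma> * T) < \<nu> * min 1 (\<rho> * T / K)"
      proof -
        have "L * (\<gamma> * T) < \<nu>"
        proof -
          have "L * (\<gamma> * T) \<le> L * (\<gamma> * (n * d))" using T L \<gamma> by (intro mult_left_mono) auto
          also have "\<dots> \<le> (L * \<gamma> * n + 1) * d" using d by (simp add: algebra_simps)
          also have "\<dots> < \<nu>"
          proof -
            have "d < \<nu> / (L * \<gamma> * n + 1)" using d by (simp add: \<epsilon>_def)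
            then show ?thesis using g1(2) by (simp add: field_simps)
          qed
          finally show ?thesis .
        qed
        moreover have "L * (\<gamma> * T) < \<nu> * (\<rho> * T / K)"
        proof -
          have "(L * \<gamma> + 1) * K / \<nu> \<le> \<rho>" using \<rho> by (simp add: \<rho>1_def)
          then have "(L * \<gamma> + 1) \<le> \<nu> * \<rho> / K" using \<nu> K by (simp add: field_simps)
          then have "L * \<gamma> < \<nu> * \<rho> / K" by linarith
          from mult_strict_right_mono[OF this Tpos] show ?thesis by (simp add: mult.assoc mult.left_commute)
        qed
        ultimately show ?thesis by (simp add: min_def)
      qed
      moreover have "\<nu> * real (rank Y) \<le> \<nu> * real r" using Y(2) \<nu> by simp
      moreover have "\<nu> * (real r + min 1 (\<rho> * T / K)) \<le> \<nu> * rank_penalty G \<rho> X"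
        using pen \<nu> by (intro mult_left_mono) auto
      ultimately have "F Y + \<nu> * real (rank Y) < F X + \<nu> * rank_penalty G \<rho> X"
        using FXY by (simp add: distrib_left)
      then show ?thesis using Y(1) by blast
    qed
  qed
qed

text \<open>Outside a large ball \<open>f\<close> exceeds the rank objective at a fixed feasible point; inside, compactness reduces the choice
of the threshold to finitely many neighbourhoods of \<open>local_exactness\<close>.\<close>

lemma exact_penalty:
  fixes \<Omega> :: "(real^'m^'n) set"
  assumes ne: "\<Omega> \<noteq> {}" and cl: "closed \<Omega>" and co: "coercive_on \<Omega> f" and ll: "locally_lipschitz_on \<Omega> f"
    and \<nu>: "\<nu> > 0" and \<phi>: "\<phi> \<in> phi_class" and calm: "all_calm \<Omega>"
  shows "\<exists>\<rho>0>0. \<forall>\<rho>\<ge>\<rho>0.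
    solution_set \<Omega> (surrogate_objective f \<nu> \<phi> \<rho>) = solution_set \<Omega> (rank_objective f \<nu>)"
proof -
  obtain K h where K: "K \<ge> 1" and h: "\<And>s. conjugate (psi_of \<phi>) s = ereal (h s)" and h0: "h 0 = 0"
    and h1: "\<And>s. s - 1 \<le> h s" and h2: "\<And>s. 0 \<le> s \<Longrightarrow> h s \<le> s - min 1 (s / K)"
    using conjugate_bounds[OF \<phi>] by metis
  define G where "G = (\<lambda>s. s - h s)"
  have G: "G 0 = 0" "\<And>s. G s \<le> 1" "\<And>s. 0 \<le> s \<Longrightarrow> min 1 (s / K) \<le> G s"
    using h0 h1 h2 unfolding G_def by (auto simp: algebra_simps)
  define F where "F X = real_of_ereal (f X)" for X
  have fF: "f X = ereal (F X)" if "X \<in> \<Omega>" for X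
    using ll that unfolding locally_lipschitz_on_def F_def by (simp add: ereal_real)
  obtain X0 where X0: "X0 \<in> \<Omega>" using ne by blast
  define C where "C = F X0 + \<nu> * real CARD('n)"
  have "eventually (\<lambda>X. ereal C < f X) (inf at_infinity (principal \<Omega>))"
    using co unfolding coercive_on_def tendsto_PInfty by blast
  then obtain b where b: "\<And>X. b \<le> norm X \<Longrightarrow> X \<in> \<Omega> \<Longrightarrow> ereal C < f X"
    unfolding eventually_inf_principal eventually_at_infinity by blast
  let ?K = "\<Omega> \<inter> cball 0 b"
  have cK: "compact ?K" using cl by (intro closed_Int_compact) auto
  let ?P = "\<lambda>\<rho> X. rank_penalty G \<rho> X = real (rank X) \<or>
    (\<exists>Y\<in>\<Omega>. F Y + \<nu> * real (rank Y) < F X + \<nu> * rank_penalty G \<rho> X)"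
  have "\<exists>\<epsilon>>0. \<exists>\<rho>1>0. \<forall>\<rho>\<ge>\<rho>1. \<forall>X\<in>\<Omega> \<inter> ball Xb \<epsilon>. ?P \<rho> X" if Xb: "Xb \<in> \<Omega>" for Xb
  proof -
    obtain U L where "open U" "Xb \<in> U" "lipschitz_on L (U \<inter> \<Omega>) (\<lambda>Y. real_of_ereal (f Y))"
      using ll Xb unfolding locally_lipschitz_on_def by blast
    then have "L-lipschitz_on (U \<inter> \<Omega>) F" by (simp add: F_def[abs_def])
    then show ?thesis using local_exactness[OF calm Xb \<open>open U\<close> \<open>Xb \<in> U\<close> _ \<nu> K G] by blast
  qed
  then obtain \<epsilon> \<rho>1 where \<epsilon>: "\<And>Xb. Xb \<in> \<Omega> \<Longrightarrow> \<epsilon> Xb > 0"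
    and loc: "\<And>Xb \<rho> X. Xb \<in> \<Omega> \<Longrightarrow> \<rho>1 Xb \<le> \<rho> \<Longrightarrow> X \<in> \<Omega> \<inter> ball Xb (\<epsilon> Xb) \<Longrightarrow> ?P \<rho> X"
    by metis
  have "?K \<subseteq> (\<Union>Xb\<in>?K. ball Xb (\<epsilon> Xb))" using \<epsilon> by auto
  then obtain D where D: "D \<subseteq> ?K" "finite D" "?K \<subseteq> (\<Union>Xb\<in>D. ball Xb (\<epsilon> Xb))"
    using compactE_image[OF cK, of ?K "\<lambda>Xb. ball Xb (\<epsilon> Xb)"] by auto
  define \<rho>0 where "\<rho>0 = Max (insert 1 (\<rho>1 ` D))"
  have \<rho>0: "\<rho>0 \<ge> 1" "\<And>Xb. Xb \<in> D \<Longrightarrow> \<rho>1 Xb \<le> \<rho>0" using D(2) by (auto simp: \<rho>0_def)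
  show ?thesis
  proof (intro exI[of _ \<rho>0] conjI allI impI)
    show "\<rho>0 > 0" using \<rho>0 by simp
    fix \<rho> assume \<rho>: "\<rho>0 \<le> \<rho>"
    then have \<rho>pos: "\<rho> > 0" using \<rho>0 by simp
    have sur: "surrogate_objective f \<nu> \<phi> \<rho> X = ereal (F X + \<nu> * rank_penalty G \<rho> X)" if "X \<in> \<Omega>" for X
      unfolding G_def by (rule surrogate_objective_eq[where f = f and X = X, OF h \<rho>pos fF[OF that]])
    have rko: "rank_objective f \<nu> X = ereal (F X + \<nu> * real (rank X))" if "X \<in> \<Omega>" for X
      by (simp add: rank_objective_def fF[OF that])
    show "solution_set \<Omega> (surrogate_objective f \<nu> \<phi> \<rho>) = solution_set \<Omega> (rank_objective f \<nu>)"
    proof (rule solution_set_eq_if_dominated)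
      fix X assume X: "X \<in> \<Omega>"
      show "surrogate_objective f \<nu> \<phi> \<rho> X \<le> rank_objective f \<nu> X"
        using rank_penalty_le_rank[of G, OF G(1,2) \<rho>pos, of X] \<nu> by (simp add: sur[OF X] rko[OF X])
      have "?P \<rho> X"
      proof (cases "X \<in> ?K")
        case True
        then obtain Xb where Xb: "Xb \<in> D" "X \<in> ball Xb (\<epsilon> Xb)" using D(3) by blast
        then have "Xb \<in> \<Omega>" "\<rho>1 Xb \<le> \<rho>" using D(1) \<rho>0(2)[OF Xb(1)] \<rho> by auto
        then show ?thesis using loc[of Xb \<rho> X] X Xb(2) by blast
      next
        case False
        then have "ereal C < f X" using b X by auto
        then have "C < F X" by (simp add: fF[OF X])
        moreover have "real (rank X0) \<le> real CARD('n)" using rank_bound[of X0] by simp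
        then have "F X0 + \<nu> * real (rank X0) \<le> C" using \<nu> by (simp add: C_def)
        moreover have "0 \<le> rank_penalty G \<rho> X"
          unfolding rank_penalty_def
        proof (rule sum_nonneg)
          fix k assume "k \<in> {1..CARD('n)}"
          then have "0 \<le> \<rho> * sing_val k X" using sing_val_nonneg[of k X] \<rho>pos by simp
          then show "0 \<le> G (\<rho> * sing_val k X)"
            using G(3)[of "\<rho> * sing_val k X"] K by (smt (verit) divide_nonneg_nonneg)
        qed
        then have "0 \<le> \<nu> * rank_penalty G \<rho> X" using \<nu> by simp
        ultimately show ?thesis using X0 by (intro disjI2 bexI[of _ X0]) auto
      qed
      then show "surrogate_objective f \<nu> \<phi> \<rho> X = rank_objective f \<nu> X \<or>
          (\<exists>Y\<in>\<Omega>. rank_objective f \<nu> Y < surrogate_objective f \<nu> \<phi> \<rho> X)"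
      proof
        assume "\<exists>Y\<in>\<Omega>. F Y + \<nu> * real (rank Y) < F X + \<nu> * rank_penalty G \<rho> X"
        then obtain Y where "Y \<in> \<Omega>" "F Y + \<nu> * real (rank Y) < F X + \<nu> * rank_penalty G \<rho> X" by blast
        then show ?thesis by (intro disjI2 bexI[of _ Y]) (simp_all add: sur[OF X] rko)
      qed (simp add: sur[OF X] rko[OF X])
    qed
  qed
qed

section \<open>Exact penalty and calm constraint sets\<close>

theorem theorem4p4:
  shows
   "\<comment> \<open>exact penalty, rectangular matrices\<close>
    (CARD('n::finite) \<le> CARD('m::finite) \<longrightarrow>
      (\<forall>(\<Omega> :: (real^'m^'n) set) f \<nu> \<phi>.
         \<Omega> \<noteq> {} \<and> closed \<Omega> \<and>
         bounded_below_on UNIV f \<and> coercive_on \<Omega> f \<and> locally_lipschitz_on \<Omega> f \<and>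
         \<nu> > 0 \<and> \<phi> \<in> phi_class \<and> all_calm \<Omega> \<longrightarrow>
         (\<exists>\<rho>0>0. \<forall>\<rho>\<ge>\<rho>0.
            solution_set \<Omega> (surrogate_objective f \<nu> \<phi> \<rho>) = solution_set \<Omega> (rank_objective f \<nu>)))) \<and>
    \<comment> \<open>exact penalty, symmetric matrices\<close>
    (\<forall>(\<Omega> :: (real^'n^'n) set) f \<nu> \<phi>.
         \<Omega> \<subseteq> sym_mats \<and> \<Omega> \<noteq> {} \<and> closed \<Omega> \<and>
         bounded_below_on sym_mats f \<and> coercive_on \<Omega> f \<and> locally_lipschitz_on \<Omega> f \<and>
         \<nu> > 0 \<and> \<phi> \<in> phi_class \<and> all_calm \<Omega> \<longrightarrow>
         (\<exists>\<rho>0>0. \<forall>\<rho>\<ge>\<rho>0.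
            solution_set \<Omega> (surrogate_objective f \<nu> \<phi> \<rho>) = solution_set \<Omega> (rank_objective f \<nu>))) \<and>
    \<comment> \<open>(1)\<close>
    (CARD('n) \<le> CARD('m) \<longrightarrow>
      (\<forall>(N :: real^'m^'n \<Rightarrow> real) \<rho>. norm_on UNIV N \<and> \<rho> > 0 \<longrightarrow> all_calm {Z. N Z \<le> \<rho>})) \<and>
    (\<forall>(N :: real^'n^'n \<Rightarrow> real) \<rho>. norm_on sym_mats N \<and> \<rho> > 0 \<longrightarrow>
      all_calm {Z \<in> sym_mats. N Z \<le> \<rho>}) \<and>
    (CARD('n) \<le> CARD('m) \<longrightarrow> (\<forall>\<rho>>0. all_calm {Z :: real^'m^'n. norm Z = \<rho>})) \<and>
    (\<forall>\<rho>>0. all_calm {Z \<in> sym_mats :: (real^'n^'n) set. norm Z = \<rho>}) \<and>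
    (\<forall>(N :: real^'n^'n \<Rightarrow> real) \<rho>. norm_on sym_mats N \<and> \<rho> > 0 \<longrightarrow>
      all_calm (psd_mats \<inter> {Z \<in> sym_mats. N Z \<le> \<rho>})) \<and>
    \<comment> \<open>(2)\<close>
    all_calm (psd_mats \<inter> {X \<in> sym_mats :: (real^'n^'n) set. \<forall>i. X $ i $ i = 1}) \<and>
    \<comment> \<open>(3)\<close>
    (\<forall>(B :: real^'n^'n) \<in> sym_mats. \<forall>C \<in> sym_mats. \<forall>b1 b2 :: real.
      b2 \<noteq> 0 \<and> invertible (B - (b1 / b2) *\<^sub>R C) \<longrightarrow>
      all_calm (psd_mats \<inter> {X \<in> sym_mats. B \<bullet> X = b1 \<and> C \<bullet> X = b2})) \<and>
    (\<forall>(C :: real^'n^'n) \<in> sym_mats. \<forall>b2 :: real.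
      b2 \<noteq> 0 \<and> invertible C \<longrightarrow>
      all_calm (psd_mats \<inter> {X \<in> sym_mats. C \<bullet> X = b2})) \<and>
    \<comment> \<open>(4), where the index c plays the role of 1\<close>
    (\<forall>c :: 'n. all_calm (psd_mats \<inter> {X \<in> sym_mats. X $ c $ c = 1 \<and>
      (\<forall>i. i \<noteq> c \<longrightarrow> X $ i $ i - 1 / 2 * (X $ c $ i + X $ i $ c) = 0)})) \<and>
    \<comment> \<open>(5)\<close>
    all_calm (psd_mats \<inter> {X \<in> sym_mats :: (real^('k::finite \<times> 'p::finite)^('k \<times> 'p)) set.
      (\<forall>i. mat 1 \<bullet> block X i i = 1) \<and> (\<forall>i j. i \<noteq> j \<longrightarrow> mat 1 \<bullet> block X i j = 0)}) \<and>
    \<comment> \<open>(6)\<close>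
    all_calm {X :: real^'n^'n. (\<forall>i j. 0 \<le> X $ i $ j) \<and> X *v 1 = 1} \<and>
    \<comment> \<open>(7)\<close>
    all_calm {X :: real^'n^'n. (\<forall>i j. 0 \<le> X $ i $ j) \<and> X *v 1 = 1 \<and> transpose X *v 1 = 1}"
proof (intro conjI impI allI ballI, goal_cases)
  case (1 \<Omega> f \<nu> \<phi>)
  then show ?case by (intro exact_penalty) blast+
next
  case (2 \<Omega> f \<nu> \<phi>)
  then show ?case by (intro exact_penalty) blast+
next
  case (3 N \<rho>)
  then show ?case using all_calm_norm_ball[OF truncatable_cone_UNIV order_refl subspace_UNIV, of N \<rho>] by simp
next
  case (4 N \<rho>)
  then show ?case using all_calm_norm_ball[OF truncatable_cone_sym_mats order_refl subspace_sym_mats] by blast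
next
  case (5 \<rho>)
  then show ?case using all_calm_sphere[OF truncatable_cone_UNIV] by simp
next
  case (6 \<rho>)
  then show ?case by (intro all_calm_sphere[OF truncatable_cone_sym_mats])
next
  case (7 N \<rho>)
  have "psd_mats \<inter> {Z \<in> sym_mats. N Z \<le> \<rho>} = {Z \<in> psd_mats. N Z \<le> \<rho>}"
    by (auto simp: psd_mats_def)
  then show ?case
    using 7 all_calm_norm_ball[OF truncatable_cone_psd_mats _ subspace_sym_mats, of N \<rho>]
    by (auto simp: psd_mats_def)
next
  case 8
  show ?case by (rule all_calm_correlation)
next
  case (9 B C b1 b2)
  have "psd_mats \<inter> {X \<in> sym_mats. B \<bullet> X = b1 \<and> C \<bullet> X = b2} = {X \<in> psd_mats. B \<bullet> X = b1 \<and> C \<bullet> X = b2}"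
    by (auto simp: psd_mats_def)
  then show ?case using 9 all_calm_psd_two_slices[of B C b2 b1] by simp
next
  case (10 C b2)
  have "psd_mats \<inter> {X \<in> sym_mats. C \<bullet> X = b2} = {X \<in> psd_mats. C \<bullet> X = b2}"
    by (auto simp: psd_mats_def)
  then show ?case using 10 all_calm_psd_slice[of b2 C] by simp
next
  case (11 c)
  show ?case by (rule all_calm_lifted_binary)
next
  case 12
  show ?case by (rule all_calm_block_trace)
next
  case 13
  show ?case using all_calm_stochastic unfolding stochastic_mats_def .
next
  case 14
  show ?case using all_calm_doubly_stochastic unfolding doubly_stochastic_mats_def .
qed

end
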